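(* Let $0<\vartheta\le1$ be fixed and such that hypothesis $\mathrm{EH}(\vartheta)$ (defined in the context) holds. Let $h\sim\lambda\log N$ with $\lambda>0$, $\lambda\ll1$, and for $k=2$ or $3$ let $R=N^{\theta_k}$ where $\theta_k$ is fixed and $0<\theta_k<\frac{\vartheta}{k-1}$ (the value $R=N^{\theta_k}$ being used in $\tilde M_k$). Then, as $N\to\infty$, $$\tilde M_1(N,h,\psi_R)\sim\lambda N\log N,\qquad \tilde M_2(N,h,\psi_R)\sim(\theta_2\lambda+\lambda^2)N\log^2N,$$ $$\tilde M_3(N,h,\psi_R)\sim\left(\theta_3^2\lambda+3\theta_3\lambda^2+\lambda^3\right)N\log^3N.$$
   Context: For $n\ge1$ and $R\ge1$, $\lambda_R(n)=\sum_{q\le R}\frac{\mu^2(q)}{\phi(q)}\sum_{d\mid (q,n)}d\,\mu(d)$ (with $\mu$ the Möbius function, $\phi$ Euler's function), and $\lambda_R(n)=0$ for $n\le0$. Put $\psi_R(x)=\sum_{n\le x}\lambda_R(n)$ and $\psi(x)=\sum_{n\le x}\Lambda(n)$, with $\Lambda$ the von Mangoldt function. For a positive integer $h$ and $k\ge2$, $$\tilde M_k(N,h,\psi_R)=\sum_{n=1}^N\bigl(\psi_R(n+h)-\psi_R(n)\bigr)^{k-1}\bigl(\psi(n+h)-\psi(n)\bigr),$$ and $\tilde M_1(N,h,\psi_R)=\sum_{n=1}^N(\psi(n+h)-\psi(n))$ (which does not depend on $R$). (The real parameter $\lambda$ is unrelated to the function $\lambda_R$.) Put $\psi(x;q,a)=\sum_{n\le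 x,\ n\equiv a\,(\mathrm{mod}\ q)}\Lambda(n)$ and $E(x;q,a)=\psi(x;q,a)-[(a,q)=1]\frac{x}{\phi(q)}$, where $[P]$ is $1$ if $P$ is true and $0$ otherwise. Hypothesis $\mathrm{EH}(\vartheta)$: for every $\epsilon'>0$ and every $\mathcal{A}>0$, $$\sum_{1\le q\le x^{\vartheta-\epsilon'}}\max_{(a,q)=1}|E(x;q,a)|\ll\frac{x}{\log^{\mathcal{A}}x}$$ for all sufficiently large $x$. (It holds unconditionally for $\vartheta\le\frac12$ by the Bombieri–Vinogradov theorem.) *)

theory Defs
  imports
    "HOL-Analysis.Analysis"
    "HOL-Computational_Algebra.Squarefree"
    "HOL-Number_Theory.Number_Theory"
    "HOL-Number_Theory.Prime_Powers"
    "HOL-Library.Landau_Symbols"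
begin

definition moebius_mu :: "nat \<Rightarrow> real" where
  "moebius_mu n = (if squarefree n then (-1) ^ card (prime_factors n) else 0)"

definition lambda_R :: "real \<Rightarrow> int \<Rightarrow> real" where
  "lambda_R R n =
     (if n \<le> 0 then 0
      else \<Sum>q = 1..nat \<lfloor>R\<rfloor>. (moebius_mu q)\<^sup>2 / real (totient q) *
             (\<Sum>d | d dvd gcd q (nat n). real d * moebius_mu d))"

(* The sum over all integers n <= x starts at 1 because lambda_R R n = 0 for n <= 0. *)
definition psi_R :: "real \<Rightarrow> real \<Rightarrow> real" where
  "psi_R R x = (\<Sum>n = 1..\<lfloor>x\<rfloor>. lambda_R R n)"

definition psi :: "real \<Rightarrow> real" where
  "psi x = (\<Sum>n = 1..nat \<lfloor>x\<rfloor>. mangoldt n)"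

(* For k = 1 the first factor is a 0-th power, hence 1 (also when its base is 0). *)
definition M_tilde :: "nat \<Rightarrow> nat \<Rightarrow> nat \<Rightarrow> (real \<Rightarrow> real) \<Rightarrow> real" where
  "M_tilde k N h f =
     (\<Sum>n = 1..N. (f (real n + real h) - f (real n)) ^ (k - 1) *
                  (psi (real n + real h) - psi (real n)))"

definition psi_ap :: "real \<Rightarrow> nat \<Rightarrow> nat \<Rightarrow> real" where
  "psi_ap x q a = (\<Sum>n | n \<in> {1..nat \<lfloor>x\<rfloor>} \<and> [n = a] (mod q). mangoldt n)"

definition E_ap :: "real \<Rightarrow> nat \<Rightarrow> nat \<Rightarrow> real" where
  "E_ap x q a = psi_ap x q a - (if coprime a q then x / real (totient q) else 0)"

(* E_ap x q a depends only on the residue class of a modulo q, so the maximum over all a coprime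
   to q is taken over the representatives totatives q (nonempty for every q >= 1).  The implied
   constant and the threshold in O(..), at real x tending to infinity, may depend on e and A. *)
definition EH :: "real \<Rightarrow> bool" where
  "EH \<theta> \<longleftrightarrow> (\<forall>e > 0. \<forall>A > 0.
     (\<lambda>x :: real. \<Sum>q = 1..nat \<lfloor>x powr (\<theta> - e)\<rfloor>. Max ((\<lambda>a. \<bar>E_ap x q a\<bar>) ` totatives q))
       \<in> O[at_top](\<lambda>x. x / (ln x) powr A))"

end

theory Submission
  imports Defs "HOL-Real_Asymp.Real_Asymp"
begin

text \<open>
  For squarefree \<open>q\<close> the inner sum of \<open>lambda_R\<close> is the product over \<open>p\<close> dividing \<open>q\<close> of \<open>sp p n\<close>,
  so that \<open>lambda_R R n\<close> is a sum, over the sets \<open>S\<close> of primes with product at most \<open>R\<close>, of products of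
  the functions \<open>sp p n / (p - 1)\<close>. Expanding these products into indicators of \<open>p dvd n\<close> reduces
  the correlations with the von Mangoldt function to primes in progressions whose moduli are at most
  a power of \<open>N\<close> with exponent below \<open>\<theta>\<close>, and \<open>EH \<theta>\<close> gives, uniformly in the shifts, the main term
  \<open>N * corr X Y a b\<close>. The prime number theorem is the case of modulus 1.

  The function \<open>corr\<close> is a sum over pairs of sets of primes of products of local factors. Each factor
  is periodic with mean value zero and has size about \<open>1 / p^2\<close> except on few residue classes.
  Averaged over the shifts in \<open>{1..h}\<close>, a term is therefore bounded both by a power of \<open>h\<close> smaller
  than the main one (periodicity) and by a convergent series in the primes (gcd sums); interpolating
  between the two bounds shows that only the empty sets contribute. No singular series is needed.
  When two or three of the shifts coincide the local factors are not small, and the resulting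
  powers of \<open>L_sum X \<sim> ln X\<close> give the terms of lower degree in \<open>h\<close>.
\<close>

section \<open>Squarefree numbers as sets of primes\<close>

text \<open>\<open>lam N\<close> may vary with \<open>N\<close> and tend to 0, so \<open>h\<close>
  need not tend to infinity and the top power of \<open>h\<close> need not dominate. Errors must
  therefore be small against \<open>N * h * ln N ^ (k - 1)\<close>, the size of the term of degree
  one in \<open>h\<close>: one factor \<open>h\<close> is always kept, \<open>h powr (7/4)\<close>
  is used as \<open>h\<close> times at most \<open>(C * ln N) powr (3/4)\<close>, and
  \<open>h powr (35/12)\<close> as \<open>h\<close> times at most
  \<open>(C * ln N) powr (23/12)\<close>. Neither bound for a single nonempty set \<open>U\<close>
  suffices alone. Periodicity saves a power of \<open>h\<close> but grows with
  \<open>\<Prod>U\<close>, which runs up to a power of \<open>N\<close>, whereas \<open>h\<close> is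
  only logarithmic. The gcd bound is summable over \<open>U\<close> but saves nothing in
  \<open>h\<close>. A weighted geometric mean keeps both advantages as long as the exponent of
  \<open>\<Prod>U\<close> stays below -1; the weights 1/4 and 1/12 are chosen to leave that margin.
  The gcd bound fails at a zero difference, where the gcd is all of \<open>\<Prod>U\<close>; this
  forces the coincidences among the shifts to be split off first.\<close>

definition prime_sets :: "nat \<Rightarrow> nat set set" where
  "prime_sets X = {S. finite S \<and> (\<forall>p\<in>S. prime p) \<and> \<Prod>S \<le> X}"

lemma prod_primes_pos:
  fixes S :: "nat set"
  assumes "\<And>p. p \<in> S \<Longrightarrow> prime p"
  shows "\<Prod>S > 0"
  using assms by (auto intro!: prod_pos simp: prime_gt_0_nat)

lemma prime_factors_prod_primes:
  fixes S :: "nat set"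
  assumes "finite S" "\<And>p. p \<in> S \<Longrightarrow> prime p"
  shows "prime_factors (\<Prod>S) = S"
proof -
  have "prime_factors (\<Prod>S) = \<Union>((prime_factors \<circ> id) ` S)"
    using prime_factors_prod[of S id] assms(1) assms(2)[of 0] by (auto simp del: in_prime_factors_iff)
  also have "\<dots> = (\<Union>p\<in>S. {p})"
    using assms by (auto simp: prime_factorization_prime)
  finally show ?thesis by simp
qed

lemma squarefree_prod_primes:
  fixes S :: "nat set"
  assumes "finite S" "\<And>p. p \<in> S \<Longrightarrow> prime p"
  shows "squarefree (\<Prod>S)"
  using assms by (intro squarefree_prod_coprime) (auto simp: primes_coprime squarefree_prime)

lemma prod_prime_factors_squarefree:
  assumes "squarefree (n::nat)"
  shows "\<Prod>(prime_factors n) = n"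
proof -
  have "n \<noteq> 0" using assms not_squarefree_0 by metis
  have "n = (\<Prod>p\<in>prime_factors n. p ^ multiplicity p n)"
    using \<open>n \<noteq> 0\<close> by (simp add: prime_factorization_nat)
  also have "\<dots> = (\<Prod>p\<in>prime_factors n. p)"
  proof (intro prod.cong refl)
    fix p assume p: "p \<in> prime_factors n"
    hence "multiplicity p n \<le> 1"
      using assms \<open>n \<noteq> 0\<close> squarefree_factorial_semiring'' by blast
    moreover have "multiplicity p n > 0" using p by (simp add: prime_factors_multiplicity)
    ultimately have "multiplicity p n = 1" by linarith
    thus "p ^ multiplicity p n = p" by simp
  qed
  finally show ?thesis by simp
qed

lemma prod_primes_dvd_iff:
  fixes S :: "nat set" and n :: int
  assumes "finite S" "\<And>p. p \<in> S \<Longrightarrow> prime p"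
  shows "int (\<Prod>S) dvd n \<longleftrightarrow> (\<forall>p\<in>S. int p dvd n)"
  using assms
proof (induction S rule: finite_induct)
  case (insert p S)
  have "coprime (int p) (int (\<Prod>S))"
    unfolding of_nat_prod using insert
    by (intro prod_coprime_right) (auto intro!: primes_coprime)
  moreover have "int (\<Prod>(insert p S)) = int p * int (\<Prod>S)" using insert by simp
  ultimately have "int (\<Prod>(insert p S)) dvd n \<longleftrightarrow> int p dvd n \<and> int (\<Prod>S) dvd n"
    by (metis divides_mult dvd_mult_left dvd_mult_right)
  thus ?case using insert by simp
qed auto

lemma prime_setsD:
  assumes "S \<in> prime_sets X"
  shows "finite S" "p \<in> S \<Longrightarrow> prime p" "\<Prod>S \<le> X"
  using assms by (auto simp: prime_sets_def)

lemma prime_sets_mono: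
  assumes "S \<in> prime_sets X" "T \<subseteq> S"
  shows "T \<in> prime_sets X"
proof -
  have "\<Prod>T dvd \<Prod>S" using assms by (intro prod_dvd_prod_subset) (auto simp: prime_sets_def)
  moreover have "\<Prod>S > 0" using assms by (intro prod_primes_pos) (auto simp: prime_sets_def)
  ultimately have "\<Prod>T \<le> \<Prod>S" by (intro dvd_imp_le)
  thus ?thesis using assms by (auto simp: prime_sets_def intro: finite_subset)
qed

lemma finite_prime_sets [simp, intro]: "finite (prime_sets X)"
proof (rule finite_subset)
  show "prime_sets X \<subseteq> Pow {..X}"
  proof safe
    fix S p assume S: "S \<in> prime_sets X" and p: "p \<in> S"
    hence "{p} \<in> prime_sets X" by (intro prime_sets_mono[OF S]) auto
    thus "p \<le> X" by (auto simp: prime_sets_def)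
  qed
qed auto

lemma empty_in_prime_sets [simp]: "{} \<in> prime_sets X \<longleftrightarrow> X \<ge> 1"
  by (auto simp: prime_sets_def)

lemma prime_sets_1: "prime_sets (Suc 0) = {{}}"
proof (intro equalityI subsetI)
  fix S assume S: "S \<in> prime_sets (Suc 0)"
  show "S \<in> {{}}"
  proof (cases "S = {}")
    case False
    then obtain p where "p \<in> S" by auto
    with S have "{p} \<in> prime_sets (Suc 0)" by (intro prime_sets_mono[OF S]) auto
    thus ?thesis by (auto simp: prime_sets_def dest: prime_gt_1_nat)
  qed auto
qed auto

lemma inj_on_Prod_prime_sets: "inj_on \<Prod> (prime_sets X)"
  by (rule inj_on_Prod_primes) (auto dest: prime_setsD)

lemma Prod_prime_sets_ge_1: "S \<in> prime_sets X \<Longrightarrow> \<Prod>S \<ge> 1"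
  using prod_primes_pos[of S] prime_setsD(2)[of S X] by (simp add: Suc_leI)

lemma bij_betw_Prod_prime_sets:
  "bij_betw \<Prod> (prime_sets X) {q \<in> {1..X}. squarefree q}"
  unfolding bij_betw_def
proof (intro conjI inj_on_Prod_prime_sets equalityI subsetI)
  fix q assume "q \<in> \<Prod> ` prime_sets X"
  thus "q \<in> {q \<in> {1..X}. squarefree q}"
    using squarefree_prod_primes Prod_prime_sets_ge_1 by (auto simp: prime_sets_def)
next
  fix q assume q: "q \<in> {q \<in> {1..X}. squarefree q}"
  hence "prime_factors q \<in> prime_sets X"
    by (auto simp: prime_sets_def prod_prime_factors_squarefree)
  thus "q \<in> \<Prod> ` prime_sets X" using q prod_prime_factors_squarefree[of q]
    by (metis (mono_tags, lifting) image_iff mem_Collect_eq)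
qed

lemma sum_prime_sets_le:
  fixes f :: "nat \<Rightarrow> real"
  assumes "\<And>n. n \<in> {1..X} \<Longrightarrow> f n \<ge> 0"
  shows "(\<Sum>S\<in>prime_sets X. f (\<Prod>S)) \<le> (\<Sum>n=1..X. f n)"
proof -
  have "(\<Sum>S\<in>prime_sets X. f (\<Prod>S)) = (\<Sum>q | q \<in> {1..X} \<and> squarefree q. f q)"
    by (rule sum.reindex_bij_betw) (use bij_betw_Prod_prime_sets[of X] in simp)
  also have "\<dots> \<le> (\<Sum>n=1..X. f n)"
    using assms by (intro sum_mono2) auto
  finally show ?thesis .
qed

text \<open>This is minus the Ramanujan sum modulo \<open>p\<close>, that is
  \<open>1 - p * [p dvd n]\<close>: it sums to 0 over a period and is large on one residue class
  only.\<close>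

definition sp :: "nat \<Rightarrow> int \<Rightarrow> real" where
  "sp p n = (if int p dvd n then 1 - real p else 1)"

text \<open>Unlike \<open>lambda_R\<close> there is no cut-off at \<open>n \<le> 0\<close>, so the
  function remains periodic when a shift moves its argument to 0 or below, as happens from
  \<open>corr_sum_shift\<close> on.\<close>

definition lam_sets :: "nat \<Rightarrow> int \<Rightarrow> real" where
  "lam_sets X n = (\<Sum>S\<in>prime_sets X. \<Prod>p\<in>S. sp p n / (real p - 1))"

lemma totient_prod_primes:
  fixes S :: "nat set"
  assumes "finite S" "\<And>p. p \<in> S \<Longrightarrow> prime p"
  shows "real (totient (\<Prod>S)) = (\<Prod>p\<in>S. real p - 1)"
proof -
  have "totient (prod id S) = (\<Prod>p\<in>S. totient (id p))"
    using assms by (intro totient_prod_coprime) (auto simp: primes_coprime pairwise_def)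
  also have "real \<dots> = (\<Prod>p\<in>S. real p - 1)"
    unfolding of_nat_prod using assms
    by (intro prod.cong) (auto simp: totient_prime of_nat_diff Suc_leI prime_gt_0_nat)
  finally show ?thesis by simp
qed

lemma moebius_mu_prod_primes:
  fixes S :: "nat set"
  assumes "finite S" "\<And>p. p \<in> S \<Longrightarrow> prime p"
  shows "moebius_mu (\<Prod>S) = (-1) ^ card S"
  using assms by (simp add: moebius_mu_def squarefree_prod_primes prime_factors_prod_primes)

lemma divisors_prod_primes:
  fixes S :: "nat set"
  assumes "finite S" "\<And>p. p \<in> S \<Longrightarrow> prime p"
  shows "bij_betw \<Prod> (Pow S) {d. d dvd \<Prod>S}"
  unfolding bij_betw_def
proof (intro conjI equalityI subsetI)
  show "inj_on \<Prod> (Pow S)"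
    by (rule inj_on_Prod_primes) (use assms in \<open>auto intro: finite_subset\<close>)
next
  fix d assume "d \<in> \<Prod> ` Pow S"
  thus "d \<in> {d. d dvd \<Prod>S}" using assms by (auto intro!: prod_dvd_prod_subset)
next
  fix d assume "d \<in> {d. d dvd \<Prod>S}"
  hence d: "d dvd \<Prod>S" by simp
  have sf: "squarefree d" using squarefree_mono[OF d] squarefree_prod_primes assms by blast
  have "prime_factors d \<subseteq> prime_factors (\<Prod>S)"
    using d prod_primes_pos[of S] assms by (intro dvd_prime_factors) auto
  hence "prime_factors d \<in> Pow S" using prime_factors_prod_primes assms by auto
  thus "d \<in> \<Prod> ` Pow S" using prod_prime_factors_squarefree[OF sf] by (metis image_eqI)
qed

lemma gcd_prod_primes:
  fixes S :: "nat set"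
  assumes "finite S" "\<And>p. p \<in> S \<Longrightarrow> prime p"
  shows "gcd (\<Prod>S) n = \<Prod>{p\<in>S. p dvd n}"
proof -
  have "gcd (\<Prod>S) n dvd \<Prod>S" by simp
  then obtain T where T: "T \<subseteq> S" "gcd (\<Prod>S) n = \<Prod>T"
    using divisors_prod_primes[OF assms] by (auto simp: bij_betw_def)
  have finT: "finite T" using T assms finite_subset by blast
  have "p \<in> T \<longleftrightarrow> p \<in> S \<and> p dvd n" for p
  proof (cases "prime p \<and> p \<in> S")
    case True
    hence "p dvd \<Prod>S" using assms by (auto intro: dvd_prodI)
    hence "p dvd n \<longleftrightarrow> p dvd \<Prod>T" unfolding T(2)[symmetric] by auto
    also have "\<dots> \<longleftrightarrow> p \<in> prime_factors (\<Prod>T)"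
      using True prod_primes_pos[of T] T assms by (subst in_prime_factors_iff) auto
    also have "prime_factors (\<Prod>T) = T"
      using T assms finT by (intro prime_factors_prod_primes) auto
    finally show ?thesis using True by auto
  next
    case False
    thus ?thesis using T assms by auto
  qed
  hence "T = {p\<in>S. p dvd n}" by auto
  thus ?thesis using T by simp
qed

lemma sum_Pow_prod:
  fixes f :: "'a \<Rightarrow> real"
  assumes "finite S"
  shows "(\<Sum>T\<in>Pow S. \<Prod>p\<in>T. f p) = (\<Prod>p\<in>S. 1 + f p)"
  using prod_add[OF assms, of f "\<lambda>_. 1"] by (simp add: add.commute)

lemma lambda_R_eq_lam_sets:
  assumes "n > 0"
  shows "lambda_R R n = lam_sets (nat \<lfloor>R\<rfloor>) n"
proof -
  define g where "g q = (moebius_mu q)\<^sup>2 / real (totient q) *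
             (\<Sum>d | d dvd gcd q (nat n). real d * moebius_mu d)" for q
  have dv: "int p dvd n \<longleftrightarrow> p dvd nat n" for p
    using assms int_dvd_int_iff[of p "nat n"] by simp
  have g0: "g q = 0" if "\<not>squarefree q" for q
    using that by (simp add: g_def moebius_mu_def)
  have gS: "g (\<Prod>S) = (\<Prod>p\<in>S. sp p n / (real p - 1))" if S: "S \<in> prime_sets X" for S X
  proof -
    note S' = prime_setsD(1,2)[OF S]
    define T where "T = {p\<in>S. p dvd nat n}"
    have T: "finite T" "\<And>p. p \<in> T \<Longrightarrow> prime p" using S' by (auto simp: T_def)
    have "(\<Sum>d | d dvd gcd (\<Prod>S) (nat n). real d * moebius_mu d)
        = (\<Sum>d | d dvd \<Prod>T. real d * moebius_mu d)"
      using gcd_prod_primes[of S "nat n"] S' by (simp add: T_def)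
    also have "\<dots> = (\<Sum>U\<in>Pow T. real (\<Prod>U) * moebius_mu (\<Prod>U))"
      by (rule sum.reindex_bij_betw[symmetric]) (use divisors_prod_primes[OF T] in simp)
    also have "\<dots> = (\<Sum>U\<in>Pow T. \<Prod>p\<in>U. - real p)"
    proof (intro sum.cong refl)
      fix U assume "U \<in> Pow T"
      hence U: "finite U" "\<And>p. p \<in> U \<Longrightarrow> prime p" using T by (auto intro: finite_subset)
      have "(\<Prod>p\<in>U. - real p) = (-1) ^ card U * (\<Prod>p\<in>U. real p)"
        by (rule prod_uminus)
      thus "real (\<Prod>U) * moebius_mu (\<Prod>U) = (\<Prod>p\<in>U. - real p)"
        using moebius_mu_prod_primes[OF U] by simp
    qed
    also have "\<dots> = (\<Prod>p\<in>T. 1 - real p)" by (subst sum_Pow_prod) (use T in auto)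
    also have "\<dots> = (\<Prod>p\<in>S. sp p n)"
      using assms S' unfolding T_def
      by (intro prod.mono_neutral_cong_left) (auto simp: sp_def dv)
    finally show ?thesis
      using S' by (simp add: g_def moebius_mu_prod_primes totient_prod_primes prod_dividef power_mult_distrib flip: power_mult)
  qed
  have "lambda_R R n = (\<Sum>q = 1..nat \<lfloor>R\<rfloor>. g q)"
    using assms by (simp add: lambda_R_def g_def)
  also have "\<dots> = (\<Sum>q | q \<in> {1..nat \<lfloor>R\<rfloor>} \<and> squarefree q. g q)"
    using g0 by (intro sum.mono_neutral_right) auto
  also have "\<dots> = (\<Sum>S\<in>prime_sets (nat \<lfloor>R\<rfloor>). g (\<Prod>S))"
    by (rule sum.reindex_bij_betw[symmetric]) (use bij_betw_Prod_prime_sets in simp)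
  also have "\<dots> = lam_sets (nat \<lfloor>R\<rfloor>) n"
    unfolding lam_sets_def using gS by (intro sum.cong) auto
  finally show ?thesis .
qed

section \<open>Sums over sets of primes\<close>

lemma prod_of_nat_nonneg [simp]: "0 \<le> prod real S"
  by (simp add: prod_nonneg)

text \<open>A prime with \<open>p powr \<delta> \<ge> C\<close> pays for its own factor
  \<open>C\<close>. The others are at most \<open>M\<close>, and \<open>{..M}\<close> has
  \<open>Suc M\<close> elements, which gives the constant \<open>C ^ Suc M\<close>.\<close>

lemma power_card_le_powr:
  fixes C \<delta> :: real
  assumes "C \<ge> 1" "\<delta> > 0"
  shows "\<exists>K>0. \<forall>S :: nat set. finite S \<longrightarrow> (\<forall>p\<in>S. prime p) \<longrightarrow> C ^ card S \<le> K * real (\<Prod>S) powr \<delta>"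
proof -
  define M where "M = nat \<lceil>C powr (1 / \<delta>)\<rceil>"
  have M: "real p powr \<delta> \<ge> C" if "p > M" for p
  proof -
    have "C powr (1 / \<delta>) \<le> real p" using that unfolding M_def by linarith
    hence "(C powr (1 / \<delta>)) powr \<delta> \<le> real p powr \<delta>" using assms by (intro powr_mono2) auto
    thus ?thesis using assms by (simp add: powr_powr)
  qed
  have "C ^ card S \<le> C ^ Suc M * real (\<Prod>S) powr \<delta>"
    if S: "finite S" "\<forall>p\<in>S. prime p" for S :: "nat set"
  proof -
    have "C ^ card S = (\<Prod>p\<in>S. C)" by simp
    also have "\<dots> \<le> (\<Prod>p\<in>S. (if p \<le> M then C else 1) * real p powr \<delta>)"
    proof (intro prod_mono conjI)
      fix p assume "p \<in> S"
      hence "real p \<ge> 1" using S prime_ge_1_nat by auto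
      hence "real p powr \<delta> \<ge> 1" using assms by (intro ge_one_powr_ge_zero) auto
      thus "C \<le> (if p \<le> M then C else 1) * real p powr \<delta>" using M[of p] assms by auto
    qed (use assms in auto)
    also have "\<dots> = (\<Prod>p\<in>S. if p \<le> M then C else 1) * real (\<Prod>S) powr \<delta>"
      by (simp add: prod.distrib prod_powr_distrib)
    also have "(\<Prod>p\<in>S. if p \<le> M then C else 1) = (\<Prod>p\<in>S \<inter> {..M}. C)"
      using S by (intro prod.mono_neutral_cong_right) auto
    also have "\<dots> = C ^ card (S \<inter> {..M})" by simp
    also have "\<dots> \<le> C ^ Suc M"
      using assms card_mono[of "{..M}" "S \<inter> {..M}"] by (intro power_increasing) auto
    finally show ?thesis by (simp add: mult_right_mono)
  qed
  thus ?thesis using assms by (intro exI[of _ "C ^ Suc M"]) auto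
qed

lemma sum_prime_sets_powr_le:
  fixes \<alpha> :: real
  assumes "\<alpha> > 1"
  shows "\<exists>K>0. \<forall>X. (\<Sum>S\<in>prime_sets X. real (\<Prod>S) powr (-\<alpha>)) \<le> K"
proof -
  define K where "K = (\<Sum>n. real n powr (-\<alpha>))"
  have summ: "summable (\<lambda>n. real n powr (-\<alpha>))"
    using assms by (subst summable_real_powr_iff) auto
  have "(\<Sum>S\<in>prime_sets X. real (\<Prod>S) powr (-\<alpha>)) \<le> \<bar>K\<bar> + 1" for X
  proof -
    have "(\<Sum>S\<in>prime_sets X. real (\<Prod>S) powr (-\<alpha>)) \<le> (\<Sum>n=1..X. real n powr (-\<alpha>))"
      by (rule sum_prime_sets_le) auto
    also have "\<dots> \<le> K" unfolding K_def
      by (rule sum_le_suminf[OF summ]) auto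
    finally show ?thesis by simp
  qed
  thus ?thesis by (intro exI[of _ "\<bar>K\<bar> + 1"]) auto
qed

text \<open>The map from \<open>(S, T)\<close> to \<open>(T, S - T)\<close> is injective with both
  parts again in \<open>prime_sets X\<close>; nonnegativity pays for the pairs that are not reached.
  This replaces multiplicativity of Dirichlet convolution by an inequality that respects the bound
  \<open>X\<close>.\<close>

lemma sum_prime_sets_split_le:
  fixes f g :: "nat set \<Rightarrow> real"
  assumes "\<And>S. S \<in> prime_sets X \<Longrightarrow> f S \<ge> 0" "\<And>S. S \<in> prime_sets X \<Longrightarrow> g S \<ge> 0"
  shows "(\<Sum>S\<in>prime_sets X. \<Sum>T\<in>Pow S. f T * g (S - T))
           \<le> (\<Sum>S\<in>prime_sets X. f S) * (\<Sum>S\<in>prime_sets X. g S)"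
proof -
  define h where "h = (\<lambda>(S :: nat set, T). (T, S - T))"
  have inj: "inj_on h (Sigma (prime_sets X) Pow)"
    by (auto simp: inj_on_def h_def)
  have "(\<Sum>S\<in>prime_sets X. \<Sum>T\<in>Pow S. f T * g (S - T))
      = (\<Sum>(S,T)\<in>Sigma (prime_sets X) Pow. f T * g (S - T))"
    by (subst sum.Sigma) (auto dest: prime_setsD)
  also have "\<dots> = (\<Sum>x\<in>Sigma (prime_sets X) Pow. case h x of (T, U) \<Rightarrow> f T * g U)"
    by (intro sum.cong) (auto simp: h_def)
  also have "\<dots> = (\<Sum>(T,U)\<in>h ` Sigma (prime_sets X) Pow. f T * g U)"
    by (subst sum.reindex[OF inj]) simp
  also have "\<dots> \<le> (\<Sum>(T,U)\<in>prime_sets X \<times> prime_sets X. f T * g U)"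
  proof (rule sum_mono2)
    show "h ` Sigma (prime_sets X) Pow \<subseteq> prime_sets X \<times> prime_sets X"
      by (auto simp: h_def intro: prime_sets_mono)
  qed (use assms in auto)
  also have "\<dots> = (\<Sum>S\<in>prime_sets X. f S) * (\<Sum>S\<in>prime_sets X. g S)"
    by (simp add: sum_product sum.cartesian_product)
  finally show ?thesis .
qed

lemma sum_inverse_le: "X \<ge> 1 \<Longrightarrow> (\<Sum>n=1..X. 1 / real n) \<le> 1 + ln (real X)"
  using decseqD[OF decseq_harm_diff_ln, of 0 "X - 1"] by (simp add: harm_def inverse_eq_divide)

text \<open>\<open>(C + 1) ^ card S\<close> is the sum of \<open>C ^ card T\<close> over the subsets
  \<open>T\<close> of \<open>S\<close>, so each induction step splits off one sum of reciprocals,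
  which is at most a harmonic sum.\<close>

lemma sum_power_card_div_le:
  assumes "X \<ge> 1"
  shows "(\<Sum>S\<in>prime_sets X. real C ^ card S / real (\<Prod>S)) \<le> (1 + ln (real X)) ^ C"
proof (induction C)
  case 0
  have "(\<Sum>S\<in>prime_sets X. real 0 ^ card S / real (\<Prod>S)) = (\<Sum>S\<in>{{} :: nat set}. 1)"
    using assms by (intro sum.mono_neutral_cong_right) (auto simp: card_gt_0_iff dest: prime_setsD)
  thus ?case by simp
next
  case (Suc C)
  have "(\<Sum>S\<in>prime_sets X. real (Suc C) ^ card S / real (\<Prod>S))
      = (\<Sum>S\<in>prime_sets X. \<Sum>T\<in>Pow S. real C ^ card T / real (\<Prod>T) * (1 / real (\<Prod>(S - T))))"
  proof (intro sum.cong refl)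
    fix S assume S: "S \<in> prime_sets X"
    note S' = prime_setsD[OF S]
    have "real (Suc C) ^ card S = (\<Sum>T\<in>Pow S. real C ^ card T)"
      using sum_Pow_prod[of S "\<lambda>_. real C"] S' by simp
    moreover have "real (\<Prod>S) = real (\<Prod>T) * real (\<Prod>(S - T))" if "T \<in> Pow S" for T
      using prod.subset_diff[of T S "\<lambda>x. x"] that S' by simp
    ultimately show "real (Suc C) ^ card S / real (\<Prod>S)
       = (\<Sum>T\<in>Pow S. real C ^ card T / real (\<Prod>T) * (1 / real (\<Prod>(S - T))))"
      unfolding sum_divide_distrib
      by (simp add: sum_divide_distrib)
  qed
  also have "\<dots> \<le> (\<Sum>S\<in>prime_sets X. real C ^ card S / real (\<Prod>S)) * (\<Sum>S\<in>prime_sets X. 1 / real (\<Prod>S))"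
    by (rule sum_prime_sets_split_le; intro divide_nonneg_nonneg zero_le_power of_nat_0_le_iff zero_le_one)
  also have "\<dots> \<le> (1 + ln (real X)) ^ C * (1 + ln (real X))"
  proof (intro mult_mono Suc.IH)
    have "(\<Sum>S\<in>prime_sets X. 1 / real (\<Prod>S)) \<le> (\<Sum>n=1..X. 1 / real n)"
      by (rule sum_prime_sets_le) auto
    thus "(\<Sum>S\<in>prime_sets X. 1 / real (\<Prod>S)) \<le> 1 + ln (real X)"
      using sum_inverse_le[OF assms] by linarith
    show "0 \<le> (\<Sum>S\<in>prime_sets X. 1 / real (\<Prod>S))"
      by (intro sum_nonneg divide_nonneg_nonneg of_nat_0_le_iff) simp
  qed (use assms in simp)
  finally show ?case by (simp add: mult.commute)
qed

section \<open>The sum of 1 / phi(q) over squarefree q and its asymptotics\<close>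

definition prime_wt :: "nat set \<Rightarrow> real" where
  "prime_wt S = (\<Prod>p\<in>S. 1 / (real p - 1))"

text \<open>For sets of primes \<open>prime_wt S\<close> is \<open>1 / totient (\<Prod>S)\<close>,
  so this is the classical sum of mu^2(q) / phi(q). It is the value of the main term when a shift
  coincides with that of the prime variable.\<close>

definition L_sum :: "nat \<Rightarrow> real" where
  "L_sum X = (\<Sum>S\<in>prime_sets X. prime_wt S)"

lemma prime_minus_1_ge: "prime p \<Longrightarrow> real p - 1 \<ge> real p / 2"
  using prime_ge_2_nat[of p] by simp

lemma prime_wt_pos:
  assumes "\<And>p. p \<in> S \<Longrightarrow> prime p"
  shows "prime_wt S > 0"
  unfolding prime_wt_def using assms by (intro prod_pos) (metis prime_gt_1_nat diff_gt_0_iff_gt of_nat_1 of_nat_less_iff zero_less_divide_1_iff)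

lemma prime_wt_le:
  assumes "\<And>p. p \<in> S \<Longrightarrow> prime p"
  shows "prime_wt S \<le> 2 ^ card S / real (\<Prod>S)"
proof -
  have "prime_wt S \<le> (\<Prod>p\<in>S. 2 / real p)"
    unfolding prime_wt_def
  proof (intro prod_mono conjI)
    fix p assume "p \<in> S"
    hence p: "prime p" using assms by auto
    hence "real p > 1" using prime_gt_1_nat by simp
    thus "1 / (real p - 1) \<le> 2 / real p" "0 \<le> 1 / (real p - 1)"
      using prime_minus_1_ge[OF p] by (auto simp: field_simps)
  qed
  also have "\<dots> = 2 ^ card S / real (\<Prod>S)" by (simp add: prod_dividef)
  finally show ?thesis .
qed

lemma prime_wt_Un:
  assumes "finite S" "finite T" "S \<inter> T = {}"
  shows "prime_wt (S \<union> T) = prime_wt S * prime_wt T"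
  using assms by (simp add: prime_wt_def prod.union_disjoint)

lemma L_sum_nonneg: "L_sum X \<ge> 0"
  unfolding L_sum_def by (intro sum_nonneg less_imp_le prime_wt_pos) (auto dest: prime_setsD)

text \<open>Crude, but valid for every \<open>X \<ge> 1\<close> without a limit process; it suffices
  where a fixed power of the logarithm is harmless. The exponent 2 comes from
  \<open>p - 1 \<ge> p / 2\<close>.\<close>

lemma L_sum_le: "X \<ge> 1 \<Longrightarrow> L_sum X \<le> (1 + ln (real X)) ^ 2"
proof -
  assume X: "X \<ge> 1"
  have "L_sum X \<le> (\<Sum>S\<in>prime_sets X. real 2 ^ card S / real (\<Prod>S))"
    unfolding L_sum_def using prime_wt_le by (intro sum_mono) (auto dest: prime_setsD)
  also have "\<dots> \<le> (1 + ln (real X)) ^ 2" by (rule sum_power_card_div_le[OF X])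
  finally show ?thesis .
qed

text \<open>Group the \<open>n \<le> X\<close> by their set of prime factors: the \<open>n\<close> whose set of prime factors is \<open>S\<close>
  contribute at most \<open>\<Prod>p\<in>S. (1/p + 1/p^2 + \<dots>)\<close>.\<close>

lemma sum_inverse_prime_factors_le:
  assumes "finite S" "\<And>p. p \<in> S \<Longrightarrow> prime p" "finite A" "\<And>n. n \<in> A \<Longrightarrow> n > 0 \<and> prime_factors n = S"
  shows "(\<Sum>n\<in>A. 1 / real n) \<le> prime_wt S"
  using assms
proof (induction S arbitrary: A rule: finite_induct)
  case empty
  have "A \<subseteq> {1}"
    using empty by (auto simp: prime_factorization_empty_iff)
  hence "A = {} \<or> A = {1}" by auto
  thus ?case by (auto simp: prime_wt_def)
next
  case (insert p S A)
  have p: "prime p" using insert by auto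
  define k where "k n = multiplicity p n" for n
  define m where "m n = n div p ^ k n" for n
  have dec: "n = p ^ k n * m n" and m0: "m n > 0" and pm: "\<not> p dvd m n" and k0: "k n > 0" if "n \<in> A" for n
  proof -
    have n: "n > 0" "prime_factors n = insert p S" using insert.prems that by auto
    have "p ^ k n dvd n" unfolding k_def by (rule multiplicity_dvd)
    thus *: "n = p ^ k n * m n" unfolding m_def by simp
    thus "m n > 0" using n by (metis gr0I mult_0_right)
    show "\<not> p dvd m n"
      using n p unfolding m_def k_def
      by (metis multiplicity_decompose prime_gt_1_nat  less_numeral_extra(4) not_prime_unit neq0_conv)
    have "p \<in> prime_factors n" using n by auto
    thus "k n > 0" unfolding k_def using p by (simp add: prime_factors_multiplicity)
  qed
  have pf: "prime_factors (m n) = S" if "n \<in> A" for n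
  proof -
    have "insert p S = prime_factors (p ^ k n * m n)" using dec[OF that] insert.prems that by auto
    also have "\<dots> = prime_factors (p ^ k n) \<union> prime_factors (m n)"
      using m0[OF that] p by (intro prime_factors_product) auto
    also have "prime_factors (p ^ k n) = {p}"
      using k0[OF that] p by (simp add: prime_factors_power prime_prime_factors)
    finally have "insert p S = insert p (prime_factors (m n))" by simp
    moreover have "p \<notin> prime_factors (m n)" using pm[OF that] by auto
    ultimately show ?thesis using insert.hyps by (metis insert_ident)
  qed
  \<comment> \<open>Inserting 1 keeps \<open>Max\<close> defined for empty \<open>A\<close>. The
    exponents \<open>k n\<close> start at 1, so the geometric series below sums to
    \<open>1 / (p - 1)\<close>.\<close>
  define K where "K = Max (insert 1 (k ` A))"
  have kK: "k n \<in> {1..K}" if "n \<in> A" for n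
    using k0[OF that] insert.prems that by (auto simp: K_def Suc_le_eq intro!: Max_ge)
  have inj: "inj_on (\<lambda>n. (k n, m n)) A"
    by (rule inj_onI) (metis dec prod.inject)
  have "(\<Sum>n\<in>A. 1 / real n) = (\<Sum>n\<in>A. (1 / real p) ^ k n * (1 / real (m n)))"
  proof (intro sum.cong refl)
    fix n assume "n \<in> A"
    hence "real n = real p ^ k n * real (m n)"
      using dec[of n] by (metis of_nat_mult of_nat_power)
    thus "1 / real n = (1 / real p) ^ k n * (1 / real (m n))" by (simp add: power_one_over)
  qed
  also have "\<dots> = (\<Sum>(i,j)\<in>(\<lambda>n. (k n, m n)) ` A. (1 / real p) ^ i * (1 / real j))"
    by (subst sum.reindex[OF inj]) simp
  also have "\<dots> \<le> (\<Sum>(i,j)\<in>{1..K} \<times> m ` A. (1 / real p) ^ i * (1 / real j))"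
    using kK insert.prems by (intro sum_mono2) auto
  also have "\<dots> = (\<Sum>i=1..K. (1 / real p) ^ i) * (\<Sum>j\<in>m ` A. 1 / real j)"
    by (simp add: sum_product sum.cartesian_product)
  also have "\<dots> \<le> 1 / (real p - 1) * prime_wt S"
  proof (intro mult_mono)
    have p1: "real p > 1" using p prime_gt_1_nat by simp
    have "(\<Sum>i=1..K. (1 / real p) ^ i) \<le> (\<Sum>i. (1 / real p) ^ Suc i)"
    proof -
      have "(\<Sum>i=1..K. (1 / real p) ^ i) = (\<Sum>i<K. (1 / real p) ^ Suc i)"
        by (rule sum.reindex_bij_witness[of _ Suc "\<lambda>i. i - 1"]) auto
      also have "\<dots> \<le> (\<Sum>i. (1 / real p) ^ Suc i)"
        using p1 by (intro sum_le_suminf) (auto intro!: summable_mult summable_geometric)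
      finally show ?thesis .
    qed
    also have "\<dots> = (1 / real p) * (1 / (1 - 1 / real p))"
      unfolding power_Suc using p1 by (subst suminf_mult) (auto simp: suminf_geometric summable_geometric)
    also have "\<dots> = 1 / (real p - 1)" using p1 by (simp add: field_simps)
    finally show "(\<Sum>i=1..K. (1 / real p) ^ i) \<le> 1 / (real p - 1)" .
    show "(\<Sum>j\<in>m ` A. 1 / real j) \<le> prime_wt S"
      using insert.prems pf m0 by (intro insert.IH) auto
  qed (use p in \<open>auto intro!: sum_nonneg dest: prime_gt_1_nat\<close>)
  also have "\<dots> = prime_wt (insert p S)" using insert.hyps by (simp add: prime_wt_def)
  finally show ?case .
qed

text \<open>The prime factors of \<open>n \<le> X\<close> have product at most \<open>n\<close>,
  hence form a member of \<open>prime_sets X\<close>; grouping the harmonic sum by these sets embeds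
  it into \<open>L_sum X\<close>.\<close>

lemma L_sum_ge:
  assumes "X \<ge> 1"
  shows "L_sum X \<ge> ln (real X)"
proof -
  have "ln (real X) \<le> ln (real X + 1)" using assms by simp
  also have "\<dots> \<le> harm X" by (rule ln_le_harm)
  also have "harm X = (\<Sum>n\<in>{1..X}. 1 / real n)" by (simp add: harm_def field_simps)
  also have "\<dots> \<le> (\<Sum>S\<in>prime_sets X. \<Sum>n | n \<in> {1..X} \<and> prime_factors n = S. 1 / real n)"
  proof (subst sum.group)
    show "prime_factors ` {1..X} \<subseteq> prime_sets X"
    proof safe
      fix n assume n: "n \<in> {1..X}"
      have "\<Prod>(prime_factors n) dvd n"
      proof -
        have "int (\<Prod>(prime_factors n)) dvd int n"
          by (subst prod_primes_dvd_iff) auto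
        thus ?thesis using int_dvd_int_iff by blast
      qed
      hence "\<Prod>(prime_factors n) \<le> n" using n by (intro dvd_imp_le) auto
      thus "prime_factors n \<in> prime_sets X" using n by (auto simp: prime_sets_def)
    qed
  qed auto
  also have "\<dots> \<le> L_sum X"
    unfolding L_sum_def
    by (intro sum_mono sum_inverse_prime_factors_le) (auto dest: prime_setsD)
  finally show ?thesis .
qed

text \<open>Cut \<open>{1..X}\<close> into blocks of length \<open>k\<close>. Each block holds at
  most \<open>totient k\<close> admissible \<open>n\<close>; in block \<open>t \<ge> 1\<close> each
  reciprocal is at most \<open>1 / (t * k)\<close>, and block 0 costs at most
  \<open>totient k \<le> k\<close>.\<close>

lemma sum_inverse_coprime_le:
  fixes k X :: nat
  assumes "k \<ge> 1" "X \<ge> 1"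
  shows "(\<Sum>n=1..X. if coprime n k then 1 / real n else 0)
           \<le> real (totient k) / real k * (1 + ln (real X)) + real k"
proof -
  define g where "g = (\<lambda>(t, r). if coprime r k then (if t = 0 then 1 else 1 / (real t * real k)) else 0)"
  \<comment> \<open>Remainders run through \<open>1..k\<close> instead of \<open>0..k - 1\<close>,
    to match \<open>totatives k\<close>.\<close>
  define h where "h n = ((n - 1) div k, (n - 1) mod k + 1)" for n
  have dec: "n = fst (h n) * k + snd (h n)" if "n \<ge> 1" for n
    using that by (simp add: h_def)
  have inj: "inj_on h {1..X}"
    by (rule inj_onI) (metis dec atLeastAtMost_iff)
  have "(\<Sum>n=1..X. if coprime n k then 1 / real n else 0) \<le> (\<Sum>n=1..X. g (h n))"
  proof (intro sum_mono)
    fix n assume n: "n \<in> {1..X}"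
    define t r where "t = fst (h n)" and "r = snd (h n)"
    have nn: "n = t * k + r" using dec[of n] n by (simp add: t_def r_def)
    have "coprime n k \<longleftrightarrow> coprime r k"
      unfolding nn by (metis coprime_iff_gcd_eq_1 gcd_add_mult gcd.commute add.commute)
    moreover have "1 / real n \<le> (if t = 0 then 1 else 1 / (real t * real k))"
    proof (cases "t = 0")
      case False
      have "real t * real k \<le> real n" using nn by simp
      moreover have "real t * real k > 0" using False assms by simp
      ultimately show ?thesis using False by (simp add: frac_le)
    qed (use n in auto)
    ultimately show "(if coprime n k then 1 / real n else 0) \<le> g (h n)"
      by (auto simp: g_def t_def r_def case_prod_beta)
  qed
  also have "\<dots> = sum g (h ` {1..X})" by (subst sum.reindex[OF inj]) simp
  also have "\<dots> \<le> sum g ({0..X} \<times> {1..k})"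
  proof (rule sum_mono2)
    show "h ` {1..X} \<subseteq> {0..X} \<times> {1..k}"
    proof safe
      fix n t r assume "(t, r) = h n" and n: "n \<in> {1..X}"
      moreover have "(n - 1) div k \<le> X"
        using div_le_dividend[of "n - 1" k] n unfolding atLeastAtMost_iff by linarith
      ultimately show "t \<in> {0..X}" "r \<in> {1..k}"
        using assms by (auto simp: h_def Suc_le_eq)
    qed
  qed (auto simp: g_def)
  also have "\<dots> = (\<Sum>t=0..X. \<Sum>r=1..k. g (t, r))" by (simp add: sum.cartesian_product)
  also have "\<dots> = (\<Sum>t=0..X. real (totient k) * (if t = 0 then 1 else 1 / (real t * real k)))"
  proof (intro sum.cong refl)
    fix t
    have "(\<Sum>r=1..k. g (t, r)) = (\<Sum>r\<in>totatives k. (if t = 0 then 1 else 1 / (real t * real k)))"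
      unfolding g_def
      by (intro sum.mono_neutral_cong_right) (auto simp: totatives_def)
    thus "(\<Sum>r=1..k. g (t, r)) = real (totient k) * (if t = 0 then 1 else 1 / (real t * real k))"
      by (simp add: totient_def)
  qed
  also have "\<dots> = real (totient k) + (\<Sum>t=1..X. real (totient k) / real k * (1 / real t))"
    by (subst sum.atLeast_Suc_atMost) (auto intro!: sum.cong simp: field_simps)
  also have "(\<Sum>t=1..X. real (totient k) / real k * (1 / real t)) \<le> real (totient k) / real k * (1 + ln (real X))"
    unfolding sum_distrib_left[symmetric] using sum_inverse_le[OF assms(2)] by (intro mult_left_mono) auto
  finally show ?thesis using totient_le[of k] by simp
qed

lemma prod_ge_element:
  fixes S :: "nat set"
  assumes "finite S" "\<And>p. p \<in> S \<Longrightarrow> prime p" "p \<in> S"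
  shows "p \<le> \<Prod>S"
  using assms prod_primes_pos[of S] by (intro dvd_imp_le dvd_prodI) auto

lemma sum_Pow_prime_wt: "finite S \<Longrightarrow> (\<Sum>T\<in>Pow S. prime_wt T) = (\<Prod>p\<in>S. 1 + 1 / (real p - 1))"
  unfolding prime_wt_def by (rule sum_Pow_prod)

text \<open>Split off the primes up to a bound \<open>y\<close>.  The remaining weights \<open>prime_wt V\<close> are within a
  factor \<open>1 + \<epsilon>\<close>, on average, of \<open>1 / \<Prod>V\<close>, and the density of the integers free of primes up
  to \<open>y\<close> cancels the factor contributed by the small primes.\<close>

lemma L_sum_upper:
  assumes \<epsilon>: "\<epsilon> > 0"
  shows "\<exists>C. \<forall>X\<ge>1. L_sum X \<le> (1 + \<epsilon>) * ln (real X) + C"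
proof -
  obtain K where K: "K > 0"
    "\<And>S :: nat set. finite S \<Longrightarrow> (\<forall>p\<in>S. prime p) \<Longrightarrow> 2 ^ card S \<le> K * real (\<Prod>S) powr (1/2)"
    using power_card_le_powr[of 2 "1/2"] by auto
  \<comment> \<open>Majorant of \<open>prime_wt V / \<Prod>V\<close>: two factors
    \<open>1 / \<Prod>V\<close>, with \<open>2 ^ card V\<close> absorbed by a square root. The
    threshold \<open>y\<close> makes the tail of the convergent series smaller than
    \<open>\<epsilon>\<close>.\<close>
  define \<phi> where "\<phi> n = K * real n powr (-3/2)" for n
  have summ: "summable \<phi>" unfolding \<phi>_def
    by (intro summable_mult) (simp add: summable_real_powr_iff)
  obtain y where y: "norm (\<Sum>i. \<phi> (i + y)) < \<epsilon>"
    using suminf_exist_split[OF \<epsilon> summ] by blast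
  define Ks where "Ks = {p. prime p \<and> p \<le> y}"
  have Ks: "finite Ks" "\<And>p. p \<in> Ks \<Longrightarrow> prime p" by (auto simp: Ks_def)
  define k where "k = \<Prod>Ks"
  define P where "P = (\<Prod>p\<in>Ks. 1 + 1 / (real p - 1))"
  have k1: "k \<ge> 1" using prod_primes_pos[of Ks] Ks by (simp add: k_def Suc_leI)
  have P0: "P \<ge> 0" unfolding P_def by (intro prod_nonneg) (auto simp: Ks_def dest: prime_ge_1_nat)
  \<comment> \<open>Euler factors \<open>p / (p - 1)\<close> against \<open>(p - 1) / p\<close>:
    this exact cancellation keeps the leading coefficient down to \<open>1 + \<epsilon>\<close>,
    however large \<open>y\<close> is.\<close>
  have Pk: "P * (real (totient k) / real k) = 1"
  proof -
    have "P * (real (totient k) / real k) = (\<Prod>p\<in>Ks. (1 + 1 / (real p - 1)) * ((real p - 1) / real p))"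
    proof -
      have "real (totient k) = (\<Prod>p\<in>Ks. real p - 1)"
        unfolding k_def using Ks by (intro totient_prod_primes) auto
      thus ?thesis unfolding P_def k_def by (simp add: prod.distrib prod_dividef)
    qed
    also have "\<dots> = (\<Prod>p\<in>Ks. 1)"
    proof (intro prod.cong refl)
      fix p assume "p \<in> Ks"
      hence "real p > 1" using Ks prime_gt_1_nat by auto
      thus "(1 + 1 / (real p - 1)) * ((real p - 1) / real p) = 1" by (simp add: field_simps)
    qed
    finally show ?thesis by (simp only: prod.neutral_const)
  qed
  have wt0: "prime_wt S \<ge> 0" if "S \<in> prime_sets X" for S X
    using prime_wt_pos[of S] prime_setsD(2)[OF that] by force
  define f1 where "f1 T = (if T \<subseteq> Ks then prime_wt T else 0)" for T
  define g1 where "g1 T = (if T \<inter> Ks = {} then prime_wt T else 0)" for T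
  define f2 where "f2 T = (if T \<inter> Ks = {} then prime_wt T / real (\<Prod>T) else 0)" for T
  define g2 where "g2 T = (if T \<inter> Ks = {} then 1 / real (\<Prod>T) else 0)" for T
  have "L_sum X \<le> (1 + \<epsilon>) * ln (real X) + (1 + \<epsilon>) * (1 + P * real k)" if X: "X \<ge> 1" for X
  proof -
    have "L_sum X \<le> (\<Sum>S\<in>prime_sets X. \<Sum>T\<in>Pow S. f1 T * g1 (S - T))"
      unfolding L_sum_def
    proof (intro sum_mono)
      fix S assume S: "S \<in> prime_sets X"
      note S' = prime_setsD[OF S]
      have wt_eq: "prime_wt ((S \<inter> Ks) \<union> (S - Ks)) = prime_wt (S \<inter> Ks) * prime_wt (S - Ks)"
        using S' by (intro prime_wt_Un) auto
      have "prime_wt S = f1 (S \<inter> Ks) * g1 (S - S \<inter> Ks)"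
      proof -
        have "(S \<inter> Ks) \<union> (S - Ks) = S" "S - S \<inter> Ks = S - Ks" "(S - Ks) \<inter> Ks = {}" by auto
        thus ?thesis using wt_eq by (simp add: f1_def g1_def)
      qed
      also have "\<dots> \<le> (\<Sum>T\<in>Pow S. f1 T * g1 (S - T))"
      proof (rule member_le_sum)
        fix T assume "T \<in> Pow S - {S \<inter> Ks}"
        hence "T \<in> prime_sets X" "S - T \<in> prime_sets X" using S by (auto intro: prime_sets_mono)
        thus "f1 T * g1 (S - T) \<ge> 0" using wt0 by (simp add: f1_def g1_def)
      qed (use S' in auto)
      finally show "prime_wt S \<le> (\<Sum>T\<in>Pow S. f1 T * g1 (S - T))" .
    qed
    also have "\<dots> \<le> (\<Sum>S\<in>prime_sets X. f1 S) * (\<Sum>S\<in>prime_sets X. g1 S)"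
      by (rule sum_prime_sets_split_le) (auto simp: f1_def g1_def wt0)
    also have "\<dots> \<le> P * (\<Sum>S\<in>prime_sets X. g1 S)"
    proof (intro mult_right_mono sum_nonneg)
      have "(\<Sum>S\<in>prime_sets X. f1 S) = (\<Sum>S\<in>prime_sets X \<inter> Pow Ks. prime_wt S)"
        by (intro sum.mono_neutral_cong_right) (auto simp: f1_def)
      also have "\<dots> \<le> (\<Sum>S\<in>Pow Ks. prime_wt S)"
        using Ks by (intro sum_mono2) (auto intro!: less_imp_le prime_wt_pos)
      also have "\<dots> = P" unfolding P_def by (rule sum_Pow_prime_wt[OF Ks(1)])
      finally show "(\<Sum>S\<in>prime_sets X. f1 S) \<le> P" .
    qed (auto simp: g1_def wt0)
    \<comment> \<open>Uses \<open>1 / (p - 1) = (1 + 1 / (p - 1)) / p\<close>, that is, 1 / phi(q)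
      equals 1 / q times the sum of 1 / phi(d) over the divisors d of q.\<close>
    also have "(\<Sum>S\<in>prime_sets X. g1 S) \<le> (\<Sum>S\<in>prime_sets X. \<Sum>T\<in>Pow S. f2 T * g2 (S - T))"
    proof (intro sum_mono)
      fix S assume S: "S \<in> prime_sets X"
      note S' = prime_setsD[OF S]
      show "g1 S \<le> (\<Sum>T\<in>Pow S. f2 T * g2 (S - T))"
      proof (cases "S \<inter> Ks = {}")
        case True
        have "f2 T * g2 (S - T) = prime_wt T / real (\<Prod>S)" if "T \<in> Pow S" for T
        proof -
          have "T \<inter> Ks = {}" "(S - T) \<inter> Ks = {}" using True that by auto
          moreover have "real (\<Prod>S) = real (\<Prod>T) * real (\<Prod>(S - T))"
            using prod.subset_diff[of T S "\<lambda>x. x"] that S' by simp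
          ultimately show ?thesis by (simp add: f2_def g2_def)
        qed
        hence "(\<Sum>T\<in>Pow S. f2 T * g2 (S - T)) = (\<Sum>T\<in>Pow S. prime_wt T) / real (\<Prod>S)"
          by (simp add: sum_divide_distrib)
        also have "\<dots> = (\<Prod>p\<in>S. 1 + 1 / (real p - 1)) / real (\<Prod>S)"
          using S' by (subst sum_Pow_prime_wt) auto
        also have "\<dots> = (\<Prod>p\<in>S. (1 + 1 / (real p - 1)) / real p)"
          by (simp add: prod_dividef)
        also have "\<dots> = prime_wt S" unfolding prime_wt_def
        proof (intro prod.cong refl)
          fix p assume "p \<in> S"
          hence "real p > 1" using S' prime_gt_1_nat by auto
          thus "(1 + 1 / (real p - 1)) / real p = 1 / (real p - 1)" by (simp add: field_simps)
        qed
        finally show ?thesis using True by (simp add: g1_def)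
      next
        case False
        have "f2 T * g2 (S - T) \<ge> 0" if "T \<in> Pow S" for T
          using that S wt0[of T X] prime_sets_mono[OF S, of T] by (auto simp: f2_def g2_def intro!: divide_nonneg_nonneg mult_nonneg_nonneg prod_nonneg)
        hence "(\<Sum>T\<in>Pow S. f2 T * g2 (S - T)) \<ge> 0" by (intro sum_nonneg)
        thus ?thesis using False by (simp add: g1_def)
      qed
    qed
    also have "\<dots> \<le> (\<Sum>S\<in>prime_sets X. f2 S) * (\<Sum>S\<in>prime_sets X. g2 S)"
      by (rule sum_prime_sets_split_le)
         (auto simp: f2_def g2_def wt0 intro!: divide_nonneg_nonneg prod_nonneg)
    also have "\<dots> \<le> (1 + \<epsilon>) * (real (totient k) / real k * (1 + ln (real X)) + real k)"
    proof (intro mult_mono)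
      \<comment> \<open>A nonempty set free of primes up to \<open>y\<close> has product above
        \<open>y\<close>, so besides the 1 from the empty set only the tail of \<open>\<phi>\<close>
        can occur.\<close>
      define \<psi> where "\<psi> n = (if n > y then \<phi> n else 0)" for n
      have "(\<Sum>S\<in>prime_sets X. f2 S) \<le> (\<Sum>S\<in>prime_sets X. (if S = {} then 1 else 0) + \<psi> (\<Prod>S))"
      proof (intro sum_mono)
        fix S assume S: "S \<in> prime_sets X"
        note S' = prime_setsD[OF S]
        show "f2 S \<le> (if S = {} then 1 else 0) + \<psi> (\<Prod>S)"
        proof (cases "S \<noteq> {} \<and> S \<inter> Ks = {}")
          case True
          then obtain p where p: "p \<in> S" "p \<notin> Ks" by blast
          hence "p > y" using S' by (auto simp: Ks_def)
          moreover have "p \<le> \<Prod>S" using p S' by (intro prod_ge_element) auto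
          ultimately have big: "\<Prod>S > y" by linarith
          have "f2 S = prime_wt S / real (\<Prod>S)" using True by (simp add: f2_def)
          also have "\<dots> \<le> (2 ^ card S / real (\<Prod>S)) / real (\<Prod>S)"
            using S' by (intro divide_right_mono prime_wt_le of_nat_0_le_iff) auto
          also have "\<dots> \<le> (K * real (\<Prod>S) powr (1/2) / real (\<Prod>S)) / real (\<Prod>S)"
            using S' by (intro divide_right_mono K of_nat_0_le_iff) auto
          also have "\<dots> = \<phi> (\<Prod>S)"
          proof -
            have "real (\<Prod>S) > 0" using big by (subst of_nat_0_less_iff) linarith
            moreover have "x powr (1/2) / x / x = x powr (-3/2)" if "x > 0" for x :: real
              using that powr_diff[of x "1/2" 2] by (simp add: field_simps power2_eq_square)
            ultimately show ?thesis unfolding \<phi>_def by (metis times_divide_eq_right)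
          qed
          finally show ?thesis using True big by (simp add: \<psi>_def)
        next
          case False
          thus ?thesis using K(1) by (auto simp: f2_def \<psi>_def \<phi>_def prime_wt_def)
        qed
      qed
      also have "\<dots> = (\<Sum>S\<in>prime_sets X. if S = {} then 1 else 0) + (\<Sum>S\<in>prime_sets X. \<psi> (\<Prod>S))"
        by (simp add: sum.distrib)
      also have "(\<Sum>S\<in>prime_sets X. if S = {} then 1 else 0) \<le> (1 :: real)"
        by (subst sum.delta) auto
      also have "(\<Sum>S\<in>prime_sets X. \<psi> (\<Prod>S)) \<le> \<epsilon>"
      proof -
        have "(\<Sum>S\<in>prime_sets X. \<psi> (\<Prod>S)) \<le> (\<Sum>n=1..X. \<psi> n)"
          using K(1) by (intro sum_prime_sets_le) (auto simp: \<psi>_def \<phi>_def)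
        also have "\<dots> \<le> (\<Sum>n\<in>{y..<y+X+1}. \<phi> n)"
        proof -
          have "(\<Sum>n=1..X. \<psi> n) = (\<Sum>n\<in>{1..X} \<inter> {y<..}. \<phi> n)"
            by (intro sum.mono_neutral_cong_right) (auto simp: \<psi>_def)
          also have "\<dots> \<le> (\<Sum>n\<in>{y..<y+X+1}. \<phi> n)"
            using K(1) by (intro sum_mono2) (auto simp: \<phi>_def)
          finally show ?thesis .
        qed
        also have "\<dots> = (\<Sum>i<X+1. \<phi> (i + y))"
          by (rule sum.reindex_bij_witness[of _ "\<lambda>i. i + y" "\<lambda>i. i - y"]) auto
        also have "\<dots> \<le> (\<Sum>i. \<phi> (i + y))"
        proof (rule sum_le_suminf)
          show "summable (\<lambda>i. \<phi> (i + y))" using summ by (rule summable_ignore_initial_segment)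
          show "\<phi> (i + y) \<ge> 0" for i using K(1) by (simp add: \<phi>_def)
        qed simp
        finally show ?thesis using y by simp
      qed
      finally show "(\<Sum>S\<in>prime_sets X. f2 S) \<le> 1 + \<epsilon>" by simp
    next
      have "(\<Sum>S\<in>prime_sets X. g2 S) \<le> (\<Sum>S\<in>prime_sets X. if coprime (\<Prod>S) k then 1 / real (\<Prod>S) else 0)"
      proof (intro sum_mono)
        fix S assume S: "S \<in> prime_sets X"
        have "coprime (\<Prod>S) k" if "S \<inter> Ks = {}"
          unfolding k_def using that Ks prime_setsD[OF S]
          by (intro prod_coprime_left prod_coprime_right primes_coprime) auto
        thus "g2 S \<le> (if coprime (\<Prod>S) k then 1 / real (\<Prod>S) else 0)"
          by (auto simp: g2_def)
      qed
      also have "\<dots> \<le> (\<Sum>n=1..X. if coprime n k then 1 / real n else 0)"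
        by (rule sum_prime_sets_le) auto
      also have "\<dots> \<le> real (totient k) / real k * (1 + ln (real X)) + real k"
        by (rule sum_inverse_coprime_le[OF k1 X])
      finally show "(\<Sum>S\<in>prime_sets X. g2 S) \<le> real (totient k) / real k * (1 + ln (real X)) + real k" .
    qed (use \<epsilon> in \<open>auto intro!: sum_nonneg simp: g2_def\<close>)
    finally have "L_sum X \<le> P * ((1 + \<epsilon>) * (real (totient k) / real k * (1 + ln (real X)) + real k))"
      using P0 by (auto intro: mult_left_mono)
    also have "\<dots> = (1 + \<epsilon>) * ((P * (real (totient k) / real k)) * (1 + ln (real X)) + P * real k)"
      by (simp add: algebra_simps)
    also have "\<dots> = (1 + \<epsilon>) * ln (real X) + (1 + \<epsilon>) * (1 + P * real k)"
      unfolding Pk by (simp add: algebra_simps)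
    finally show ?thesis .
  qed
  thus ?thesis by blast
qed

lemma L_sum_asymp: "((\<lambda>X. L_sum X / ln (real X)) \<longlongrightarrow> 1) at_top"
proof (rule order_tendstoI)
  fix a :: real assume "a < 1"
  have "eventually (\<lambda>X :: nat. X \<ge> 3) at_top" by (rule eventually_ge_at_top)
  thus "eventually (\<lambda>X. a < L_sum X / ln (real X)) at_top"
  proof eventually_elim
    case (elim X)
    hence "ln (real X) > 0" by simp
    hence "L_sum X / ln (real X) \<ge> 1" using L_sum_ge[of X] elim by simp
    thus ?case using \<open>a < 1\<close> by simp
  qed
next
  fix a :: real assume "1 < a"
  define \<epsilon> where "\<epsilon> = (a - 1) / 2"
  have "\<epsilon> > 0" using \<open>1 < a\<close> by (simp add: \<epsilon>_def)
  then obtain C where C: "\<And>X. X \<ge> 1 \<Longrightarrow> L_sum X \<le> (1 + \<epsilon>) * ln (real X) + C"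
    using L_sum_upper by blast
  have "filterlim (\<lambda>X :: nat. ln (real X)) at_top at_top"
    by (rule filterlim_compose[OF ln_at_top filterlim_real_sequentially])
  hence "eventually (\<lambda>X :: nat. ln (real X) > C / \<epsilon>) at_top"
    by (simp add: filterlim_at_top_dense)
  moreover have "eventually (\<lambda>X :: nat. X \<ge> 3) at_top" by (rule eventually_ge_at_top)
  ultimately show "eventually (\<lambda>X. L_sum X / ln (real X) < a) at_top"
  proof eventually_elim
    case (elim X)
    hence pos: "ln (real X) > 0" by simp
    have "C < \<epsilon> * ln (real X)" using elim \<open>\<epsilon> > 0\<close> by (simp add: field_simps)
    hence "L_sum X < (1 + 2 * \<epsilon>) * ln (real X)" using C[of X] elim by (simp add: algebra_simps)
    thus ?case using pos by (simp add: \<epsilon>_def field_simps)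
  qed
qed

section \<open>Primes in progressions and local densities\<close>

text \<open>\<open>eta p a\<close> and \<open>gam p a b\<close> are the mean values, over the reduced residues \<open>u\<close> modulo \<open>p\<close>, of
  \<open>sp p (u + a) / (p - 1)\<close> and of \<open>sp p (u + a) * sp p (u + b) / (p - 1)^2\<close>. Similarly,
  \<open>rho x y a b p\<close> is the proportion of reduced residues \<open>u\<close> for which \<open>p\<close> divides \<open>u + a\<close> (if \<open>x\<close>)
  and \<open>u + b\<close> (if \<open>y\<close>).\<close>

definition eta :: "nat \<Rightarrow> int \<Rightarrow> real" where
  "eta p a = - sp p a / (real p - 1)\<^sup>2"

definition gam :: "nat \<Rightarrow> int \<Rightarrow> int \<Rightarrow> real" where
  "gam p a b = (1 - (if int p dvd a then 0 else real p / (real p - 1))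
                  - (if int p dvd b then 0 else real p / (real p - 1))
                  + (if int p dvd a - b \<and> \<not> int p dvd a then (real p)\<^sup>2 / (real p - 1) else 0)) / (real p - 1)\<^sup>2"

text \<open>The local mean of those among the two factors whose set contains \<open>p\<close>. The
  last branch is meant for \<open>p \<in> T - S\<close>, since the function is only multiplied over
  \<open>S \<union> T\<close>.\<close>

definition loc :: "nat set \<Rightarrow> nat set \<Rightarrow> int \<Rightarrow> int \<Rightarrow> nat \<Rightarrow> real" where
  "loc S T a b p = (if p \<in> S then if p \<in> T then gam p a b else eta p a else eta p b)"

text \<open>By the Chinese remainder theorem this is the mean of
  \<open>lam_sets X (u + a) * lam_sets Y (u + b)\<close> over the reduced residues \<open>u\<close>
  to a common modulus, hence the expected average when \<open>u\<close> runs through the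
  primes.\<close>

definition corr :: "nat \<Rightarrow> nat \<Rightarrow> int \<Rightarrow> int \<Rightarrow> real" where
  "corr X Y a b = (\<Sum>S\<in>prime_sets X. \<Sum>T\<in>prime_sets Y. \<Prod>p\<in>S \<union> T. loc S T a b p)"

definition rho :: "bool \<Rightarrow> bool \<Rightarrow> int \<Rightarrow> int \<Rightarrow> nat \<Rightarrow> real" where
  "rho x y a b p =
     (if (x \<and> int p dvd a) \<or> (y \<and> int p dvd b) \<or> (x \<and> y \<and> \<not> int p dvd a - b) then 0
      else if x \<or> y then 1 / (real p - 1) else 1)"

text \<open>Multiplies out a product in which only the places in \<open>S\<close> offer a choice.
  Passing the choice as a truth value lets the rule be applied twice, once for each of two
  independent subsets.\<close>

lemma sum_Pow_prod_if:
  fixes f :: "'a \<Rightarrow> bool \<Rightarrow> real"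
  assumes "finite V" "S \<subseteq> V"
  shows "(\<Sum>T\<in>Pow S. \<Prod>p\<in>V. f p (p \<in> T)) = (\<Prod>p\<in>V. f p False + (if p \<in> S then f p True else 0))"
proof -
  have fin: "finite S" using assms finite_subset by blast
  have "(\<Prod>p\<in>V. f p False + (if p \<in> S then f p True else 0))
      = (\<Prod>p\<in>V - S. f p False) * (\<Prod>p\<in>S. f p True + f p False)"
    unfolding prod.subset_diff[OF assms(2,1)]
    by (intro arg_cong2[where f = "(*)"] prod.cong) auto
  also have "\<dots> = (\<Sum>T\<in>Pow S. (\<Prod>p\<in>V - S. f p False) * ((\<Prod>p\<in>T. f p True) * (\<Prod>p\<in>S - T. f p False)))"
    unfolding prod_add[OF fin] sum_distrib_left ..
  also have "\<dots> = (\<Sum>T\<in>Pow S. \<Prod>p\<in>V. f p (p \<in> T))"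
  proof (intro sum.cong refl)
    fix T assume T: "T \<in> Pow S"
    have "(\<Prod>p\<in>V. f p (p \<in> T)) = (\<Prod>p\<in>V - S. f p (p \<in> T)) * ((\<Prod>p\<in>S - T. f p (p \<in> T)) * (\<Prod>p\<in>T. f p (p \<in> T)))"
      using T fin prod.subset_diff[OF assms(2,1), of "\<lambda>p. f p (p \<in> T)"]
        prod.subset_diff[of T S "\<lambda>p. f p (p \<in> T)"] by simp
    also have "(\<Prod>p\<in>V - S. f p (p \<in> T)) = (\<Prod>p\<in>V - S. f p False)"
    proof (intro prod.cong refl)
      fix p assume "p \<in> V - S"
      hence "p \<notin> T" using T by auto
      thus "f p (p \<in> T) = f p False" by simp
    qed
    also have "(\<Prod>p\<in>S - T. f p (p \<in> T)) = (\<Prod>p\<in>S - T. f p False)" by (intro prod.cong) auto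
    also have "(\<Prod>p\<in>T. f p (p \<in> T)) = (\<Prod>p\<in>T. f p True)" by (intro prod.cong) auto
    finally show "(\<Prod>p\<in>V - S. f p False) * ((\<Prod>p\<in>T. f p True) * (\<Prod>p\<in>S - T. f p False)) = (\<Prod>p\<in>V. f p (p \<in> T))"
      by simp
  qed
  finally show ?thesis by simp
qed

text \<open>With \<open>sp p n = 1 - p * [p dvd n]\<close>, the sets \<open>U\<close> and
  \<open>V\<close> record where divisibility of \<open>u + a\<close> and of \<open>u + b\<close> is
  imposed. The double sum factors over the primes, and what remains is an identity at one prime with
  four cases of membership.\<close>

lemma prod_loc_expand:
  assumes "finite S" "finite T" "\<And>p. p \<in> S \<union> T \<Longrightarrow> prime p"
  shows "(\<Prod>p\<in>S \<union> T. loc S T a b p)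
     = prime_wt S * prime_wt T * (\<Sum>U\<in>Pow S. \<Sum>V\<in>Pow T. (\<Prod>p\<in>U. - real p) * (\<Prod>p\<in>V. - real p) *
         (\<Prod>p\<in>U \<union> V. rho (p \<in> U) (p \<in> V) a b p))"
proof -
  define W where "W = S \<union> T"
  have W: "finite W" "S \<subseteq> W" "T \<subseteq> W" using assms by (auto simp: W_def)
  define F where "F p x y = (if x then - real p else 1) * (if y then - real p else 1) * rho x y a b p" for p x y
  have "(\<Sum>U\<in>Pow S. \<Sum>V\<in>Pow T. (\<Prod>p\<in>U. - real p) * (\<Prod>p\<in>V. - real p) *
         (\<Prod>p\<in>U \<union> V. rho (p \<in> U) (p \<in> V) a b p))
      = (\<Sum>U\<in>Pow S. \<Sum>V\<in>Pow T. \<Prod>p\<in>W. F p (p \<in> U) (p \<in> V))"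
  proof (intro sum.cong refl)
    fix U V assume UV: "U \<in> Pow S" "V \<in> Pow T"
    have "(\<Prod>p\<in>U. - real p) = (\<Prod>p\<in>W. if p \<in> U then - real p else 1)"
      using UV W by (intro prod.mono_neutral_cong_left) auto
    moreover have "(\<Prod>p\<in>V. - real p) = (\<Prod>p\<in>W. if p \<in> V then - real p else 1)"
      using UV W by (intro prod.mono_neutral_cong_left) auto
    moreover have "(\<Prod>p\<in>U \<union> V. rho (p \<in> U) (p \<in> V) a b p) = (\<Prod>p\<in>W. rho (p \<in> U) (p \<in> V) a b p)"
      using UV W by (intro prod.mono_neutral_cong_left) (auto simp: rho_def)
    ultimately show "(\<Prod>p\<in>U. - real p) * (\<Prod>p\<in>V. - real p) *
         (\<Prod>p\<in>U \<union> V. rho (p \<in> U) (p \<in> V) a b p) = (\<Prod>p\<in>W. F p (p \<in> U) (p \<in> V))"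
      by (simp add: F_def prod.distrib)
  qed
  also have "\<dots> = (\<Sum>U\<in>Pow S. \<Prod>p\<in>W. F p (p \<in> U) False + (if p \<in> T then F p (p \<in> U) True else 0))"
    by (intro sum.cong refl sum_Pow_prod_if[OF W(1,3), where f = "\<lambda>p y. F p (p \<in> U) y" for U])
  also have "\<dots> = (\<Prod>p\<in>W. (F p False False + (if p \<in> T then F p False True else 0))
      + (if p \<in> S then F p True False + (if p \<in> T then F p True True else 0) else 0))"
    using sum_Pow_prod_if[OF W(1,2), of "\<lambda>p x. F p x False + (if p \<in> T then F p x True else 0)"] by simp
  finally have eq: "(\<Sum>U\<in>Pow S. \<Sum>V\<in>Pow T. (\<Prod>p\<in>U. - real p) * (\<Prod>p\<in>V. - real p) *
         (\<Prod>p\<in>U \<union> V. rho (p \<in> U) (p \<in> V) a b p)) = \<dots>" .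
  have wS: "prime_wt S = (\<Prod>p\<in>W. if p \<in> S then 1 / (real p - 1) else 1)"
    unfolding prime_wt_def using W by (intro prod.mono_neutral_cong_left) auto
  have wT: "prime_wt T = (\<Prod>p\<in>W. if p \<in> T then 1 / (real p - 1) else 1)"
    unfolding prime_wt_def using W by (intro prod.mono_neutral_cong_left) auto
  show ?thesis
    unfolding eq wS wT W_def[symmetric] prod.distrib[symmetric]
  proof (intro prod.cong refl)
    fix p assume p: "p \<in> W"
    hence "prime p" using assms by (auto simp: W_def)
    hence p1: "real p - 1 > 0" using prime_gt_1_nat by simp
    have ab: "int p dvd b" if "int p dvd a - b" "int p dvd a"
      using dvd_diff[OF that(2,1)] by simp
    have ba: "int p dvd a" if "int p dvd a - b" "int p dvd b"
      using dvd_add[OF that] by simp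
    show "loc S T a b p = (if p \<in> S then 1 / (real p - 1) else 1) * (if p \<in> T then 1 / (real p - 1) else 1) *
      (F p False False + (if p \<in> T then F p False True else 0)
      + (if p \<in> S then F p True False + (if p \<in> T then F p True True else 0) else 0))"
    proof (cases "p \<in> S"; cases "p \<in> T")
      assume *: "p \<in> S" "p \<in> T"
      have eq2: "F p False False + F p False True + (F p True False + F p True True)
          = gam p a b * (real p - 1)\<^sup>2"
        using p1 ab ba by (auto simp: F_def rho_def gam_def power2_eq_square)
      have "1 / (real p - 1) * (1 / (real p - 1)) * (F p False False + F p False True + (F p True False + F p True True))
          = gam p a b"
        unfolding eq2 using p1 by (simp add: power2_eq_square)
      thus ?thesis using * by (simp add: loc_def)
    next
      assume *: "p \<in> S" "p \<notin> T"
      have "(F p False False + F p True False) / (real p - 1) = eta p a"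
        using p1 by (auto simp: F_def rho_def eta_def sp_def power2_eq_square divide_simps)
      thus ?thesis using * by (simp add: loc_def)
    next
      assume *: "p \<notin> S" "p \<in> T"
      have "(F p False False + F p False True) / (real p - 1) = eta p b"
        using p1 by (auto simp: F_def rho_def eta_def sp_def power2_eq_square divide_simps)
      thus ?thesis using * by (simp add: loc_def)
    next
      assume "p \<notin> S" "p \<notin> T"
      thus ?thesis using p by (simp add: W_def)
    qed
  qed
qed

text \<open>Among the multiples of \<open>p\<close> only powers of \<open>p\<close> contribute.
  Those up to \<open>N\<close> divide the largest power \<open>p ^ K \<le> N\<close>, and over the
  divisors of \<open>p ^ K\<close> the von Mangoldt function sums to its logarithm.\<close>

lemma sum_mangoldt_multiples_le:
  assumes "prime p" "N \<ge> 1"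
  shows "(\<Sum>m | m \<in> {1..N} \<and> p dvd m. mangoldt m) \<le> ln (real N)"
proof -
  obtain K where K: "p ^ K \<le> N" "N < p ^ (K + 1)"
    using ex_power_ivl1[of p N] assms prime_ge_2_nat by auto
  have "(\<Sum>m | m \<in> {1..N} \<and> p dvd m. mangoldt m) \<le> (\<Sum>d | d dvd p ^ K. mangoldt d :: real)"
  proof -
    have "(\<Sum>m | m \<in> {1..N} \<and> p dvd m. mangoldt m :: real) = (\<Sum>m | m \<in> {1..N} \<and> p dvd m \<and> primepow m. mangoldt m)"
      by (intro sum.mono_neutral_right) (auto simp: mangoldt_def)
    also have "\<dots> \<le> (\<Sum>d | d dvd p ^ K. mangoldt d)"
    proof (rule sum_mono2)
      show "finite {d. d dvd p ^ K}" using assms by (simp add: prime_gt_0_nat)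
      show "{m \<in> {1..N}. p dvd m \<and> primepow m} \<subseteq> {d. d dvd p ^ K}"
      proof safe
        fix m assume m: "m \<in> {1..N}" "p dvd m" "primepow m"
        then obtain q k where q: "prime q" "m = q ^ k" by (auto simp: primepow_def)
        hence "p = q" using m assms by (metis prime_dvd_power primes_dvd_imp_eq)
        hence "p ^ k < p ^ (K + 1)" using m q K by auto
        hence "k < K + 1" using power_less_imp_less_exp[OF prime_gt_1_nat[OF assms(1)]] by blast
        hence "k \<le> K" by simp
        thus "m dvd p ^ K" using q \<open>p = q\<close> by (simp add: le_imp_power_dvd)
      qed
    qed (auto simp: mangoldt_nonneg)
    finally show ?thesis by simp
  qed
  also have "\<dots> = ln (real (p ^ K))"
    using mangoldt_sum[of "p ^ K", where 'a = real] assms prime_gt_0_nat[of p] by simp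
  also have "\<dots> \<le> ln (real N)"
    using K(1) assms prime_gt_0_nat[of p] by (subst ln_le_cancel_iff) (auto simp del: of_nat_power)
  finally show ?thesis by simp
qed

definition E_max :: "nat \<Rightarrow> nat \<Rightarrow> real" where
  "E_max N r = Max ((\<lambda>a. \<bar>E_ap (real N) r a\<bar>) ` totatives r)"

lemma totatives_cong:
  assumes "coprime x r" "r > 0"
  shows "\<exists>c\<in>totatives r. [x = c] (mod r)"
\<comment> \<open>For \<open>r = 1\<close> the reduced residue is 0, whereas
  \<open>totatives 1\<close> is \<open>{1}\<close>.\<close>
proof (cases "r = 1")
  case True
  thus ?thesis by (intro bexI[of _ 1]) (auto simp: totatives_def)
next
  case False
  have "coprime (x mod r) r" using assms by simp
  moreover have "x mod r \<noteq> 0" using assms False by (metis calculation coprime_0_left_iff nat_dvd_1_iff_1)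
  ultimately show ?thesis using assms
    by (intro bexI[of _ "x mod r"]) (auto simp: totatives_def cong_def less_imp_le)
qed

lemma E_max_ge:
  assumes "coprime x r" "r > 0"
  shows "\<bar>E_ap (real N) r x\<bar> \<le> E_max N r"
proof -
  obtain c where c: "c \<in> totatives r" "[x = c] (mod r)" using totatives_cong[OF assms] by auto
  have "[n = x] (mod r) \<longleftrightarrow> [n = c] (mod r)" for n
    using c(2) by (meson cong_sym cong_trans)
  moreover have "coprime c r" using c(1) by (simp add: totatives_def)
  ultimately have "E_ap (real N) r x = E_ap (real N) r c"
    using assms by (simp add: E_ap_def psi_ap_def)
  thus ?thesis unfolding E_max_def using c(1) by (intro Max_ge) auto
qed

lemma E_max_nonneg: "r > 0 \<Longrightarrow> E_max N r \<ge> 0"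
  using E_max_ge[of 1 r N] by simp

definition psi_sets :: "nat \<Rightarrow> nat set \<Rightarrow> nat set \<Rightarrow> int \<Rightarrow> int \<Rightarrow> real" where
  "psi_sets N S T a b = (\<Sum>m | m \<in> {1..N} \<and> (\<forall>p\<in>S. int p dvd int m + a) \<and> (\<forall>p\<in>T. int p dvd int m + b). mangoldt m)"

text \<open>If the conditions contradict each other at a common prime, both sides vanish. Otherwise
  they are one congruence modulo \<open>\<Prod>(S \<union> T)\<close>: for a reduced class the error
  is an instance of \<open>E_ap\<close>, and for a nonreduced class the main term is 0 while only
  powers of a single prime are counted, which costs \<open>ln N\<close>.\<close>

lemma psi_sets_approx:
  assumes fin: "finite S" "finite T" and pr: "\<And>p. p \<in> S \<union> T \<Longrightarrow> prime p" and N: "N \<ge> 1"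
  shows "\<bar>psi_sets N S T a b - real N * (\<Prod>p\<in>S \<union> T. rho (p \<in> S) (p \<in> T) a b p)\<bar>
           \<le> E_max N (\<Prod>(S \<union> T)) + ln (real N)"
proof -
  define V where "V = S \<union> T"
  have V: "finite V" "\<And>p. p \<in> V \<Longrightarrow> prime p" using fin pr by (auto simp: V_def)
  define r where "r = \<Prod>V"
  have r0: "r > 0" unfolding r_def using V by (intro prod_primes_pos) auto
  have lnN: "ln (real N) \<ge> 0" using N by simp
  have Em: "E_max N r \<ge> 0" using r0 by (rule E_max_nonneg)
  have main: "\<bar>psi_sets N S T a b - real N * (\<Prod>p\<in>V. rho (p \<in> S) (p \<in> T) a b p)\<bar> \<le> E_max N r + ln (real N)"
  proof (cases "\<forall>p\<in>S \<inter> T. int p dvd a - b")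
    case False
    then obtain p where p: "p \<in> S" "p \<in> T" "\<not> int p dvd a - b" by auto
    have pr0: "(\<Prod>p\<in>V. rho (p \<in> S) (p \<in> T) a b p) = 0"
      using p V by (intro prod_zero bexI[of _ p]) (auto simp: V_def rho_def)
    have emp: "{m. m \<in> {1..N} \<and> (\<forall>p\<in>S. int p dvd int m + a) \<and> (\<forall>p\<in>T. int p dvd int m + b)} = {}"
    proof safe
      fix m assume "\<forall>p\<in>S. int p dvd int m + a" "\<forall>p\<in>T. int p dvd int m + b"
      hence "int p dvd (int m + a) - (int m + b)" using p by (intro dvd_diff) auto
      thus "m \<in> {}" using p by simp
    qed
    have "psi_sets N S T a b = 0" unfolding psi_sets_def by (subst emp) simp
    thus ?thesis using lnN Em pr0 by simp
  next
    case True
    \<comment> \<open>On \<open>S \<inter> T\<close> the residues \<open>- a\<close> and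
      \<open>- b\<close> agree modulo \<open>p\<close> in this case, so preferring
      \<open>- a\<close> is harmless.\<close>
    define u where "u p = nat ((if p \<in> S then - a else - b) mod int p)" for p
    obtain x where x: "\<And>p. p \<in> V \<Longrightarrow> [x = u p] (mod p)"
      using chinese_remainder_nat[of V "\<lambda>p. p" u] V by (metis primes_coprime)
    have x': "int p dvd int x - (if p \<in> S then - a else - b)" if "p \<in> V" for p
    proof -
      have p0: "int p > 0" using V(2)[OF that] prime_gt_0_nat by simp
      have "[int x = int (u p)] (mod int p)" using x[OF that] by (simp add: cong_int_iff)
      also have "int (u p) = (if p \<in> S then - a else - b) mod int p"
        unfolding u_def using p0 by simp
      also have "[\<dots> = (if p \<in> S then - a else - b)] (mod int p)" by simp
      finally show ?thesis by (simp add: cong_iff_dvd_diff)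
    qed
    have xS: "int p dvd int x + a" if "p \<in> S" for p
      using x'[of p] that by (simp add: V_def)
    have xT: "int p dvd int x + b" if "p \<in> T" for p
    proof (cases "p \<in> S")
      case False thus ?thesis using x'[of p] that by (simp add: V_def)
    next
      case True2: True
      hence "int p dvd a - b" using that True by auto
      from dvd_diff[OF xS[OF True2] this] show ?thesis by simp
    qed
    have cond: "(\<forall>p\<in>S. int p dvd int m + a) \<and> (\<forall>p\<in>T. int p dvd int m + b) \<longleftrightarrow> [m = x] (mod r)" for m
    proof -
      have "int p dvd int m + a \<longleftrightarrow> int p dvd int m - int x" if "p \<in> S" for p
        using dvd_add_left_iff[OF xS[OF that], of "int m - int x"] by simp
      moreover have "int p dvd int m + b \<longleftrightarrow> int p dvd int m - int x" if "p \<in> T" for p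
        using dvd_add_left_iff[OF xT[OF that], of "int m - int x"] by simp
      ultimately have "(\<forall>p\<in>S. int p dvd int m + a) \<and> (\<forall>p\<in>T. int p dvd int m + b) \<longleftrightarrow> (\<forall>p\<in>V. int p dvd int m - int x)"
        by (auto simp: V_def)
      also have "\<dots> \<longleftrightarrow> int r dvd int m - int x"
        unfolding r_def using V by (subst prod_primes_dvd_iff) auto
      finally show ?thesis by (simp add: cong_iff_dvd_diff flip: cong_int_iff)
    qed
    have pS: "int p dvd a \<longleftrightarrow> p dvd x" if "p \<in> S" for p
      using xS[OF that] by (metis dvd_add_right_iff dvd_add_left_iff int_dvd_int_iff)
    have pT: "int p dvd b \<longleftrightarrow> p dvd x" if "p \<in> T" for p
      using xT[OF that] by (metis dvd_add_right_iff dvd_add_left_iff int_dvd_int_iff)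
    have psi: "psi_sets N S T a b = (\<Sum>m | m \<in> {1..N} \<and> [m = x] (mod r). mangoldt m)"
      unfolding psi_sets_def cond ..
    show ?thesis
    proof (cases "\<exists>p\<in>V. p dvd x")
      case True
      then obtain p where p: "p \<in> V" "p dvd x" by auto
      have "rho (p \<in> S) (p \<in> T) a b p = 0"
        using p pS pT by (auto simp: rho_def V_def)
      hence prod0: "(\<Prod>p\<in>V. rho (p \<in> S) (p \<in> T) a b p) = 0"
        using p V by auto
      have "p dvd r" unfolding r_def using p V by (intro dvd_prodI) auto
      have "psi_sets N S T a b \<le> (\<Sum>m | m \<in> {1..N} \<and> p dvd m. mangoldt m)"
        unfolding psi
      proof (rule sum_mono2)
        show "{m \<in> {1..N}. [m = x] (mod r)} \<subseteq> {m \<in> {1..N}. p dvd m}"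
          using p \<open>p dvd r\<close> by (auto dest: cong_dvd_modulus_nat simp: cong_dvd_iff)
      qed (auto simp: mangoldt_nonneg)
      also have "\<dots> \<le> ln (real N)" using p V N by (intro sum_mangoldt_multiples_le) auto
      finally have "psi_sets N S T a b \<le> ln (real N)" .
      moreover have "psi_sets N S T a b \<ge> 0"
        unfolding psi_sets_def by (intro sum_nonneg mangoldt_nonneg)
      ultimately show ?thesis using prod0 Em by simp
    next
      case no: False
      have cop: "coprime x r" unfolding r_def
      proof (rule prod_coprime_right)
        fix p assume "p \<in> V"
        thus "coprime x p" using no V by (metis coprime_commute prime_imp_coprime)
      qed
      have "(\<Prod>p\<in>V. rho (p \<in> S) (p \<in> T) a b p) = (\<Prod>p\<in>V. 1 / (real p - 1))"
      proof (intro prod.cong refl)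
        fix p assume p: "p \<in> V"
        thus "rho (p \<in> S) (p \<in> T) a b p = 1 / (real p - 1)"
          using no pS pT True by (auto simp: rho_def V_def)
      qed
      also have "\<dots> = 1 / real (totient r)"
        using totient_prod_primes[of V] V by (simp add: prod_dividef r_def)
      finally have rr: "(\<Prod>p\<in>V. rho (p \<in> S) (p \<in> T) a b p) = 1 / real (totient r)" .
      have "psi_sets N S T a b - real N * (1 / real (totient r)) = E_ap (real N) r x"
        using cop by (simp add: psi E_ap_def psi_ap_def)
      thus ?thesis using E_max_ge[OF cop r0, of N] lnN unfolding rr by simp
    qed
  qed
  thus ?thesis by (simp add: V_def r_def)
qed

text \<open>For q = \<open>\<Prod>S\<close> and its divisor d = \<open>\<Prod>U\<close> this is d
  mu(d) / phi(q), the coefficient with which the condition that d divides n enters lambda_R.\<close>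

definition lam_coeff :: "nat set \<times> nat set \<Rightarrow> real" where
  "lam_coeff = (\<lambda>(S, U). prime_wt S * (\<Prod>p\<in>U. - real p))"

definition all_dvd :: "nat set \<Rightarrow> int \<Rightarrow> real" where
  "all_dvd U n = (if \<forall>p\<in>U. int p dvd n then 1 else 0)"

lemma finite_Sigma_prime_sets [simp]: "finite (Sigma (prime_sets X) Pow)"
  by (auto dest: prime_setsD)

lemma lam_sets_expand:
  "lam_sets X n = (\<Sum>x\<in>Sigma (prime_sets X) Pow. lam_coeff x * all_dvd (snd x) n)"
proof -
  have "lam_sets X n = (\<Sum>S\<in>prime_sets X. \<Sum>U\<in>Pow S. lam_coeff (S, U) * all_dvd U n)"
    unfolding lam_sets_def
  proof (intro sum.cong refl)
    fix S assume S: "S \<in> prime_sets X"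
    have "(\<Prod>p\<in>S. sp p n / (real p - 1)) = prime_wt S * (\<Prod>p\<in>S. sp p n)"
      by (simp add: prime_wt_def prod_dividef)
    also have "(\<Prod>p\<in>S. sp p n) = (\<Prod>p\<in>S. 1 + (if int p dvd n then - real p else 0))"
      by (intro prod.cong) (auto simp: sp_def)
    also have "\<dots> = (\<Sum>U\<in>Pow S. \<Prod>p\<in>U. if int p dvd n then - real p else 0)"
      using prime_setsD[OF S] by (subst sum_Pow_prod) auto
    also have "\<dots> = (\<Sum>U\<in>Pow S. (\<Prod>p\<in>U. - real p) * all_dvd U n)"
    proof (intro sum.cong refl)
      fix U assume "U \<in> Pow S"
      hence "finite U" using prime_setsD[OF S] finite_subset by blast
      thus "(\<Prod>p\<in>U. if int p dvd n then - real p else 0) = (\<Prod>p\<in>U. - real p) * all_dvd U n"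
        by (cases "\<forall>p\<in>U. int p dvd n") (auto simp: all_dvd_def intro!: prod.cong)
    qed
    also have "prime_wt S * \<dots> = (\<Sum>U\<in>Pow S. lam_coeff (S, U) * all_dvd U n)"
      by (simp add: lam_coeff_def sum_distrib_left mult.assoc)
    finally show "(\<Prod>p\<in>S. sp p n / (real p - 1)) = (\<Sum>U\<in>Pow S. lam_coeff (S, U) * all_dvd U n)" .
  qed
  thus ?thesis by (subst (asm) sum.Sigma) (auto dest: prime_setsD simp: case_prod_beta)
qed

text \<open>Same index set and coefficients as in \<open>lam_sets_expand\<close>, so the average
  over primes and its main term can be compared term by term.\<close>

lemma corr_expand:
  "corr X Y a b = (\<Sum>x\<in>Sigma (prime_sets X) Pow. \<Sum>y\<in>Sigma (prime_sets Y) Pow.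
      lam_coeff x * lam_coeff y * (\<Prod>p\<in>snd x \<union> snd y. rho (p \<in> snd x) (p \<in> snd y) a b p))"
proof -
  have "corr X Y a b = (\<Sum>S\<in>prime_sets X. \<Sum>T\<in>prime_sets Y. \<Sum>U\<in>Pow S. \<Sum>V\<in>Pow T.
      lam_coeff (S, U) * lam_coeff (T, V) * (\<Prod>p\<in>U \<union> V. rho (p \<in> U) (p \<in> V) a b p))"
    unfolding corr_def
  proof (intro sum.cong refl)
    fix S T assume ST: "S \<in> prime_sets X" "T \<in> prime_sets Y"
    show "(\<Prod>p\<in>S \<union> T. loc S T a b p) = (\<Sum>U\<in>Pow S. \<Sum>V\<in>Pow T.
      lam_coeff (S, U) * lam_coeff (T, V) * (\<Prod>p\<in>U \<union> V. rho (p \<in> U) (p \<in> V) a b p))"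
      using prime_setsD[OF ST(1)] prime_setsD[OF ST(2)]
      by (subst prod_loc_expand) (auto simp: sum_distrib_left lam_coeff_def mult_ac)
  qed
  also have "\<dots> = (\<Sum>S\<in>prime_sets X. \<Sum>U\<in>Pow S. \<Sum>T\<in>prime_sets Y. \<Sum>V\<in>Pow T.
      lam_coeff (S, U) * lam_coeff (T, V) * (\<Prod>p\<in>U \<union> V. rho (p \<in> U) (p \<in> V) a b p))"
    by (intro sum.cong refl sum.swap)
  also have "\<dots> = (\<Sum>S\<in>prime_sets X. \<Sum>U\<in>Pow S. \<Sum>y\<in>Sigma (prime_sets Y) Pow.
      lam_coeff (S, U) * lam_coeff y * (\<Prod>p\<in>U \<union> snd y. rho (p \<in> U) (p \<in> snd y) a b p))"
    by (intro sum.cong refl, subst sum.Sigma) (auto dest: prime_setsD simp: case_prod_beta)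
  also have "\<dots> = (\<Sum>x\<in>Sigma (prime_sets X) Pow. \<Sum>y\<in>Sigma (prime_sets Y) Pow.
      lam_coeff x * lam_coeff y * (\<Prod>p\<in>snd x \<union> snd y. rho (p \<in> snd x) (p \<in> snd y) a b p))"
    by (subst sum.Sigma) (auto dest: prime_setsD simp: case_prod_beta)
  finally show ?thesis .
qed

text \<open>For fixed d the sum of d / phi(q) over the multiples q of d is at most d / phi(d) times
  \<open>L_sum X\<close>, and d / phi(d) is at most \<open>2 ^ card U\<close>. The large factor d of
  the coefficients thus costs no power of \<open>X\<close>.\<close>

lemma sum_lam_coeff_le:
  assumes "\<And>U. U \<in> prime_sets X \<Longrightarrow> H U \<ge> 0"
  shows "(\<Sum>x\<in>Sigma (prime_sets X) Pow. \<bar>lam_coeff x\<bar> * H (snd x))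
           \<le> L_sum X * (\<Sum>U\<in>prime_sets X. 2 ^ card U * H U)"
proof -
  have wt0: "prime_wt S \<ge> 0" if "S \<in> prime_sets X" for S
    using prime_wt_pos[of S] prime_setsD(2)[OF that] by force
  have "(\<Sum>x\<in>Sigma (prime_sets X) Pow. \<bar>lam_coeff x\<bar> * H (snd x))
      = (\<Sum>S\<in>prime_sets X. \<Sum>U\<in>Pow S. \<bar>lam_coeff (S, U)\<bar> * H U)"
    by (subst sum.Sigma) (auto dest: prime_setsD simp: case_prod_beta)
  also have "\<dots> = (\<Sum>S\<in>prime_sets X. \<Sum>U\<in>Pow S. (prime_wt U * real (\<Prod>U) * H U) * prime_wt (S - U))"
  proof (intro sum.cong refl)
    fix S U assume S: "S \<in> prime_sets X" and U: "U \<in> Pow S"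
    have "prime_wt (U \<union> (S - U)) = prime_wt U * prime_wt (S - U)"
      using U prime_setsD[OF S] by (intro prime_wt_Un) (auto intro: finite_subset)
    moreover have "U \<union> (S - U) = S" using U by auto
    ultimately have "prime_wt S = prime_wt U * prime_wt (S - U)" by simp
    moreover have "\<bar>\<Prod>p\<in>U. - real p\<bar> = real (\<Prod>U)" by (simp add: abs_prod)
    moreover have "\<bar>prime_wt S\<bar> = prime_wt S" using wt0[OF S] by simp
    ultimately show "\<bar>lam_coeff (S, U)\<bar> * H U = (prime_wt U * real (\<Prod>U) * H U) * prime_wt (S - U)"
      by (simp add: lam_coeff_def abs_mult)
  qed
  also have "\<dots> \<le> (\<Sum>U\<in>prime_sets X. prime_wt U * real (\<Prod>U) * H U) * L_sum X"
    unfolding L_sum_def by (rule sum_prime_sets_split_le) (auto simp: wt0 assms)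
  also have "\<dots> \<le> (\<Sum>U\<in>prime_sets X. 2 ^ card U * H U) * L_sum X"
  proof (rule mult_right_mono[OF sum_mono L_sum_nonneg])
    fix U assume U: "U \<in> prime_sets X"
    have "real (\<Prod>U) > 0" using Prod_prime_sets_ge_1[OF U] by (subst of_nat_0_less_iff) linarith
    hence "prime_wt U * real (\<Prod>U) \<le> 2 ^ card U"
      using prime_wt_le[of U] prime_setsD(2)[OF U] by (simp add: pos_le_divide_eq)
    thus "prime_wt U * real (\<Prod>U) * H U \<le> 2 ^ card U * H U"
      using assms[OF U] by (intro mult_right_mono) auto
  qed
  finally show ?thesis by (simp add: mult.commute)
qed

lemma corr_approx:
  assumes N: "N \<ge> 1"
  shows "\<bar>(\<Sum>m=1..N. mangoldt m * (lam_sets X (int m + a) * lam_sets Y (int m + b))) - real N * corr X Y a b\<bar>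
    \<le> L_sum X * L_sum Y * (\<Sum>S\<in>prime_sets X. \<Sum>T\<in>prime_sets Y.
          2 ^ card S * 2 ^ card T * (E_max N (\<Prod>(S \<union> T)) + ln (real N)))"
proof -
  define PX where "PX = Sigma (prime_sets X) Pow"
  define PY where "PY = Sigma (prime_sets Y) Pow"
  define H where "H S T = E_max N (\<Prod>(S \<union> T)) + ln (real N)" for S T
  define D where "D S T = psi_sets N S T a b - real N * (\<Prod>p\<in>S \<union> T. rho (p \<in> S) (p \<in> T) a b p)" for S T
  have H0: "H S T \<ge> 0" if "S \<in> prime_sets X" "T \<in> prime_sets Y" for S T
    unfolding H_def using N prod_primes_pos[of "S \<union> T"] prime_setsD(2)[OF that(1)] prime_setsD(2)[OF that(2)]
    by (intro add_nonneg_nonneg E_max_nonneg) auto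
  have DH: "\<bar>D S T\<bar> \<le> H S T" if "S \<in> prime_sets X" "T \<in> prime_sets Y" for S T
    unfolding D_def H_def using N prime_setsD[OF that(1)] prime_setsD[OF that(2)]
    by (intro psi_sets_approx) auto
  have psi: "psi_sets N U V a b = (\<Sum>m=1..N. mangoldt m * (all_dvd U (int m + a) * all_dvd V (int m + b)))" for U V
    unfolding psi_sets_def by (intro sum.mono_neutral_cong_left) (auto simp: all_dvd_def)
  have "(\<Sum>m=1..N. mangoldt m * (lam_sets X (int m + a) * lam_sets Y (int m + b)))
      = (\<Sum>m=1..N. \<Sum>x\<in>PX. \<Sum>y\<in>PY. lam_coeff x * lam_coeff y *
           (mangoldt m * (all_dvd (snd x) (int m + a) * all_dvd (snd y) (int m + b))))"
  proof (intro sum.cong refl)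
    fix m
    have "lam_sets X (int m + a) * lam_sets Y (int m + b) =
        (\<Sum>x\<in>PX. \<Sum>y\<in>PY. (lam_coeff x * all_dvd (snd x) (int m + a)) * (lam_coeff y * all_dvd (snd y) (int m + b)))"
      unfolding lam_sets_expand PX_def PY_def by (rule sum_product)
    thus "mangoldt m * (lam_sets X (int m + a) * lam_sets Y (int m + b)) =
        (\<Sum>x\<in>PX. \<Sum>y\<in>PY. lam_coeff x * lam_coeff y *
           (mangoldt m * (all_dvd (snd x) (int m + a) * all_dvd (snd y) (int m + b))))"
      by (simp add: sum_distrib_left mult_ac)
  qed
  also have "\<dots> = (\<Sum>x\<in>PX. \<Sum>m=1..N. \<Sum>y\<in>PY. lam_coeff x * lam_coeff y *
           (mangoldt m * (all_dvd (snd x) (int m + a) * all_dvd (snd y) (int m + b))))"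
    by (rule sum.swap)
  also have "\<dots> = (\<Sum>x\<in>PX. \<Sum>y\<in>PY. \<Sum>m=1..N. lam_coeff x * lam_coeff y *
           (mangoldt m * (all_dvd (snd x) (int m + a) * all_dvd (snd y) (int m + b))))"
    by (intro sum.cong refl sum.swap)
  also have "\<dots> = (\<Sum>x\<in>PX. \<Sum>y\<in>PY. lam_coeff x * lam_coeff y * psi_sets N (snd x) (snd y) a b)"
    unfolding psi sum_distrib_left ..
  finally have "(\<Sum>m=1..N. mangoldt m * (lam_sets X (int m + a) * lam_sets Y (int m + b))) - real N * corr X Y a b
      = (\<Sum>x\<in>PX. \<Sum>y\<in>PY. lam_coeff x * lam_coeff y * D (snd x) (snd y))"
    unfolding corr_expand D_def PX_def PY_def
    by (simp add: right_diff_distrib sum_subtractf sum_distrib_left mult_ac)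
  also have "\<bar>\<dots>\<bar> \<le> (\<Sum>x\<in>PX. \<bar>\<Sum>y\<in>PY. lam_coeff x * lam_coeff y * D (snd x) (snd y)\<bar>)"
    by (rule sum_abs)
  also have "\<dots> \<le> (\<Sum>x\<in>PX. \<bar>lam_coeff x\<bar> * (\<Sum>y\<in>PY. \<bar>lam_coeff y\<bar> * H (snd x) (snd y)))"
  proof (intro sum_mono)
    fix x assume x: "x \<in> PX"
    hence x': "snd x \<in> prime_sets X" by (auto simp: PX_def intro: prime_sets_mono)
    have "\<bar>\<Sum>y\<in>PY. lam_coeff x * lam_coeff y * D (snd x) (snd y)\<bar>
        \<le> (\<Sum>y\<in>PY. \<bar>lam_coeff x * lam_coeff y * D (snd x) (snd y)\<bar>)" by (rule sum_abs)
    also have "\<dots> \<le> (\<Sum>y\<in>PY. \<bar>lam_coeff x\<bar> * (\<bar>lam_coeff y\<bar> * H (snd x) (snd y)))"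
    proof (intro sum_mono)
      fix y assume y: "y \<in> PY"
      hence y': "snd y \<in> prime_sets Y" by (auto simp: PY_def intro: prime_sets_mono)
      show "\<bar>lam_coeff x * lam_coeff y * D (snd x) (snd y)\<bar> \<le> \<bar>lam_coeff x\<bar> * (\<bar>lam_coeff y\<bar> * H (snd x) (snd y))"
        using DH[OF x' y'] by (simp add: abs_mult mult.assoc mult_left_mono)
    qed
    finally show "\<bar>\<Sum>y\<in>PY. lam_coeff x * lam_coeff y * D (snd x) (snd y)\<bar>
        \<le> \<bar>lam_coeff x\<bar> * (\<Sum>y\<in>PY. \<bar>lam_coeff y\<bar> * H (snd x) (snd y))"
      by (simp add: sum_distrib_left)
  qed
  also have "\<dots> \<le> (\<Sum>x\<in>PX. \<bar>lam_coeff x\<bar> * (L_sum Y * (\<Sum>T\<in>prime_sets Y. 2 ^ card T * H (snd x) T)))"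
  proof (intro sum_mono mult_left_mono)
    fix x assume x: "x \<in> PX"
    hence x': "snd x \<in> prime_sets X" by (auto simp: PX_def intro: prime_sets_mono)
    show "(\<Sum>y\<in>PY. \<bar>lam_coeff y\<bar> * H (snd x) (snd y)) \<le> L_sum Y * (\<Sum>T\<in>prime_sets Y. 2 ^ card T * H (snd x) T)"
      unfolding PY_def by (rule sum_lam_coeff_le) (use H0 x' in auto)
  qed auto
  also have "\<dots> \<le> L_sum X * (\<Sum>S\<in>prime_sets X. 2 ^ card S * (L_sum Y * (\<Sum>T\<in>prime_sets Y. 2 ^ card T * H S T)))"
    unfolding PX_def
    by (rule sum_lam_coeff_le) (intro mult_nonneg_nonneg L_sum_nonneg sum_nonneg H0; simp)
  also have "\<dots> = L_sum X * L_sum Y * (\<Sum>S\<in>prime_sets X. \<Sum>T\<in>prime_sets Y. 2 ^ card S * 2 ^ card T * H S T)"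
    by (simp add: sum_distrib_left mult_ac)
  finally show ?thesis by (simp add: H_def)
qed

lemma prime_sets_Un:
  assumes "S \<in> prime_sets X" "T \<in> prime_sets Y"
  shows "S \<union> T \<in> prime_sets (X * Y)"
proof -
  note S = prime_setsD[OF assms(1)] and T = prime_setsD[OF assms(2)]
  have "\<Prod>(S \<union> T) * \<Prod>(S \<inter> T) = \<Prod>S * \<Prod>T"
    using S T by (intro prod.union_inter) auto
  moreover have "\<Prod>(S \<inter> T) > 0" using S T by (intro prod_primes_pos) auto
  ultimately have "\<Prod>(S \<union> T) \<le> \<Prod>S * \<Prod>T"
    by (metis le_add1 mult.right_neutral mult_le_mono2 One_nat_def Suc_leI)
  also have "\<dots> \<le> X * Y" using S T by (intro mult_le_mono) auto
  finally show ?thesis using S T by (auto simp: prime_sets_def)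
qed

text \<open>The 16 is \<open>4 * 4\<close> for each prime of the union \<open>U\<close>: at most
  \<open>4 ^ card U\<close> pairs of subsets have union \<open>U\<close>, and the weight of each is
  at most \<open>2 ^ card U * 2 ^ card U\<close>.\<close>

lemma sum_prime_sets_Un_le:
  fixes H :: "nat \<Rightarrow> real"
  assumes H: "\<And>r. r > 0 \<Longrightarrow> H r \<ge> 0"
  shows "(\<Sum>S\<in>prime_sets X. \<Sum>T\<in>prime_sets Y. 2 ^ card S * 2 ^ card T * H (\<Prod>(S \<union> T)))
     \<le> (\<Sum>U\<in>prime_sets (X * Y). 16 ^ card U * H (\<Prod>U))"
proof -
  define h where "h = (\<lambda>(S :: nat set, T). (S \<union> T, S, T))"
  define Z where "Z = Sigma (prime_sets (X * Y)) (\<lambda>U. Pow U \<times> Pow U)"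
  define F where "F = (\<lambda>(U :: nat set, S :: nat set, T :: nat set). 2 ^ card S * 2 ^ card T * H (\<Prod>U) :: real)"
  have inj: "inj_on h (prime_sets X \<times> prime_sets Y)" by (auto simp: inj_on_def h_def)
  have HU: "H (\<Prod>U) \<ge> 0" if "U \<in> prime_sets (X * Y)" for U
    using Prod_prime_sets_ge_1[OF that] by (intro H) auto
  have finZ: "finite Z" unfolding Z_def by (auto dest: prime_setsD)
  have "(\<Sum>S\<in>prime_sets X. \<Sum>T\<in>prime_sets Y. 2 ^ card S * 2 ^ card T * H (\<Prod>(S \<union> T)))
      = (\<Sum>x\<in>prime_sets X \<times> prime_sets Y. F (h x))"
    by (simp add: sum.cartesian_product F_def h_def case_prod_beta)
  also have "\<dots> = sum F (h ` (prime_sets X \<times> prime_sets Y))"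
    by (subst sum.reindex[OF inj]) simp
  also have "\<dots> \<le> sum F Z"
  proof (rule sum_mono2[OF finZ])
    show "h ` (prime_sets X \<times> prime_sets Y) \<subseteq> Z"
      by (auto simp: h_def Z_def intro: prime_sets_Un)
  qed (auto simp: F_def Z_def HU)
  also have "\<dots> = (\<Sum>U\<in>prime_sets (X * Y). \<Sum>x\<in>Pow U \<times> Pow U. F (U, x))"
    unfolding Z_def by (subst sum.Sigma) (auto dest: prime_setsD)
  also have "\<dots> \<le> (\<Sum>U\<in>prime_sets (X * Y). \<Sum>x\<in>Pow U \<times> Pow U. 4 ^ card U * H (\<Prod>U))"
  proof (intro sum_mono)
    fix U x assume U: "U \<in> prime_sets (X * Y)" and x: "x \<in> Pow U \<times> Pow U"
    obtain S T where [simp]: "x = (S, T)" and ST: "S \<subseteq> U" "T \<subseteq> U" using x by (cases x) auto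
    have "(2 :: real) ^ card S * 2 ^ card T \<le> 2 ^ card U * 2 ^ card U"
      using ST prime_setsD(1)[OF U] by (intro mult_mono power_increasing card_mono) auto
    also have "\<dots> = 4 ^ card U" by (simp flip: power_mult_distrib)
    finally show "F (U, x) \<le> 4 ^ card U * H (\<Prod>U)"
      using HU[OF U] by (simp add: F_def mult_right_mono)
  qed
  also have "\<dots> = (\<Sum>U\<in>prime_sets (X * Y). 16 ^ card U * H (\<Prod>U))"
  proof (intro sum.cong refl)
    fix U assume U: "U \<in> prime_sets (X * Y)"
    have "real (card (Pow U \<times> Pow U)) = 4 ^ card U"
      using prime_setsD(1)[OF U] by (simp add: card_cartesian_product card_Pow flip: power_mult_distrib)
    moreover have "(4 :: real) ^ card U * 4 ^ card U = 16 ^ card U" by (simp flip: power_mult_distrib)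
    ultimately show "(\<Sum>x\<in>Pow U \<times> Pow U. 4 ^ card U * H (\<Prod>U)) = 16 ^ card U * H (\<Prod>U)"
      by (simp only: sum_constant flip: mult.assoc)
  qed
  finally show ?thesis .
qed

lemma card_cong_le:
  assumes "r > 0"
  shows "real (card {n \<in> {1..N}. [n = a] (mod r)}) \<le> real N / real r + 1"
proof -
  have "card {n \<in> {1..N}. [n = a] (mod r)} \<le> card {0..N div r}"
  proof (rule card_inj_on_le)
    show "inj_on (\<lambda>n. n div r) {n \<in> {1..N}. [n = a] (mod r)}"
    proof (rule inj_onI)
      fix m n assume "m \<in> {n \<in> {1..N}. [n = a] (mod r)}" "n \<in> {n \<in> {1..N}. [n = a] (mod r)}" "m div r = n div r"
      thus "m = n" unfolding mem_Collect_eq cong_def by (metis div_mult_mod_eq)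
    qed
  qed (auto intro: div_le_mono)
  hence "real (card {n \<in> {1..N}. [n = a] (mod r)}) \<le> real (N div r) + 1" by simp
  also have "real (N div r) \<le> real N / real r" 
    using assms div_times_less_eq_dividend[of N r]
    by (simp add: pos_le_divide_eq flip: of_nat_mult)
  finally show ?thesis by simp
qed

text \<open>Trivial bound by counting the class, where \<open>\<Prod>U \<le> N\<close> absorbs the
  rounding term. It controls the moduli with many prime factors, whose weights are too large for a
  direct use of the hypothesis.\<close>

lemma E_max_le:
  assumes U: "U \<in> prime_sets N" and N: "N \<ge> 3"
  shows "E_max N (\<Prod>U) \<le> 3 * real N * ln (real N) * (2 ^ card U / real (\<Prod>U))"
proof -
  define r where "r = \<Prod>U"
  have r: "r \<ge> 1" "r \<le> N" using U Prod_prime_sets_ge_1[OF U] prime_setsD(3)[OF U] by (auto simp: r_def)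
  have lnN: "ln (real N) \<ge> 1"
  proof -
    have "exp 1 \<le> real N" using N exp_le by linarith
    thus ?thesis using N by (subst ln_ge_iff) auto
  qed
  have bound: "\<bar>E_ap (real N) r a\<bar> \<le> 3 * real N * ln (real N) * (2 ^ card U / real r)" for a
  proof -
    have "psi_ap (real N) r a \<le> (\<Sum>n | n \<in> {1..N} \<and> [n = a] (mod r). ln (real N))"
      unfolding psi_ap_def floor_of_nat nat_int
    proof (intro sum_mono)
      fix n assume "n \<in> {n. n \<in> {1..N} \<and> [n = a] (mod r)}"
      thus "mangoldt n \<le> ln (real N)" using mangoldt_le[of n] by (auto intro: order.trans)
    qed
    also have "\<dots> = real (card {n \<in> {1..N}. [n = a] (mod r)}) * ln (real N)" by simp
    also have "\<dots> \<le> (real N / real r + 1) * ln (real N)"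
      using card_cong_le[of r N a] r lnN by (intro mult_right_mono) auto
    also have "\<dots> \<le> (2 * (real N / real r)) * ln (real N)"
      using r lnN by (intro mult_right_mono) (auto simp: field_simps)
    also have "\<dots> = 2 * real N * ln (real N) / real r" by simp
    also have "\<dots> \<le> 2 * real N * ln (real N) * 2 ^ card U / real r"
    proof (rule divide_right_mono)
      show "2 * real N * ln (real N) \<le> 2 * real N * ln (real N) * 2 ^ card U"
        using mult_left_mono[of 1 "2 ^ card U" "2 * real N * ln (real N)"] lnN by simp
    qed simp
    finally have 1: "psi_ap (real N) r a \<le> 2 * real N * ln (real N) * 2 ^ card U / real r" .
    have "real (totient r) = (\<Prod>p\<in>U. real p - 1)"
      unfolding r_def using prime_setsD[OF U] by (intro totient_prod_primes) auto
    hence "real N / real (totient r) = real N * prime_wt U" by (simp add: prime_wt_def prod_dividef)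
    also have "\<dots> \<le> real N * (2 ^ card U / real r)"
      unfolding r_def using prime_setsD[OF U] by (intro mult_left_mono prime_wt_le) auto
    also have "\<dots> \<le> real N * ln (real N) * (2 ^ card U / real r)"
    proof (rule mult_right_mono)
      show "real N \<le> real N * ln (real N)" using mult_left_mono[OF lnN, of "real N"] by simp
    qed simp
    finally have 2: "real N / real (totient r) \<le> real N * ln (real N) * 2 ^ card U / real r" by simp
    have 3: "psi_ap (real N) r a \<ge> 0" unfolding psi_ap_def by (intro sum_nonneg mangoldt_nonneg)
    have 4: "real N / real (totient r) \<ge> 0" by simp
    have "\<bar>E_ap (real N) r a\<bar> \<le> psi_ap (real N) r a + real N / real (totient r)"
    proof -
      have "\<bar>x - (if c then y else 0)\<bar> \<le> x + y" if "x \<ge> 0" "y \<ge> 0" for x y :: real and c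
        using that by auto
      from this[OF 3 4] show ?thesis unfolding E_ap_def .
    qed
    also have "\<dots> \<le> 3 * real N * ln (real N) * (2 ^ card U / real r)"
    proof -
      define t where "t = real N * ln (real N) * (2 ^ card U / real r)"
      have "psi_ap (real N) r a \<le> 2 * t" "real N / real (totient r) \<le> t"
        using 1 2 by (simp_all add: t_def mult_ac)
      hence "psi_ap (real N) r a + real N / real (totient r) \<le> 3 * t" by linarith
      also have "3 * t = 3 * real N * ln (real N) * (2 ^ card U / real r)" by (simp add: t_def)
      finally show ?thesis .
    qed
    finally show ?thesis .
  qed
  have "totatives r \<noteq> {}" using r totatives_cong[of 1 r] by auto
  thus ?thesis unfolding E_max_def r_def[symmetric] using bound by (subst Max_le_iff) auto
qed

section \<open>Error terms under the Elliott-Halberstam hypothesis\<close>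

lemma EH_sum_E_max:
  assumes "EH \<theta>" "\<theta>' < \<theta>" "A > 0"
  shows "\<exists>C>0. \<forall>\<^sub>F N in at_top. (\<Sum>r=1..nat \<lfloor>real N powr \<theta>'\<rfloor>. E_max N r) \<le> C * real N / ln (real N) powr A"
proof -
  have "\<theta> - \<theta>' > 0" using assms by simp
  hence "(\<lambda>x :: real. \<Sum>q = 1..nat \<lfloor>x powr (\<theta> - (\<theta> - \<theta>'))\<rfloor>. Max ((\<lambda>a. \<bar>E_ap x q a\<bar>) ` totatives q))
       \<in> O[at_top](\<lambda>x. x / (ln x) powr A)"
    using assms(1,3) unfolding EH_def by blast
  then obtain C where C: "C > 0"
    "\<forall>\<^sub>F x in at_top. norm (\<Sum>q = 1..nat \<lfloor>x powr (\<theta> - (\<theta> - \<theta>'))\<rfloor>. Max ((\<lambda>a. \<bar>E_ap x q a\<bar>) ` totatives q))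
        \<le> C * norm (x / (ln x) powr A)"
    by (elim landau_o.bigE)
  have "\<forall>\<^sub>F N in at_top. (\<Sum>r=1..nat \<lfloor>real N powr \<theta>'\<rfloor>. E_max N r) \<le> C * real N / ln (real N) powr A"
    using filterlim_real_sequentially[unfolded filterlim_iff, rule_format, OF C(2)]
    by eventually_elim (simp add: E_max_def)
  thus ?thesis using C(1) by blast
qed

text \<open>The number \<open>D\<close> is kept as a variable because powers with exponent 512 must not be evaluated.\<close>

lemma corr_approx_bound:
  fixes D :: nat
  assumes N: "N \<ge> 3" and XY: "X \<ge> 1" "Y \<ge> 1" "real (X * Y) \<le> real N powr \<theta>'" and \<theta>': "\<theta>' \<le> 1"
    and C: "C > 0" "(\<Sum>r=1..nat \<lfloor>real N powr \<theta>'\<rfloor>. E_max N r) \<le> C * real N / ln (real N) powr (D + 12)"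
    and D: "D = 512"
  shows "\<bar>(\<Sum>m=1..N. mangoldt m * (lam_sets X (int m + a) * lam_sets Y (int m + b))) - real N * corr X Y a b\<bar>
    \<le> real N * (48 * 2 ^ D / ln (real N) + 16 * C / ln (real N) ^ 2 + 2 ^ 20 * ln (real N) ^ 21 / real N powr (1 - \<theta>'))"
proof -
  define l where "l = ln (real N)"
  have l: "l \<ge> 1"
  proof -
    have "exp 1 \<le> real N" using N exp_le by linarith
    thus ?thesis unfolding l_def using N by (subst ln_ge_iff) auto
  qed
  have "real N powr \<theta>' \<le> real N powr 1" using N \<theta>' by (intro powr_mono) auto
  hence "real (X * Y) \<le> real N" using XY N by simp
  hence XYN: "X * Y \<le> N" by (simp only: of_nat_le_iff)
  have XY1: "X * Y \<ge> 1" using XY by (metis One_nat_def Suc_leI mult_pos_pos not_less_eq_eq not_gr0 le_zero_eq)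
  have XN: "X \<le> N" "Y \<le> N" using XYN XY
    by (metis dvd_imp_le dvd_triv_left dvd_triv_right le_trans One_nat_def Suc_le_lessD XY1)+
  have log_le: "0 \<le> 1 + ln (real x)" "1 + ln (real x) \<le> 2 * l" if "x \<ge> 1" "x \<le> N" for x
  proof -
    have "ln (real x) \<le> l" unfolding l_def using that by simp
    thus "1 + ln (real x) \<le> 2 * l" using l by simp
    show "0 \<le> 1 + ln (real x)" using that by simp
  qed
  have LX: "L_sum x \<le> (2 * l) ^ 2" if "x \<ge> 1" "x \<le> N" for x
    using L_sum_le[OF that(1)] power_mono[OF log_le(2)[OF that] log_le(1)[OF that], of 2] by linarith
  have LL: "L_sum X * L_sum Y \<le> 16 * l ^ 4"
  proof -
    have "L_sum X * L_sum Y \<le> (2 * l) ^ 2 * (2 * l) ^ 2"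
      using LX XY XN by (intro mult_mono L_sum_nonneg) auto
    also have "\<dots> = 16 * l ^ 4" by (simp add: power_mult_distrib flip: power_add)
    finally show ?thesis .
  qed
  have SC: "(\<Sum>U\<in>prime_sets (X * Y). real c ^ card U / real (\<Prod>U)) \<le> (2 * l) ^ c" for c
    using sum_power_card_div_le[OF XY1, of c] power_mono[OF log_le(2)[OF XY1 XYN] log_le(1)[OF XY1 XYN], of c]
    by linarith
  have EU: "E_max N (\<Prod>U) \<ge> 0" if "U \<in> prime_sets (X * Y)" for U
    using Prod_prime_sets_ge_1[OF that] by (intro E_max_nonneg) auto
  \<comment> \<open>The weights \<open>16 ^ card U\<close> are absorbed by the inequality \<open>w \<le> w^2 / Z + Z\<close>: the first part is
    bounded trivially, the second by the hypothesis.\<close>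
  define Z where "Z = l ^ (D + 6)"
  have Z: "Z > 0" using l by (simp add: Z_def)
  \<comment> \<open>256 is the square of the weight 16, and a further 2 per prime comes from
    \<open>E_max_le\<close>; hence \<open>512 = D\<close> as the exponent of the logarithm.\<close>
  have S1: "(\<Sum>U\<in>prime_sets (X * Y). 256 ^ card U * E_max N (\<Prod>U)) \<le> 3 * real N * l * (2 * l) ^ D"
  proof -
    have "(\<Sum>U\<in>prime_sets (X * Y). 256 ^ card U * E_max N (\<Prod>U))
        \<le> (\<Sum>U\<in>prime_sets (X * Y). 3 * real N * l * (real 512 ^ card U / real (\<Prod>U)))"
    proof (intro sum_mono)
      fix U assume U: "U \<in> prime_sets (X * Y)"
      hence "U \<in> prime_sets N" using XYN by (auto simp: prime_sets_def)
      hence "256 ^ card U * E_max N (\<Prod>U) \<le> 256 ^ card U * (3 * real N * l * (2 ^ card U / real (\<Prod>U)))"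
        unfolding l_def using N by (intro mult_left_mono E_max_le) auto
      also have "\<dots> = 3 * real N * l * ((256 ^ card U * 2 ^ card U) / real (\<Prod>U))" by simp
      also have "(256 :: real) ^ card U * 2 ^ card U = real 512 ^ card U" by (simp flip: power_mult_distrib)
      finally show "256 ^ card U * E_max N (\<Prod>U) \<le> 3 * real N * l * (real 512 ^ card U / real (\<Prod>U))" .
    qed
    also have "\<dots> \<le> 3 * real N * l * (2 * l) ^ 512"
      unfolding sum_distrib_left[symmetric] using l by (intro mult_left_mono SC) auto
    finally show ?thesis unfolding D .
  qed
  have S2: "(\<Sum>U\<in>prime_sets (X * Y). E_max N (\<Prod>U)) \<le> C * real N / l ^ (D + 12)"
  proof -
    have "(\<Sum>U\<in>prime_sets (X * Y). E_max N (\<Prod>U)) \<le> (\<Sum>r=1..X * Y. E_max N r)"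
      by (rule sum_prime_sets_le) (auto intro: E_max_nonneg)
    also have "\<dots> \<le> (\<Sum>r=1..nat \<lfloor>real N powr \<theta>'\<rfloor>. E_max N r)"
    proof (rule sum_mono2)
      have "X * Y \<le> nat \<lfloor>real N powr \<theta>'\<rfloor>" using XY(3) by (simp add: le_nat_floor)
      thus "{1..X * Y} \<subseteq> {1..nat \<lfloor>real N powr \<theta>'\<rfloor>}" by auto
    qed (auto intro: E_max_nonneg)
    also have "\<dots> \<le> C * real N / ln (real N) powr (D + 12)" by (rule C(2))
    also have "ln (real N) powr (D + 12) = l ^ (D + 12)"
      using l powr_realpow[of l "D + 12"] by (simp add: l_def add_ac)
    finally show ?thesis .
  qed
  have S3: "(\<Sum>U\<in>prime_sets (X * Y). 16 ^ card U * l) \<le> real N powr \<theta>' * l * (2 * l) ^ 16"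
  proof -
    have "(\<Sum>U\<in>prime_sets (X * Y). 16 ^ card U * l) \<le> (\<Sum>U\<in>prime_sets (X * Y). real N powr \<theta>' * l * (real 16 ^ card U / real (\<Prod>U)))"
    proof (intro sum_mono)
      fix U assume U: "U \<in> prime_sets (X * Y)"
      have pos: "real (\<Prod>U) > 0" using Prod_prime_sets_ge_1[OF U] by (subst of_nat_0_less_iff) linarith
      have "real (\<Prod>U) \<le> real N powr \<theta>'" using prime_setsD(3)[OF U] XY(3) by (meson of_nat_le_iff order.trans)
      hence "16 ^ card U * l * real (\<Prod>U) \<le> 16 ^ card U * l * real N powr \<theta>'" using l by (intro mult_left_mono) auto
      thus "16 ^ card U * l \<le> real N powr \<theta>' * l * (real 16 ^ card U / real (\<Prod>U))"
        using pos by (simp add: pos_le_divide_eq mult_ac)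
    qed
    also have "\<dots> \<le> real N powr \<theta>' * l * (2 * l) ^ 16"
      unfolding sum_distrib_left[symmetric] using l by (intro mult_left_mono SC) auto
    finally show ?thesis .
  qed
  have S4: "(\<Sum>U\<in>prime_sets (X * Y). 16 ^ card U * E_max N (\<Prod>U))
      \<le> 3 * real N * l * (2 * l) ^ D / Z + Z * (C * real N / l ^ (D + 12))"
  proof -
    have "(\<Sum>U\<in>prime_sets (X * Y). 16 ^ card U * E_max N (\<Prod>U))
       \<le> (\<Sum>U\<in>prime_sets (X * Y). (256 ^ card U * E_max N (\<Prod>U)) / Z + Z * E_max N (\<Prod>U))"
    proof (intro sum_mono)
      fix U assume U: "U \<in> prime_sets (X * Y)"
      have "(16 :: real) ^ card U \<le> 256 ^ card U / Z + Z"
      proof (cases "(16 :: real) ^ card U \<le> Z")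
        case False
        have "(16 :: real) ^ card U * Z \<le> 16 ^ card U * 16 ^ card U" using False by (intro mult_left_mono) auto
        also have "\<dots> = 256 ^ card U" by (simp flip: power_mult_distrib)
        finally have "(16 :: real) ^ card U \<le> 256 ^ card U / Z" using Z by (simp add: pos_le_divide_eq)
        thus ?thesis using Z by simp
      qed (use Z in \<open>auto intro: add_increasing\<close>)
      from mult_right_mono[OF this EU[OF U]]
      show "16 ^ card U * E_max N (\<Prod>U) \<le> (256 ^ card U * E_max N (\<Prod>U)) / Z + Z * E_max N (\<Prod>U)"
        by (simp add: algebra_simps)
    qed
    also have "\<dots> = (\<Sum>U\<in>prime_sets (X * Y). 256 ^ card U * E_max N (\<Prod>U)) / Z + Z * (\<Sum>U\<in>prime_sets (X * Y). E_max N (\<Prod>U))"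
      by (simp add: sum.distrib sum_divide_distrib sum_distrib_left)
    also have "\<dots> \<le> 3 * real N * l * (2 * l) ^ D / Z + Z * (C * real N / l ^ (D + 12))"
      using S1 S2 Z by (intro add_mono divide_right_mono mult_left_mono) auto
    finally show ?thesis .
  qed
  have "\<bar>(\<Sum>m=1..N. mangoldt m * (lam_sets X (int m + a) * lam_sets Y (int m + b))) - real N * corr X Y a b\<bar>
    \<le> L_sum X * L_sum Y * (\<Sum>S\<in>prime_sets X. \<Sum>T\<in>prime_sets Y.
          2 ^ card S * 2 ^ card T * (E_max N (\<Prod>(S \<union> T)) + ln (real N)))"
    using N by (intro corr_approx) auto
  also have "\<dots> \<le> L_sum X * L_sum Y * (\<Sum>U\<in>prime_sets (X * Y). 16 ^ card U * (E_max N (\<Prod>U) + ln (real N)))"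
    using N by (intro mult_left_mono sum_prime_sets_Un_le[where H = "\<lambda>r. E_max N r + ln (real N)"]
      mult_nonneg_nonneg L_sum_nonneg add_nonneg_nonneg E_max_nonneg) auto
  also have "\<dots> \<le> 16 * l ^ 4 * (\<Sum>U\<in>prime_sets (X * Y). 16 ^ card U * (E_max N (\<Prod>U) + ln (real N)))"
    using LL N EU by (intro mult_right_mono sum_nonneg mult_nonneg_nonneg add_nonneg_nonneg) auto
  also have "\<dots> = 16 * l ^ 4 * ((\<Sum>U\<in>prime_sets (X * Y). 16 ^ card U * E_max N (\<Prod>U)) + (\<Sum>U\<in>prime_sets (X * Y). 16 ^ card U * l))"
    by (simp add: sum.distrib algebra_simps l_def)
  also have "\<dots> \<le> 16 * l ^ 4 * ((3 * real N * l * (2 * l) ^ D / Z + Z * (C * real N / l ^ (D + 12))) + real N powr \<theta>' * l * (2 * l) ^ 16)"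
    using S3 S4 l by (intro mult_left_mono add_mono) auto
  \<comment> \<open>The exponents \<open>D + 6\<close> in \<open>Z\<close> and \<open>D + 12\<close>
    in the hypothesis are fitted to the prefactor \<open>16 * l ^ 4\<close>: the first part is left
    with \<open>l\<close> to the power 4 + 1 + D - (D + 6) = -1, the second with 4 + (D + 6) - (D +
    12) = -2.\<close>
  also have "\<dots> = real N * (48 * 2 ^ D / l + 16 * C / l ^ 2) + 2 ^ 20 * l ^ 21 * real N powr \<theta>'"
  proof -
    have "l ^ (D + 6) = l ^ D * l ^ 6" "l ^ (D + 12) = l ^ D * l ^ 12" by (simp_all add: power_add)
    moreover have "l ^ D > 0" "l > 0" using l by auto
    ultimately show ?thesis unfolding Z_def power_mult_distrib
      by (simp add: field_simps) (simp add: eval_nat_numeral)?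
  qed
  also have "real N powr \<theta>' = real N * (1 / real N powr (1 - \<theta>'))"
    using N by (simp add: powr_diff)
  also have "real N * (48 * 2 ^ D / l + 16 * C / l ^ 2) + 2 ^ 20 * l ^ 21 * (real N * (1 / real N powr (1 - \<theta>')))
     = real N * (48 * 2 ^ D / l + 16 * C / l ^ 2 + 2 ^ 20 * l ^ 21 / real N powr (1 - \<theta>'))"
    by (simp add: algebra_simps)
  finally show ?thesis by (simp add: l_def)
qed

text \<open>The shifts enter only through residue classes, over which \<open>E_max\<close> takes the
  maximum. The threshold for \<open>N\<close> is therefore the same for all \<open>a\<close>,
  \<open>b\<close>, \<open>X\<close> and \<open>Y\<close>, which allows summing over all tuples of
  shifts later.\<close>

lemma corr_approx_EH:
  assumes EH: "EH \<theta>" and \<theta>: "\<theta> \<le> 1" "\<theta>' < \<theta>" and \<epsilon>: "\<epsilon> > 0"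
  shows "\<forall>\<^sub>F N in at_top. \<forall>X Y a b. X \<ge> 1 \<longrightarrow> Y \<ge> 1 \<longrightarrow> real (X * Y) \<le> real N powr \<theta>' \<longrightarrow>
    \<bar>(\<Sum>m=1..N. mangoldt m * (lam_sets X (int m + a) * lam_sets Y (int m + b))) - real N * corr X Y a b\<bar>
      \<le> \<epsilon> * real N"
proof -
  obtain D :: nat where D: "D = 512" by blast
  obtain C where C: "C > 0"
    "\<forall>\<^sub>F N in at_top. (\<Sum>r=1..nat \<lfloor>real N powr \<theta>'\<rfloor>. E_max N r) \<le> C * real N / ln (real N) powr (D + 12)"
    using EH_sum_E_max[OF EH \<theta>(2), of "real D + 12"] by (auto simp: add_ac)
  define \<delta> where "\<delta> = 1 - \<theta>'"
  have \<delta>: "\<delta> > 0" using \<theta> by (simp add: \<delta>_def)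
  define K where "K = 48 * (2 :: real) ^ D"
  have "((\<lambda>N. K / ln (real N) + 16 * C / ln (real N) ^ 2 + 2 ^ 20 * ln (real N) ^ 21 / real N powr \<delta>) \<longlongrightarrow> 0) at_top"
    using \<delta> by real_asymp
  hence "\<forall>\<^sub>F N in at_top. K / ln (real N) + 16 * C / ln (real N) ^ 2 + 2 ^ 20 * ln (real N) ^ 21 / real N powr \<delta> < \<epsilon>"
    using \<epsilon> by (rule order_tendstoD)
  moreover have "\<forall>\<^sub>F N in at_top. N \<ge> (3 :: nat)" by (rule eventually_ge_at_top)
  ultimately show ?thesis using C(2)
  proof eventually_elim
    case (elim N)
    show ?case
    proof (intro allI impI)
      fix X Y a b assume XY: "X \<ge> 1" "Y \<ge> 1" "real (X * Y) \<le> real N powr \<theta>'"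
      have "\<bar>(\<Sum>m=1..N. mangoldt m * (lam_sets X (int m + a) * lam_sets Y (int m + b))) - real N * corr X Y a b\<bar>
        \<le> real N * (K / ln (real N) + 16 * C / ln (real N) ^ 2 + 2 ^ 20 * ln (real N) ^ 21 / real N powr \<delta>)"
        unfolding K_def \<delta>_def using \<theta> by (intro corr_approx_bound[OF elim(2) XY _ C(1) elim(3) D]) auto
      also have "\<dots> \<le> real N * \<epsilon>" using elim(1) by (intro mult_left_mono) auto
      finally show "\<bar>(\<Sum>m=1..N. mangoldt m * (lam_sets X (int m + a) * lam_sets Y (int m + b))) - real N * corr X Y a b\<bar>
        \<le> \<epsilon> * real N" by (simp add: mult.commute)
    qed
  qed
qed

section \<open>Sums of periodic products over short intervals\<close>

lemma periodic_mod:
  fixes F :: "int \<Rightarrow> real"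
  assumes "\<And>x. F (x + Q) = F x"
  shows "F (x mod Q) = F x"
proof -
  have "F (y + int k * Q) = F y" for y k
  proof (induction k)
    case (Suc k)
    have "F (y + int (Suc k) * Q) = F ((y + int k * Q) + Q)" by (simp add: algebra_simps)
    thus ?case using assms Suc by simp
  qed simp
  hence *: "F (y + k * Q) = F y" for y k
    by (metis add.commute diff_add_cancel int_of_nat_induct mult_minus_left nat_int_comparison(1) uminus_add_conv_diff int_cases2)
  show ?thesis using *[of "x mod Q" "x div Q"] by (simp add: mod_div_mult_eq)
qed

lemma sum_period:
  fixes F :: "int \<Rightarrow> real"
  assumes "\<And>x. F (x + Q) = F x" "Q > 0"
  shows "(\<Sum>x\<in>{c..<c+Q}. F x) = (\<Sum>x\<in>{0..<Q}. F x)"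
proof -
  have inj: "inj_on (\<lambda>x. x mod Q) {c..<c+Q}"
  proof (rule inj_onI)
    fix x y assume xy: "x \<in> {c..<c+Q}" "y \<in> {c..<c+Q}" "x mod Q = y mod Q"
    hence "Q dvd x - y" by (simp add: mod_eq_dvd_iff)
    then obtain k where k: "x - y = Q * k" by auto
    have "\<bar>x - y\<bar> < Q" using xy by auto
    hence "\<bar>k\<bar> < 1" using k assms(2) by (simp add: abs_mult)
    thus "x = y" using k by simp
  qed
  have "(\<lambda>x. x mod Q) ` {c..<c+Q} = {0..<Q}"
    using assms(2) inj by (intro card_subset_eq) (auto simp: card_image)
  hence "(\<Sum>x\<in>{0..<Q}. F x) = (\<Sum>x\<in>{c..<c+Q}. F (x mod Q))"
    using sum.reindex[OF inj, of F] by simp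
  thus ?thesis using periodic_mod[of F Q, OF assms(1)] by simp
qed

text \<open>Complete blocks of length \<open>Q\<close> cancel; fewer than \<open>Q\<close> terms
  remain, each of size at most 1.\<close>

lemma sum_periodic_bound:
  fixes F :: "int \<Rightarrow> real" and Q h :: nat
  assumes per: "\<And>x. F (x + int Q) = F x" and Q: "Q > 0" and F1: "\<And>x. \<bar>F x\<bar> \<le> 1"
    and zero: "(\<Sum>x\<in>{0..<int Q}. F x) = 0"
  shows "\<bar>\<Sum>x\<in>{1..int h}. F x\<bar> \<le> real Q"
proof (induction h rule: less_induct)
  case (less h)
  show ?case
  proof (cases "h < Q")
    case True
    have "\<bar>\<Sum>x\<in>{1..int h}. F x\<bar> \<le> (\<Sum>x\<in>{1..int h}. 1)"
      using F1 by (intro order.trans[OF sum_abs] sum_mono)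
    thus ?thesis using True by simp
  next
    case False
    have "{1..int h} = {1..int (h - Q)} \<union> {int (h - Q) + 1..<int (h - Q) + 1 + int Q}"
      using False by auto
    moreover have "{1..int (h - Q)} \<inter> {int (h - Q) + 1..<int (h - Q) + 1 + int Q} = {}" by auto
    ultimately have "(\<Sum>x\<in>{1..int h}. F x) = (\<Sum>x\<in>{1..int (h - Q)}. F x) + (\<Sum>x\<in>{int (h - Q) + 1..<int (h - Q) + 1 + int Q}. F x)"
      by (simp add: sum.union_disjoint)
    also have "(\<Sum>x\<in>{int (h - Q) + 1..<int (h - Q) + 1 + int Q}. F x) = 0"
      using sum_period[of F "int Q", OF per] Q zero by simp
    finally show ?thesis using less.IH[of "h - Q"] False Q by simp
  qed
qed

text \<open>Write \<open>x = r + t * n\<close>. Then \<open>g\<close> depends on \<open>r\<close>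
  only, while for fixed \<open>r\<close> the values \<open>r + t * n\<close> run through all
  residues modulo \<open>p\<close>, over which \<open>f\<close> sums to 0.\<close>

lemma sum_periodic_mult_zero:
  fixes f g :: "int \<Rightarrow> real" and p n :: nat
  assumes f: "\<And>x. f (x + int p) = f x" and g: "\<And>x. g (x + int n) = g x"
    and pn: "p > 0" "n > 0" "coprime p n" and zero: "(\<Sum>x\<in>{0..<int p}. f x) = 0"
  shows "(\<Sum>x\<in>{0..<int (p * n)}. f x * g x) = 0"
proof -
  have bij: "bij_betw (\<lambda>(r, t). r + t * int n) ({0..<int n} \<times> {0..<int p}) {0..<int (p * n)}"
  proof (rule bij_betw_byWitness[where f' = "\<lambda>x. (x mod int n, x div int n)"])
    show "(\<lambda>(r, t). r + t * int n) ` ({0..<int n} \<times> {0..<int p}) \<subseteq> {0..<int (p * n)}"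
    proof safe
      fix r t assume "r \<in> {0..<int n}" "t \<in> {0..<int p}"
      hence rt: "0 \<le> r" "r < int n" "0 \<le> t" "t + 1 \<le> int p" by auto
      have "(t + 1) * int n \<le> int p * int n" using rt by (intro mult_right_mono) auto
      hence "r + t * int n < int (p * n)" using rt by (simp add: algebra_simps)
      moreover have "0 \<le> r + t * int n" using rt by simp
      ultimately show "r + t * int n \<in> {0..<int (p * n)}" by simp
    qed
    show "(\<lambda>x. (x mod int n, x div int n)) ` {0..<int (p * n)} \<subseteq> {0..<int n} \<times> {0..<int p}"
    proof safe
      fix x assume x: "x \<in> {0..<int (p * n)}"
      have "x div int n * int n \<le> x" using pn by (simp add: minus_mod_eq_div_mult[symmetric])
      also have "x < int p * int n" using x by simp
      finally have "x div int n < int p" by (rule mult_right_less_imp_less) simp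
      thus "x div int n \<in> {0..<int p}" using x pn by (simp add: pos_imp_zdiv_nonneg_iff)
      show "x mod int n \<in> {0..<int n}" using pn by simp
    qed
  qed (use pn in auto)
  have "(\<Sum>x\<in>{0..<int (p * n)}. f x * g x) = (\<Sum>(r,t)\<in>{0..<int n} \<times> {0..<int p}. f (r + t * int n) * g (r + t * int n))"
    using sum.reindex_bij_betw[OF bij, of "\<lambda>x. f x * g x"] by (simp add: case_prod_beta)
  also have "\<dots> = (\<Sum>r\<in>{0..<int n}. \<Sum>t\<in>{0..<int p}. f (r + t * int n) * g r)"
  proof -
    have "g (r + t * int n) = g r" for r t
      using periodic_mod[of g "int n", OF g, of "r + t * int n"] periodic_mod[of g "int n", OF g, of r] by simp
    thus ?thesis by (simp add: sum.cartesian_product)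
  qed
  also have "\<dots> = (\<Sum>r\<in>{0..<int n}. 0)"
  proof (intro sum.cong refl)
    fix r
    have inj: "inj_on (\<lambda>t. (r + t * int n) mod int p) {0..<int p}"
    proof (rule inj_onI)
      fix s t assume st: "s \<in> {0..<int p}" "t \<in> {0..<int p}" "(r + s * int n) mod int p = (r + t * int n) mod int p"
      hence "int p dvd (r + s * int n) - (r + t * int n)" by (simp add: mod_eq_dvd_iff)
      hence "int p dvd (s - t) * int n" by (simp add: algebra_simps)
      hence "int p dvd s - t" using pn by (simp add: coprime_dvd_mult_left_iff)
      hence "s mod int p = t mod int p" by (simp add: mod_eq_dvd_iff)
      thus "s = t" using st by simp
    qed
    have "(\<lambda>t. (r + t * int n) mod int p) ` {0..<int p} = {0..<int p}"
      using pn inj by (intro card_subset_eq) (auto simp: card_image)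
    hence "(\<Sum>x\<in>{0..<int p}. f x) = (\<Sum>t\<in>{0..<int p}. f ((r + t * int n) mod int p))"
      using sum.reindex[OF inj, of f] by simp
    also have "\<dots> = (\<Sum>t\<in>{0..<int p}. f (r + t * int n))"
      using periodic_mod[of f "int p", OF f] by simp
    finally show "(\<Sum>t\<in>{0..<int p}. f (r + t * int n) * g r) = 0"
      using zero by (simp flip: sum_distrib_right)
  qed
  finally show ?thesis by simp
qed

text \<open>A single factor of mean zero is enough: its modulus is coprime to the period of the
  remaining product.\<close>

lemma sum_prod_periodic_bound:
  fixes f :: "nat \<Rightarrow> int \<Rightarrow> real"
  assumes U: "finite U" "\<And>p. p \<in> U \<Longrightarrow> prime p"
    and per: "\<And>p x. p \<in> U \<Longrightarrow> f p (x + int p) = f p x"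
    and f1: "\<And>p x. p \<in> U \<Longrightarrow> \<bar>f p x\<bar> \<le> 1"
    and q: "q \<in> U" "(\<Sum>x\<in>{0..<int q}. f q x) = 0"
  shows "\<bar>\<Sum>x\<in>{1..int h}. \<Prod>p\<in>U. f p x\<bar> \<le> real (\<Prod>U)"
proof -
  have per': "f p (x + int k * int p) = f p x" if "p \<in> U" for p x k
    using periodic_mod[of "f p" "int p", OF per[OF that], of x]
      periodic_mod[of "f p" "int p", OF per[OF that], of "x + int k * int p"] by simp
  have perP: "(\<Prod>p\<in>V. f p (x + int (\<Prod>V))) = (\<Prod>p\<in>V. f p x)" if V: "V \<subseteq> U" for V x
  proof (intro prod.cong refl)
    fix p assume p: "p \<in> V"
    hence "p dvd \<Prod>V" using V U by (intro dvd_prodI) (auto intro: finite_subset)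
    then obtain k where k: "\<Prod>V = p * k" by auto
    show "f p (x + int (\<Prod>V)) = f p x" unfolding k using per'[of p x k] p V by (auto simp: mult.commute)
  qed
  define V where "V = U - {q}"
  have V: "finite V" "V \<subseteq> U" "q \<notin> V" "U = insert q V" using U q by (auto simp: V_def)
  have cop: "coprime q (\<Prod>V)"
  proof (rule prod_coprime_right)
    fix p assume "p \<in> V"
    thus "coprime q p" using V U q(1) by (intro primes_coprime) auto
  qed
  have "(\<Sum>x\<in>{0..<int (q * \<Prod>V)}. f q x * (\<Prod>p\<in>V. f p x)) = 0"
  proof (rule sum_periodic_mult_zero)
    show "\<Prod>V > 0" using V U by (intro prod_primes_pos) auto
    show "q > 0" using U q by (simp add: prime_gt_0_nat)
    show "(\<Prod>p\<in>V. f p (x + int (\<Prod>V))) = (\<Prod>p\<in>V. f p x)" for x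
      by (rule perP[OF V(2)])
  qed (use per q cop in auto)
  hence zero: "(\<Sum>x\<in>{0..<int (\<Prod>U)}. \<Prod>p\<in>U. f p x) = 0"
    unfolding V(4) using V(1,3) by simp
  show ?thesis
  proof (rule sum_periodic_bound)
    show "(\<Prod>p\<in>U. f p (x + int (\<Prod>U))) = (\<Prod>p\<in>U. f p x)" for x by (rule perP) simp
    show "\<Prod>U > 0" using U by (intro prod_primes_pos) auto
    show "\<bar>\<Prod>p\<in>U. f p x\<bar> \<le> 1" for x
      unfolding abs_prod using f1 by (intro prod_le_1) auto
  qed (fact zero)
qed

section \<open>Sums of powers of the gcd of \<open>\<Prod>U\<close> with a varying nonzero
  integer\<close>

definition gcd_set :: "nat set \<Rightarrow> int \<Rightarrow> real" where
  "gcd_set U x = (\<Prod>p\<in>U. if int p dvd x then real p else 1)"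

lemma gcd_set_nonneg [simp]: "gcd_set U x \<ge> 0"
  unfolding gcd_set_def by (intro prod_nonneg) auto

text \<open>Leaving out 0 removes the usual additional 1, so the bound keeps decaying for
  \<open>d\<close> beyond \<open>h\<close>.\<close>

lemma card_multiples_le:
  assumes "d > 0"
  shows "real (card {x \<in> {-int h..int h} - {0}. int d dvd x}) \<le> 2 * real h / real d"
proof -
  define k where "k = h div d"
  have "{x \<in> {-int h..int h} - {0}. int d dvd x} \<subseteq> (\<lambda>y. int d * y) ` ({-int k..int k} - {0})"
  proof
    fix x assume "x \<in> {x \<in> {-int h..int h} - {0}. int d dvd x}"
    hence x: "x \<in> {-int h..int h}" "x \<noteq> 0" "int d dvd x" by auto
    then obtain y where y: "x = int d * y" by auto
    have "int d * \<bar>y\<bar> \<le> int h" using x y by (auto simp: abs_if split: if_splits)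
    hence "\<bar>y\<bar> \<le> int k" unfolding k_def zdiv_int using assms
      by (metis mult.commute of_nat_0_less_iff zdiv_mono1 nonzero_mult_div_cancel_left less_irrefl)
    thus "x \<in> (\<lambda>y. int d * y) ` ({-int k..int k} - {0})" using x y by (intro image_eqI[of _ _ y]) auto
  qed
  hence "card {x \<in> {-int h..int h} - {0}. int d dvd x} \<le> card ((\<lambda>y. int d * y) ` ({-int k..int k} - {0}))"
    by (intro card_mono) auto
  also have "\<dots> \<le> card ({-int k..int k} - {0})" by (intro card_image_le) auto
  also have "\<dots> = 2 * k" by (subst card_Diff_singleton) auto
  finally have "real (card {x \<in> {-int h..int h} - {0}. int d dvd x}) \<le> 2 * real k" by simp
  also have "real k \<le> real h / real d" unfolding k_def
    using assms div_times_less_eq_dividend[of h d] by (simp add: pos_le_divide_eq flip: of_nat_mult)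
  finally show ?thesis by simp
qed

text \<open>A power of the gcd is at most the sum of the same powers of all divisors d of
  \<open>\<Prod>U\<close> that divide \<open>x\<close>. Each d has at most \<open>2 * h / d\<close>
  nonzero multiples in range, which lowers the exponent by one, and there are
  \<open>2 ^ card U\<close> such divisors.\<close>

lemma sum_gcd_set_power_le:
  assumes U: "finite U" "\<And>p. p \<in> U \<Longrightarrow> prime p"
  shows "(\<Sum>x\<in>{-int h..int h} - {0}. gcd_set U x ^ Suc m) \<le> 2 * real h * 2 ^ card U * real (\<Prod>U) ^ m"
proof -
  have "(\<Sum>x\<in>{-int h..int h} - {0}. gcd_set U x ^ Suc m)
      \<le> (\<Sum>x\<in>{-int h..int h} - {0}. \<Sum>T\<in>Pow U. if int (\<Prod>T) dvd x then real (\<Prod>T) ^ Suc m else 0)"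
  proof (intro sum_mono)
    fix x
    have "gcd_set U x ^ Suc m = (\<Prod>p\<in>U. (if int p dvd x then real p else 1) ^ Suc m)"
      unfolding gcd_set_def by (rule prod_power_distrib)
    also have "\<dots> \<le> (\<Prod>p\<in>U. 1 + (if int p dvd x then real p ^ Suc m else 0))"
      by (intro prod_mono) auto
    also have "\<dots> = (\<Sum>T\<in>Pow U. \<Prod>p\<in>T. if int p dvd x then real p ^ Suc m else 0)"
      by (rule sum_Pow_prod[symmetric]) (use U in auto)
    also have "\<dots> = (\<Sum>T\<in>Pow U. if int (\<Prod>T) dvd x then real (\<Prod>T) ^ Suc m else 0)"
    proof (intro sum.cong refl)
      fix T assume "T \<in> Pow U"
      hence T: "finite T" "\<And>p. p \<in> T \<Longrightarrow> prime p" using U by (auto intro: finite_subset)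
      have iff: "int (\<Prod>T) dvd x \<longleftrightarrow> (\<forall>p\<in>T. int p dvd x)"
        using T by (intro prod_primes_dvd_iff) auto
      show "(\<Prod>p\<in>T. if int p dvd x then real p ^ Suc m else 0) = (if int (\<Prod>T) dvd x then real (\<Prod>T) ^ Suc m else 0)"
      proof (cases "\<forall>p\<in>T. int p dvd x")
        case True
        hence "(\<Prod>p\<in>T. if int p dvd x then real p ^ Suc m else 0) = (\<Prod>p\<in>T. real p ^ Suc m)"
          by (intro prod.cong) auto
        also have "\<dots> = real (\<Prod>T) ^ Suc m" by (simp only: prod_power_distrib of_nat_prod)
        finally show ?thesis using iff True by simp
      next
        case False
        hence "(\<Prod>p\<in>T. if int p dvd x then real p ^ Suc m else 0) = 0" using T by (intro prod_zero) auto
        thus ?thesis using iff False by simp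
      qed
    qed
    finally show "gcd_set U x ^ Suc m \<le> \<dots>" .
  qed
  also have "\<dots> = (\<Sum>T\<in>Pow U. \<Sum>x\<in>{-int h..int h} - {0}. if int (\<Prod>T) dvd x then real (\<Prod>T) ^ Suc m else 0)"
    by (rule sum.swap)
  also have "\<dots> \<le> (\<Sum>T\<in>Pow U. 2 * real h * real (\<Prod>U) ^ m)"
  proof (intro sum_mono)
    fix T assume "T \<in> Pow U"
    hence T: "finite T" "\<And>p. p \<in> T \<Longrightarrow> prime p" "T \<subseteq> U" using U by (auto intro: finite_subset)
    have pos: "\<Prod>T > 0" "\<Prod>U > 0" using prod_primes_pos[OF T(2)] prod_primes_pos[OF U(2)] by blast+
    have "\<Prod>T dvd \<Prod>U" using T U by (intro prod_dvd_prod_subset) auto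
    hence le: "\<Prod>T \<le> \<Prod>U" using pos by (intro dvd_imp_le)
    have "(\<Sum>x\<in>{-int h..int h} - {0}. if int (\<Prod>T) dvd x then real (\<Prod>T) ^ Suc m else 0)
        = (\<Sum>x | x \<in> {-int h..int h} - {0} \<and> int (\<Prod>T) dvd x. real (\<Prod>T) ^ Suc m)"
      by (intro sum.mono_neutral_cong_right) auto
    also have "\<dots> = real (card {x \<in> {-int h..int h} - {0}. int (\<Prod>T) dvd x}) * real (\<Prod>T) ^ Suc m"
      by (rule sum_constant)
    also have "\<dots> \<le> (2 * real h / real (\<Prod>T)) * real (\<Prod>T) ^ Suc m"
      using card_multiples_le[OF pos(1), of h] by (intro mult_right_mono zero_le_power of_nat_0_le_iff)
    also have "\<dots> = 2 * real h * real (\<Prod>T) ^ m"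
    proof -
      have "real (\<Prod>T) \<noteq> 0" using pos(1) by (metis of_nat_eq_0_iff less_irrefl)
      thus ?thesis by (metis (no_types, lifting) power_Suc times_divide_eq_left nonzero_mult_div_cancel_left mult.left_commute)
    qed
    also have "\<dots> \<le> 2 * real h * real (\<Prod>U) ^ m"
      using le by (intro mult_left_mono power_mono mult_nonneg_nonneg zero_le_numeral of_nat_0_le_iff)
         (simp only: of_nat_le_iff)
    finally show "(\<Sum>x\<in>{-int h..int h} - {0}. if int (\<Prod>T) dvd x then real (\<Prod>T) ^ Suc m else 0) \<le> 2 * real h * real (\<Prod>U) ^ m" .
  qed
  also have "\<dots> = 2 * real h * 2 ^ card U * real (\<Prod>U) ^ m"
    using U by (simp add: card_Pow)
  finally show ?thesis .
qed

lemma sum_offdiag_le: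
  fixes f :: "int \<Rightarrow> real"
  assumes "\<And>x. f x \<ge> 0" "i \<in> {1..int h}"
  shows "(\<Sum>j\<in>{1..int h} - {i}. f (i - j)) \<le> (\<Sum>x\<in>{-int h..int h} - {0}. f x)"
    and "(\<Sum>j\<in>{1..int h} - {i}. f (j - i)) \<le> (\<Sum>x\<in>{-int h..int h} - {0}. f x)"
proof -
  have "(\<Sum>j\<in>{1..int h} - {i}. f (i - j)) = (\<Sum>x\<in>(\<lambda>j. i - j) ` ({1..int h} - {i}). f x)"
    by (subst sum.reindex) (auto simp: inj_on_def)
  also have "\<dots> \<le> (\<Sum>x\<in>{-int h..int h} - {0}. f x)"
    using assms by (intro sum_mono2) auto
  finally show "(\<Sum>j\<in>{1..int h} - {i}. f (i - j)) \<le> (\<Sum>x\<in>{-int h..int h} - {0}. f x)" .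
  have "(\<Sum>j\<in>{1..int h} - {i}. f (j - i)) = (\<Sum>x\<in>(\<lambda>j. j - i) ` ({1..int h} - {i}). f x)"
    by (subst sum.reindex) (auto simp: inj_on_def)
  also have "\<dots> \<le> (\<Sum>x\<in>{-int h..int h} - {0}. f x)"
    using assms by (intro sum_mono2) auto
  finally show "(\<Sum>j\<in>{1..int h} - {i}. f (j - i)) \<le> (\<Sum>x\<in>{-int h..int h} - {0}. f x)" .
qed

section \<open>The local factors\<close>

lemma sp_periodic: "sp p (x + int p) = sp p x"
  by (simp add: sp_def)

lemma sum_dvd_period:
  fixes A B :: real
  assumes "p > 0"
  shows "(\<Sum>x\<in>{0..<int p}. if int p dvd x - c then A else B) = A + (real p - 1) * B"
proof -
  have "(\<Sum>x\<in>{0..<int p}. if int p dvd x - c then A else B)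
      = (\<Sum>x\<in>{0..<int p}. if x = c mod int p then A else B)"
  proof (intro sum.cong refl if_cong)
    fix x assume "x \<in> {0..<int p}"
    hence "x mod int p = x" by simp
    thus "int p dvd x - c \<longleftrightarrow> x = c mod int p" by (metis mod_eq_dvd_iff)
  qed
  also have "\<dots> = (\<Sum>x\<in>{0..<int p}. B + (if x = c mod int p then A - B else 0))"
    by (intro sum.cong) auto
  also have "\<dots> = real p * B + (A - B)"
    using assms by (simp add: sum.distrib)
  finally show ?thesis by (simp add: algebra_simps)
qed

lemma sum_sp_period: "p > 0 \<Longrightarrow> (\<Sum>x\<in>{0..<int p}. sp p (x - c)) = 0"
  unfolding sp_def by (subst sum_dvd_period) auto

lemma prime_minus_1_cases:
  assumes "prime p"
  obtains "p = 2" | q :: real where "q = real p - 1" "q \<ge> 2" "p \<ge> 3"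
  using assms prime_ge_2_nat[OF assms] by (cases "p = 2") auto

lemma abs_eta_le_1:
  assumes "prime p"
  shows "\<bar>eta p a\<bar> \<le> 1"
  using assms
proof (cases rule: prime_minus_1_cases)
  case (2 q)
  have "\<bar>sp p a\<bar> \<le> q" using 2 by (auto simp: sp_def)
  also have "q \<le> q\<^sup>2" using 2 by (simp add: power2_eq_square)
  finally have "\<bar>sp p a\<bar> / q\<^sup>2 \<le> 1" using 2 by (simp add: divide_le_eq_1)
  thus ?thesis using 2 by (simp add: eta_def)
qed (auto simp: eta_def sp_def)

lemma abs_eta_le:
  assumes "prime p"
  shows "\<bar>eta p a\<bar> \<le> (if int p dvd a then real p else 1) / (real p - 1)\<^sup>2"
proof -
  have "\<bar>sp p a\<bar> \<le> (if int p dvd a then real p else 1)"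
    using prime_gt_1_nat[OF assms] by (auto simp: sp_def)
  thus ?thesis by (simp add: eta_def divide_right_mono)
qed

lemma gam_values:
  assumes "prime p"
  defines "q \<equiv> real p - 1"
  shows "gam p a b * q\<^sup>2 =
     (if int p dvd a then if int p dvd b then 1 else - 1 / q
      else if int p dvd b then - 1 / q
      else if int p dvd a - b then q + 1 - 1 / q else - (q + 2) / q)"
proof -
  have q: "q > 0" "real p = q + 1" using prime_gt_1_nat[OF assms(1)] by (auto simp: q_def)
  have ba: "int p dvd a" if "int p dvd a - b" "int p dvd b"
    using dvd_add[OF that] by simp
  have "gam p a b * q\<^sup>2 = (1 - (if int p dvd a then 0 else (q + 1) / q)
                  - (if int p dvd b then 0 else (q + 1) / q)
                  + (if int p dvd a - b \<and> \<not> int p dvd a then (q + 1)\<^sup>2 / q else 0))"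
    using q unfolding gam_def q_def[symmetric] by simp
  also have "\<dots> = (if int p dvd a then if int p dvd b then 1 else - 1 / q
      else if int p dvd b then - 1 / q
      else if int p dvd a - b then q + 1 - 1 / q else - (q + 2) / q)"
    using q ba by (auto simp: field_simps power2_eq_square)
  finally show ?thesis .
qed

text \<open>The bound by 1 feeds the periodicity argument; the second shows the size
  \<open>1 / p^2\<close> away from \<open>p dvd a - b\<close> and feeds the gcd sums.\<close>

lemma abs_gam_le:
  assumes "prime p"
  shows "\<bar>gam p a b\<bar> \<le> 1" "\<bar>gam p a b\<bar> \<le> 3 * (if int p dvd a - b then real p else 1) / (real p - 1)\<^sup>2"
proof -
  define q where "q = real p - 1"
  have q: "q \<ge> 1" "real p = q + 1" using prime_ge_2_nat[OF assms] by (auto simp: q_def)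
  define v where "v = (if int p dvd a then if int p dvd b then 1 else - 1 / q
      else if int p dvd b then - 1 / q
      else if int p dvd a - b then q + 1 - 1 / q else - (q + 2) / q)"
  have v: "gam p a b = v / q\<^sup>2"
    using gam_values[OF assms, of a b] q unfolding v_def q_def[symmetric] by (simp add: field_simps)
  have 1: "1 / q \<le> 1" "1 / q > 0" using q by auto
  have "1 / q \<le> q" using 1 q by linarith
  have "\<bar>v\<bar> \<le> q\<^sup>2"
    using assms
  proof (cases rule: prime_minus_1_cases)
    case 1
    hence "q = 1" by (simp add: q_def)
    \<comment> \<open>For \<open>p = 2\<close> we have \<open>q = 1\<close>, and the last value of
      \<open>v\<close> would be -3. That case does not occur, because two odd numbers have an even
      difference.\<close>
    moreover have "even (a - b)" if "odd a" "odd b" using that by simp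
    ultimately show ?thesis using 1 by (auto simp: v_def)
  next
    case (2 q')
    hence q2: "q \<ge> 2" by (simp add: q_def)
    have "q * q \<ge> 2 * q" using q2 by (intro mult_right_mono) auto
    hence sq: "q\<^sup>2 \<ge> 2 * q" by (simp add: power2_eq_square)
    have "(q + 2) / q \<le> 2" using q2 by (simp add: field_simps)
    moreover have "(q + 2) / q > 0" using q2 by simp
    moreover have "- (q + 2) / q = - ((q + 2) / q)" by (rule minus_divide_left[symmetric])
    ultimately have "\<bar>- (q + 2) / q\<bar> \<le> q\<^sup>2" using sq q2 by linarith
    moreover have "\<bar>q + 1 - 1 / q\<bar> \<le> q\<^sup>2" using 1 sq q2 by linarith
    moreover have "\<bar>- 1 / q\<bar> \<le> q\<^sup>2"
    proof -
      have "\<bar>- 1 / q\<bar> = 1 / q" using q2 by simp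
      thus ?thesis using 1 sq q2 by linarith
    qed
    moreover have "\<bar>1\<bar> \<le> q\<^sup>2" using sq q2 by simp
    ultimately show ?thesis unfolding v_def by presburger
  qed
  thus "\<bar>gam p a b\<bar> \<le> 1" using q by (simp add: v)
  have "\<bar>v\<bar> \<le> 3 * (if int p dvd a - b then real p else 1)"
  proof -
    have "(q + 2) / q \<le> 3" using q by (simp add: field_simps)
    moreover have "(q + 2) / q > 0" using q by simp
    moreover have "- (q + 2) / q = - ((q + 2) / q)" by (rule minus_divide_left[symmetric])
    ultimately have a1: "\<bar>- (q + 2) / q\<bar> \<le> 3" by linarith
    have a2: "\<bar>q + 1 - 1 / q\<bar> \<le> 3 * real p" using 1 q by linarith
    have "\<bar>- 1 / q\<bar> = 1 / q" using q by simp
    hence a3: "\<bar>- 1 / q\<bar> \<le> 3" using 1 by linarith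
    have a4: "3 * (if int p dvd a - b then real p else 1) \<ge> 3" using q by simp
    have a5: "\<not> int p dvd a - b \<Longrightarrow> 3 * (if int p dvd a - b then real p else 1) = 3" by simp
    show ?thesis
    proof (cases "\<not> int p dvd a \<and> \<not> int p dvd b \<and> int p dvd a - b")
      case True
      thus ?thesis using a2 by (simp add: v_def)
    next
      case False
      hence "\<bar>v\<bar> \<le> 3" using a1 a3 by (auto simp: v_def)
      thus ?thesis using a4 by linarith
    qed
  qed
  thus "\<bar>gam p a b\<bar> \<le> 3 * (if int p dvd a - b then real p else 1) / (real p - 1)\<^sup>2"
    unfolding v q_def[symmetric] by (simp add: divide_right_mono)
qed

lemma gam_periodic: "gam p (a + int p) b = gam p a b"
proof -
  have "a + int p - b = (a - b) + int p" by simp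
  hence "int p dvd a + int p - b \<longleftrightarrow> int p dvd a - b" by (metis dvd_add_triv_right_iff)
  thus ?thesis by (simp add: gam_def)
qed

lemma eta_periodic: "eta p (a + int p) = eta p a"
  by (simp add: eta_def sp_periodic)

lemma sum_eta_period: "p > 0 \<Longrightarrow> (\<Sum>x\<in>{0..<int p}. eta p (x - c)) = 0"
  using sum_sp_period[of p c] by (simp add: eta_def sum_negf flip: sum_divide_distrib)

text \<open>\<open>gam p a b\<close> is an average over \<open>u\<close> of multiples of
  \<open>sp p (u + a) * sp p (u + b)\<close>; for each \<open>u\<close> the first factor already
  sums to 0 over a period of \<open>a\<close>, whatever \<open>b\<close> is.\<close>

lemma sum_gam_period:
  assumes "prime p"
  shows "(\<Sum>x\<in>{0..<int p}. gam p (x - c) b) = 0"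
proof -
  define q where "q = real p - 1"
  have q: "q > 0" "real p = q + 1" using prime_gt_1_nat[OF assms] by (auto simp: q_def)
  have p0: "p > 0" using assms prime_gt_0_nat by blast
  have dv: "int p dvd x - c \<longleftrightarrow> int p dvd b" if "int p dvd x - c - b" for x
    using that dvd_add[of "int p" "x - c - b" b] dvd_diff[of "int p" "x - c" "x - c - b"] by auto
  have eq: "gam p (x - c) b * q\<^sup>2 = (if int p dvd x - c then 0 else - (q + 1) / q)
      + (if int p dvd x - (c + b) then if int p dvd b then 0 else (q + 1)\<^sup>2 / q else 0)
      + (1 - (if int p dvd b then 0 else (q + 1) / q))" for x
    using q dv[of x] unfolding gam_def q_def[symmetric] by (auto simp: diff_diff_eq divide_simps)
  have "(\<Sum>x\<in>{0..<int p}. gam p (x - c) b * q\<^sup>2) = 0"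
    unfolding eq sum.distrib sum_dvd_period[OF p0] using q by (auto simp: field_simps power2_eq_square)
  thus ?thesis using q by (simp flip: sum_distrib_right)
qed

section \<open>Interpolated bounds for sums over pairs and triples of distinct shifts\<close>

lemma interpolate_powr:
  fixes x A B s :: real
  assumes "0 \<le> x" "x \<le> A" "x \<le> B" "0 < s" "s < 1"
  shows "x \<le> A powr s * B powr (1 - s)"
proof -
  have "x = x powr (s + (1 - s))" using assms by simp
  also have "\<dots> = x powr s * x powr (1 - s)" by (rule powr_add)
  also have "\<dots> \<le> A powr s * B powr (1 - s)"
    using assms by (intro mult_mono powr_mono2) auto
  finally show ?thesis .
qed

lemma prod_inverse_sq_le:
  assumes "finite U" "\<And>p. p \<in> U \<Longrightarrow> prime p"
  shows "(\<Prod>p\<in>U. 1 / (real p - 1)\<^sup>2) \<le> 4 ^ card U / real (\<Prod>U) ^ 2"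
proof -
  have "(\<Prod>p\<in>U. 1 / (real p - 1)\<^sup>2) = prime_wt U ^ 2"
    by (simp add: prime_wt_def prod_power_distrib power_one_over)
  also have "\<dots> \<le> (2 ^ card U / real (\<Prod>U)) ^ 2"
    using prime_wt_le[of U] prime_wt_pos[of U] assms(2) by (intro power_mono) (auto intro: less_imp_le)
  also have "\<dots> = 4 ^ card U / real (\<Prod>U) ^ 2"
    by (simp add: power_divide power2_eq_square flip: power_mult_distrib)
  finally show ?thesis .
qed

lemma real_prod_primes_ge_1:
  fixes U :: "nat set"
  assumes "\<And>p. p \<in> U \<Longrightarrow> prime p"
  shows "real (\<Prod>U) \<ge> 1"
proof -
  have "1 \<le> \<Prod>U" using prod_primes_pos[of U] assms by (simp add: Suc_leI)
  from of_nat_mono[OF this, where ?'a = real] show ?thesis by simp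
qed

text \<open>Bound \<open>A\<close> is periodicity, bound \<open>B\<close> the gcd sum, where
  \<open>8 = 4 * 2\<close> per prime (from \<open>prod_inverse_sq_le\<close> and the gcd sum) is
  absorbed by the exponent 1/6. With weights 1/4 and 3/4 the exponents are 1/4 + 3/2 = 7/4 for
  \<open>h\<close>, below 2, and 1/4 - 11/8 = -9/8 for the product, below -1.\<close>

lemma pair_sum_bound:
  "\<exists>K>0. \<forall>U h. finite U \<longrightarrow> (\<forall>p\<in>U. prime p) \<longrightarrow> U \<noteq> {} \<longrightarrow>
     \<bar>\<Sum>i\<in>{1..int h}. \<Sum>j\<in>{1..int h} - {i}. \<Prod>p\<in>U. eta p (j - i)\<bar>
        \<le> K * real h powr (7/4) * real (\<Prod>U) powr (- 9/8)"
proof -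
  obtain K where K: "K > 0" "\<And>S :: nat set. finite S \<Longrightarrow> (\<forall>p\<in>S. prime p) \<Longrightarrow> 8 ^ card S \<le> K * real (\<Prod>S) powr (1/6)"
    using power_card_le_powr[of 8 "1/6"] by auto
  have "\<bar>\<Sum>i\<in>{1..int h}. \<Sum>j\<in>{1..int h} - {i}. \<Prod>p\<in>U. eta p (j - i)\<bar>
        \<le> (2 powr (1/4) * (2 * K) powr (3/4)) * real h powr (7/4) * real (\<Prod>U) powr (- 9/8)"
    if U: "finite U" "\<forall>p\<in>U. prime p" "U \<noteq> {}" for U h
  proof -
    define Q where "Q = real (\<Prod>U)"
    have Q: "Q \<ge> 1" unfolding Q_def using U by (intro real_prod_primes_ge_1) auto
    define x where "x = \<bar>\<Sum>i\<in>{1..int h}. \<Sum>j\<in>{1..int h} - {i}. \<Prod>p\<in>U. eta p (j - i)\<bar>"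
    have le1: "\<bar>\<Prod>p\<in>U. eta p y\<bar> \<le> 1" for y
      unfolding abs_prod using U abs_eta_le_1 by (intro prod_le_1) auto
    obtain r where r: "r \<in> U" using U by blast
    have A: "x \<le> 2 * real h * Q"
    proof -
      have "x \<le> (\<Sum>i\<in>{1..int h}. \<bar>\<Sum>j\<in>{1..int h} - {i}. \<Prod>p\<in>U. eta p (j - i)\<bar>)"
        unfolding x_def by (rule sum_abs)
      also have "\<dots> \<le> (\<Sum>i\<in>{1..int h}. 2 * Q)"
      proof (intro sum_mono)
        fix i assume i: "i \<in> {1..int h}"
        have "\<bar>\<Sum>j\<in>{1..int h}. \<Prod>p\<in>U. eta p (j - i)\<bar> \<le> Q"
          unfolding Q_def
        proof (rule sum_prod_periodic_bound[where q = r])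
          show "eta p (j + int p - i) = eta p (j - i)" for p j
            using eta_periodic[of p "j - i"] by (simp add: algebra_simps)
          show "(\<Sum>x\<in>{0..<int r}. eta r (x - i)) = 0"
            using U r by (intro sum_eta_period) (auto simp: prime_gt_0_nat)
        qed (use U r abs_eta_le_1 in auto)
        \<comment> \<open>Cancellation needs the full range of \<open>j\<close>; restoring
          \<open>j = i\<close> costs one product of size at most 1, absorbed because
          \<open>Q \<ge> 1\<close>.\<close>
        moreover have "(\<Sum>j\<in>{1..int h}. \<Prod>p\<in>U. eta p (j - i)) =
            (\<Prod>p\<in>U. eta p 0) + (\<Sum>j\<in>{1..int h} - {i}. \<Prod>p\<in>U. eta p (j - i))"
          using i by (subst sum.remove[of _ i]) auto
        ultimately show "\<bar>\<Sum>j\<in>{1..int h} - {i}. \<Prod>p\<in>U. eta p (j - i)\<bar> \<le> 2 * Q"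
          using le1[of 0] Q by linarith
      qed
      finally show ?thesis by simp
    qed
    have B: "x \<le> 2 * K * (real h) ^ 2 * Q powr (- 11/6)"
    proof -
      have "x \<le> (\<Sum>i\<in>{1..int h}. \<bar>\<Sum>j\<in>{1..int h} - {i}. \<Prod>p\<in>U. eta p (j - i)\<bar>)"
        unfolding x_def by (rule sum_abs)
      also have "\<dots> \<le> (\<Sum>i\<in>{1..int h}. \<Sum>j\<in>{1..int h} - {i}. \<bar>\<Prod>p\<in>U. eta p (j - i)\<bar>)"
        by (intro sum_mono sum_abs)
      also have "\<dots> \<le> (\<Sum>i\<in>{1..int h}. \<Sum>j\<in>{1..int h} - {i}. (\<Prod>p\<in>U. 1 / (real p - 1)\<^sup>2) * gcd_set U (j - i))"
      proof (intro sum_mono)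
        fix i j
        have "\<bar>\<Prod>p\<in>U. eta p (j - i)\<bar> \<le> (\<Prod>p\<in>U. (if int p dvd j - i then real p else 1) / (real p - 1)\<^sup>2)"
          unfolding abs_prod using U abs_eta_le by (intro prod_mono) auto
        also have "\<dots> = (\<Prod>p\<in>U. 1 / (real p - 1)\<^sup>2) * gcd_set U (j - i)"
          by (simp add: gcd_set_def prod_dividef)
        finally show "\<bar>\<Prod>p\<in>U. eta p (j - i)\<bar> \<le> \<dots>" .
      qed
      also have "\<dots> = (\<Prod>p\<in>U. 1 / (real p - 1)\<^sup>2) * (\<Sum>i\<in>{1..int h}. \<Sum>j\<in>{1..int h} - {i}. gcd_set U (j - i))"
        by (simp add: sum_distrib_left)
      also have "\<dots> \<le> (4 ^ card U / Q ^ 2) * (\<Sum>i\<in>{1..int h}. 2 * real h * 2 ^ card U)"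
      proof (intro mult_mono sum_mono sum_nonneg)
        show "(\<Prod>p\<in>U. 1 / (real p - 1)\<^sup>2) \<le> 4 ^ card U / Q ^ 2"
          unfolding Q_def using U by (intro prod_inverse_sq_le) auto
        fix i assume "i \<in> {1..int h}"
        hence "(\<Sum>j\<in>{1..int h} - {i}. gcd_set U (j - i)) \<le> (\<Sum>x\<in>{-int h..int h} - {0}. gcd_set U x)"
          by (intro sum_offdiag_le) auto
        also have "\<dots> \<le> 2 * real h * 2 ^ card U"
        proof -
          have "(\<Sum>x\<in>{-int h..int h} - {0}. gcd_set U x ^ Suc 0) \<le> 2 * real h * 2 ^ card U * real (\<Prod>U) ^ 0"
            using U by (intro sum_gcd_set_power_le) auto
          thus ?thesis by simp
        qed
        finally show "(\<Sum>j\<in>{1..int h} - {i}. gcd_set U (j - i)) \<le> 2 * real h * 2 ^ card U" .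
      qed auto
      also have "\<dots> = 2 * (real h) ^ 2 * (8 ^ card U / Q ^ 2)"
        by (simp add: power2_eq_square) (simp add: mult.assoc flip: power_mult_distrib)
      also have "\<dots> \<le> 2 * (real h) ^ 2 * (K * Q powr (1/6) / Q ^ 2)"
        using K(2)[OF U(1,2)] unfolding Q_def by (intro mult_left_mono divide_right_mono) auto
      also have "K * Q powr (1/6) / Q ^ 2 = K * Q powr (- 11/6)"
        using Q powr_diff[of Q "1/6" 2] by simp
      finally show ?thesis by (simp add: mult_ac)
    qed
    have "x \<le> (2 * real h * Q) powr (1/4) * (2 * K * (real h) ^ 2 * Q powr (- 11/6)) powr (1 - 1/4)"
      using A B by (intro interpolate_powr) (auto simp: x_def)
    also have "\<dots> = (2 powr (1/4) * (2 * K) powr (3/4)) * ((real h powr (1/4)) * (real h ^ 2) powr (3/4)) * (Q powr (1/4) * (Q powr (- 11/6)) powr (3/4))"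
      using K Q by (simp add: powr_mult mult_ac)
    also have "real h powr (1/4) * (real h ^ 2) powr (3/4) = real h powr (7/4)"
    proof (cases "h = 0")
      case False
      hence "(real h ^ 2) powr (3/4) = real h powr (3/2)"
        using powr_powr[of "real h" 2 "3/4"] by simp
      thus ?thesis by (simp flip: powr_add)
    qed simp
    also have "Q powr (1/4) * (Q powr (- 11/6)) powr (3/4) = Q powr (- 9/8)"
      by (simp add: powr_powr flip: powr_add)
    finally show ?thesis unfolding x_def Q_def .
  qed
  moreover have "2 powr (1/4) * (2 * K) powr (3/4) > 0" using K by simp
  ultimately show ?thesis by blast
qed

lemma sum_pairs_split:
  fixes f :: "int \<Rightarrow> int \<Rightarrow> real"
  assumes "finite I" "j \<in> I"
  shows "(\<Sum>i\<in>I. \<Sum>k\<in>I. f i k) = f j j + (\<Sum>k\<in>I - {j}. f j k) + (\<Sum>i\<in>I - {j}. f i j)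
     + (\<Sum>i\<in>I - {j}. f i i) + (\<Sum>i\<in>I - {j}. \<Sum>k\<in>I - {j, i}. f i k)"
proof -
  have "(\<Sum>i\<in>I. \<Sum>k\<in>I. f i k) = (\<Sum>k\<in>I. f j k) + (\<Sum>i\<in>I - {j}. \<Sum>k\<in>I. f i k)"
    using assms by (rule sum.remove)
  also have "(\<Sum>k\<in>I. f j k) = f j j + (\<Sum>k\<in>I - {j}. f j k)"
    using assms by (rule sum.remove)
  also have "(\<Sum>i\<in>I - {j}. \<Sum>k\<in>I. f i k) = (\<Sum>i\<in>I - {j}. f i j + f i i + (\<Sum>k\<in>I - {j, i}. f i k))"
  proof (intro sum.cong refl)
    fix i assume i: "i \<in> I - {j}"
    have "(\<Sum>k\<in>I. f i k) = f i j + (\<Sum>k\<in>I - {j}. f i k)"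
      using assms by (rule sum.remove)
    also have "(\<Sum>k\<in>I - {j}. f i k) = f i i + (\<Sum>k\<in>I - {j} - {i}. f i k)"
      using i assms by (intro sum.remove) auto
    also have "I - {j} - {i} = I - {j, i}" by auto
    finally show "(\<Sum>k\<in>I. f i k) = f i j + f i i + (\<Sum>k\<in>I - {j, i}. f i k)" by simp
  qed
  finally show ?thesis by (simp add: sum.distrib)
qed

lemma abs_loc_le_1: "prime p \<Longrightarrow> \<bar>loc S T a b p\<bar> \<le> 1"
  by (simp add: loc_def abs_gam_le abs_eta_le_1)

lemma abs_prod_loc_le_1:
  assumes "\<And>p. p \<in> S \<union> T \<Longrightarrow> prime p"
  shows "\<bar>\<Prod>p\<in>S \<union> T. loc S T a b p\<bar> \<le> 1"
  unfolding abs_prod using assms abs_loc_le_1 by (intro prod_le_1) auto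

text \<open>One of the two summations already cancels. A prime in \<open>S\<close> has mean zero in
  the first shift, whether or not it also lies in \<open>T\<close>; if \<open>S\<close> is empty,
  the product depends on the second shift alone and is periodic in it.\<close>

lemma sum_prod_loc_bound:
  assumes fin: "finite S" "finite T" and pr: "\<And>p. p \<in> S \<union> T \<Longrightarrow> prime p" and ne: "S \<union> T \<noteq> {}"
  shows "\<bar>\<Sum>i\<in>{1..int h}. \<Sum>k\<in>{1..int h}. \<Prod>p\<in>S \<union> T. loc S T (i - j) (k - j) p\<bar>
           \<le> real h * real (\<Prod>(S \<union> T))"
proof (cases "S = {}")
  case False
  then obtain r where r: "r \<in> S" by auto
  have r': "prime r" "r > 0" using pr r prime_gt_0_nat by auto
  have "(\<Sum>i\<in>{1..int h}. \<Sum>k\<in>{1..int h}. \<Prod>p\<in>S \<union> T. loc S T (i - j) (k - j) p)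
      = (\<Sum>k\<in>{1..int h}. \<Sum>i\<in>{1..int h}. \<Prod>p\<in>S \<union> T. loc S T (i - j) (k - j) p)" by (rule sum.swap)
  also have "\<bar>\<dots>\<bar> \<le> (\<Sum>k\<in>{1..int h}. \<bar>\<Sum>i\<in>{1..int h}. \<Prod>p\<in>S \<union> T. loc S T (i - j) (k - j) p\<bar>)"
    by (rule sum_abs)
  also have "\<dots> \<le> (\<Sum>k\<in>{1..int h}. real (\<Prod>(S \<union> T)))"
  proof (intro sum_mono sum_prod_periodic_bound[where q = r])
    fix k p and i :: int
    have "i + int p - j = (i - j) + int p" by simp
    thus "loc S T (i + int p - j) (k - j) p = loc S T (i - j) (k - j) p"
      unfolding loc_def by (simp only: gam_periodic eta_periodic)
  next
    fix k
    show "(\<Sum>x\<in>{0..<int r}. loc S T (x - j) (k - j) r) = 0"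
      using r r' sum_gam_period sum_eta_period by (cases "r \<in> T") (simp_all add: loc_def)
  qed (use r fin pr abs_loc_le_1 in auto)
  finally show ?thesis by simp
next
  case True
  then obtain r where r: "r \<in> T" using ne by auto
  have r': "prime r" "r > 0" using pr r prime_gt_0_nat by auto
  have "\<bar>\<Sum>i\<in>{1..int h}. \<Sum>k\<in>{1..int h}. \<Prod>p\<in>S \<union> T. loc S T (i - j) (k - j) p\<bar>
     \<le> (\<Sum>i\<in>{1..int h}. \<bar>\<Sum>k\<in>{1..int h}. \<Prod>p\<in>S \<union> T. loc S T (i - j) (k - j) p\<bar>)"
    by (rule sum_abs)
  also have "\<dots> \<le> (\<Sum>i\<in>{1..int h}. real (\<Prod>(S \<union> T)))"
  proof (intro sum_mono sum_prod_periodic_bound[where q = r])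
    fix i p and k :: int
    have "k + int p - j = (k - j) + int p" by simp
    thus "loc S T (i - j) (k + int p - j) p = loc S T (i - j) (k - j) p"
      unfolding loc_def True by (simp only: empty_iff if_False eta_periodic)
  next
    fix i
    show "(\<Sum>x\<in>{0..<int r}. loc S T (i - j) (x - j) r) = 0"
      unfolding loc_def using r r' True sum_eta_period by simp
  qed (use r fin pr abs_loc_le_1 in auto)
  finally show ?thesis by simp
qed

text \<open>\<open>12 = 3 * 4\<close> per prime, from \<open>abs_gam_le\<close> and
  \<open>prod_inverse_sq_le\<close>. Each prime is attached to the one difference of shifts that
  governs its local factor.\<close>

lemma abs_prod_loc_le:
  assumes fin: "finite S" "finite T" and pr: "\<And>p. p \<in> S \<union> T \<Longrightarrow> prime p"
  shows "\<bar>\<Prod>p\<in>S \<union> T. loc S T a b p\<bar>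
     \<le> 12 ^ card (S \<union> T) / real (\<Prod>(S \<union> T)) ^ 2 * (gcd_set (S \<inter> T) (a - b) * gcd_set (S - T) a * gcd_set (T - S) b)"
proof -
  define U where "U = S \<union> T"
  define c where "c p = (if p \<in> S then if p \<in> T then a - b else a else b)" for p
  define g where "g p = (if int p dvd c p then real p else 1)" for p
  have U: "finite U" "\<And>p. p \<in> U \<Longrightarrow> prime p" using fin pr by (auto simp: U_def)
  have "\<bar>\<Prod>p\<in>U. loc S T a b p\<bar> \<le> (\<Prod>p\<in>U. 3 * (1 / (real p - 1)\<^sup>2) * g p)"
    unfolding abs_prod
  proof (intro prod_mono conjI abs_ge_zero)
    fix p assume "p \<in> U"
    hence p: "prime p" using U by auto
    have e: "\<bar>eta p a\<bar> \<le> 3 * ((if int p dvd a then real p else 1) / (real p - 1)\<^sup>2)" for a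
    proof -
      have "0 \<le> (if int p dvd a then real p else 1) / (real p - 1)\<^sup>2" by simp
      thus ?thesis using abs_eta_le[OF p, of a] by linarith
    qed
    show "\<bar>loc S T a b p\<bar> \<le> 3 * (1 / (real p - 1)\<^sup>2) * g p"
      using e[of a] e[of b] abs_gam_le(2)[OF p, of a b] by (auto simp: loc_def g_def c_def)
  qed
  also have "\<dots> = 3 ^ card U * (\<Prod>p\<in>U. 1 / (real p - 1)\<^sup>2) * (\<Prod>p\<in>U. g p)"
    by (simp only: prod.distrib prod_constant)
  also have "\<dots> \<le> 3 ^ card U * (4 ^ card U / real (\<Prod>U) ^ 2) * (\<Prod>p\<in>U. g p)"
    using U by (intro mult_right_mono mult_left_mono prod_inverse_sq_le prod_nonneg) (auto simp: g_def)
  also have "(\<Prod>p\<in>U. g p) = gcd_set (S \<inter> T) (a - b) * gcd_set (S - T) a * gcd_set (T - S) b"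
  proof -
    have "U = ((S \<inter> T) \<union> (S - T)) \<union> (T - S)" by (auto simp: U_def)
    hence "(\<Prod>p\<in>U. g p) = (\<Prod>p\<in>S \<inter> T. g p) * (\<Prod>p\<in>S - T. g p) * (\<Prod>p\<in>T - S. g p)"
      using fin by (simp only:) (subst prod.union_disjoint; (subst prod.union_disjoint)?; auto)
    also have "(\<Prod>p\<in>S \<inter> T. g p) = gcd_set (S \<inter> T) (a - b)"
      unfolding gcd_set_def by (intro prod.cong) (auto simp: g_def c_def)
    also have "(\<Prod>p\<in>S - T. g p) = gcd_set (S - T) a"
      unfolding gcd_set_def by (intro prod.cong) (auto simp: g_def c_def)
    also have "(\<Prod>p\<in>T - S. g p) = gcd_set (T - S) b"
      unfolding gcd_set_def by (intro prod.cong) (auto simp: g_def c_def)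
    finally show ?thesis .
  qed
  also have "(3 :: real) ^ card U * (4 ^ card U / real (\<Prod>U) ^ 2) = 12 ^ card U / real (\<Prod>U) ^ 2"
    by (simp flip: power_mult_distrib)
  finally show ?thesis by (simp add: U_def)
qed

text \<open>Decouples the gcds of the three differences \<open>i - k\<close>, \<open>i - j\<close>, \<open>k - j\<close> below. The sum of the third
  power of a gcd with \<open>a\<close> is of the order of \<open>a^2\<close>, which the scaling compensates at the cost of a
  factor \<open>a powr (2/3)\<close>.\<close>

lemma mult3_le_cubes:
  fixes x y z a b c :: real
  assumes "x \<ge> 0" "y \<ge> 0" "z \<ge> 0" "a > 0" "b > 0" "c > 0"
  shows "x * y * z \<le> (a * b * c) powr (2/3) * (x ^ 3 / a ^ 2 + y ^ 3 / b ^ 2 + z ^ 3 / c ^ 2)"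
proof -
  have main: "u * v * w \<le> u ^ 3 + v ^ 3 + w ^ 3" if "u \<ge> 0" "v \<ge> 0" "w \<ge> 0" for u v w :: real
  proof -
    define m where "m = max u (max v w)"
    have m: "u \<le> m" "v \<le> m" "w \<le> m" "m \<ge> 0" using that by (auto simp: m_def)
    have "u * v * w \<le> m * m * m" using m that by (intro mult_mono mult_nonneg_nonneg) auto
    also have "\<dots> = m ^ 3" by (simp add: eval_nat_numeral)
    also have "m = u \<or> m = v \<or> m = w" by (auto simp: m_def max_def)
    hence "m ^ 3 \<le> u ^ 3 + v ^ 3 + w ^ 3" using that by auto
    finally show ?thesis .
  qed
  have sc: "(x / a powr (2/3)) ^ 3 = x ^ 3 / a ^ 2" if "a > 0" for x a :: real
  proof -
    have "(a powr (2/3)) ^ 3 = a powr (2/3 * 3)" using that by (simp add: powr_power)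
    also have "\<dots> = a ^ 2" using that by simp
    finally show ?thesis by (simp add: power_divide)
  qed
  have "x * y * z = (a * b * c) powr (2/3) * ((x / a powr (2/3)) * (y / b powr (2/3)) * (z / c powr (2/3)))"
    using assms by (simp add: powr_mult)
  also have "\<dots> \<le> (a * b * c) powr (2/3) * ((x / a powr (2/3)) ^ 3 + (y / b powr (2/3)) ^ 3 + (z / c powr (2/3)) ^ 3)"
    using assms by (intro mult_left_mono main) auto
  finally show ?thesis using assms by (simp only: sc)
qed

text \<open>Same scheme as for pairs. In \<open>B\<close> the exponent of the product is -2 + 2/3 +
  1/33 = -43/33: the 2/3 is the cost of decoupling the gcds, and 1/33 absorbs
  \<open>24 = 12 * 2\<close> per prime. With weights 1/12 and 11/12 this gives 1/6 + 11/4 = 35/12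
  for \<open>h\<close>, below 3, and 1/12 - 43/36 = -10/9 for the product, below -1.\<close>

lemma triple_sum_bound:
  "\<exists>K>0. \<forall>S T h. finite S \<longrightarrow> finite T \<longrightarrow> (\<forall>p\<in>S \<union> T. prime p) \<longrightarrow> S \<union> T \<noteq> {} \<longrightarrow>
     \<bar>\<Sum>j\<in>{1..int h}. \<Sum>i\<in>{1..int h} - {j}. \<Sum>k\<in>{1..int h} - {j, i}. \<Prod>p\<in>S \<union> T. loc S T (i - j) (k - j) p\<bar>
        \<le> K * real h powr (35/12) * real (\<Prod>(S \<union> T)) powr (- 10/9)"
proof -
  obtain K where K: "K > 0" "\<And>S :: nat set. finite S \<Longrightarrow> (\<forall>p\<in>S. prime p) \<Longrightarrow> 24 ^ card S \<le> K * real (\<Prod>S) powr (1/33)"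
    using power_card_le_powr[of 24 "1/33"] by auto
  have "\<bar>\<Sum>j\<in>{1..int h}. \<Sum>i\<in>{1..int h} - {j}. \<Sum>k\<in>{1..int h} - {j, i}. \<Prod>p\<in>S \<union> T. loc S T (i - j) (k - j) p\<bar>
        \<le> (5 powr (1/12) * (6 * K) powr (11/12)) * real h powr (35/12) * real (\<Prod>(S \<union> T)) powr (- 10/9)"
    if fin: "finite S" "finite T" and pr: "\<forall>p\<in>S \<union> T. prime p" and ne: "S \<union> T \<noteq> {}" for S T h
  proof -
    define I where "I = {1..int h}"
    define U where "U = S \<union> T"
    define Q where "Q = real (\<Prod>U)"
    have U: "finite U" "\<forall>p\<in>U. prime p" using fin pr by (auto simp: U_def)
    have Q: "Q \<ge> 1" unfolding Q_def using U by (intro real_prod_primes_ge_1) auto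
    define F where "F j i k = (\<Prod>p\<in>S \<union> T. loc S T (i - j) (k - j) p)" for j i k
    have F1: "\<bar>F j i k\<bar> \<le> 1" for j i k unfolding F_def using pr by (intro abs_prod_loc_le_1) auto
    have cardI: "card I = h" "finite I" by (simp_all add: I_def)
    have cardI1: "real (card (I - {j})) \<le> real h" for j
      using cardI card_Diff1_le[of I j] by simp
    define x where "x = \<bar>\<Sum>j\<in>I. \<Sum>i\<in>I - {j}. \<Sum>k\<in>I - {j, i}. F j i k\<bar>"
    have s1: "\<bar>\<Sum>i\<in>I - {j}. f i\<bar> \<le> real h" if "\<And>i. \<bar>f i\<bar> \<le> 1" for f :: "int \<Rightarrow> real" and j
    proof -
      have "\<bar>\<Sum>i\<in>I - {j}. f i\<bar> \<le> (\<Sum>i\<in>I - {j}. 1)"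
        using that by (intro order.trans[OF sum_abs] sum_mono)
      thus ?thesis using cardI1[of j] by simp
    qed
    have A: "x \<le> 5 * real h ^ 2 * Q"
    proof -
      have "x \<le> (\<Sum>j\<in>I. \<bar>\<Sum>i\<in>I - {j}. \<Sum>k\<in>I - {j, i}. F j i k\<bar>)" unfolding x_def by (rule sum_abs)
      also have "\<dots> \<le> (\<Sum>j\<in>I. 5 * real h * Q)"
      proof (intro sum_mono)
        fix j assume j: "j \<in> I"
        have "real h \<ge> 1" using j by (auto simp: I_def)
        hence hQ: "real h * Q \<ge> 1 * 1" "real h * Q \<ge> real h * 1" using Q by (intro mult_mono; simp)+
        have "\<bar>\<Sum>i\<in>I. \<Sum>k\<in>I. F j i k\<bar> \<le> real h * Q"
          unfolding F_def I_def Q_def U_def using fin pr ne by (intro sum_prod_loc_bound) auto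
        moreover have "(\<Sum>i\<in>I. \<Sum>k\<in>I. F j i k) = F j j j + (\<Sum>k\<in>I - {j}. F j j k) + (\<Sum>i\<in>I - {j}. F j i j)
          + (\<Sum>i\<in>I - {j}. F j i i) + (\<Sum>i\<in>I - {j}. \<Sum>k\<in>I - {j, i}. F j i k)"
          using j cardI by (intro sum_pairs_split) auto
        moreover have "\<bar>F j j j\<bar> \<le> 1" by (rule F1)
        moreover have "\<bar>\<Sum>k\<in>I - {j}. F j j k\<bar> \<le> real h" "\<bar>\<Sum>i\<in>I - {j}. F j i j\<bar> \<le> real h" "\<bar>\<Sum>i\<in>I - {j}. F j i i\<bar> \<le> real h"
          by (rule s1, rule F1)+
        \<comment> \<open>The full double sum costs \<open>h * Q\<close>, the three single
          coincidences \<open>h\<close> each and the triple coincidence 1; all are at most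
          \<open>h * Q\<close>, which gives the 5.\<close>
        ultimately have "\<bar>\<Sum>i\<in>I - {j}. \<Sum>k\<in>I - {j, i}. F j i k\<bar> \<le> 5 * (real h * Q)"
          using hQ by linarith
        thus "\<bar>\<Sum>i\<in>I - {j}. \<Sum>k\<in>I - {j, i}. F j i k\<bar> \<le> 5 * real h * Q" by simp
      qed
      finally show ?thesis using cardI by (simp add: power2_eq_square mult_ac)
    qed
    define g r s where "g = real (\<Prod>(S \<inter> T))" and "r = real (\<Prod>(S - T))" and "s = real (\<Prod>(T - S))"
    have grs: "g \<ge> 1" "r \<ge> 1" "s \<ge> 1"
      unfolding g_def r_def s_def using pr by (intro real_prod_primes_ge_1; auto)+
    have Qgrs: "Q = g * r * s"
    proof -
      have "U = ((S \<inter> T) \<union> (S - T)) \<union> (T - S)" by (auto simp: U_def)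
      hence "\<Prod>U = \<Prod>(S \<inter> T) * \<Prod>(S - T) * \<Prod>(T - S)"
        using fin by (simp only:) (subst prod.union_disjoint; (subst prod.union_disjoint)?; auto)
      thus ?thesis by (simp add: Q_def g_def r_def s_def)
    qed
    define Z where "Z = {-int h..int h} - {0}"
    have cub: "(\<Sum>x\<in>Z. gcd_set V x ^ 3) \<le> 2 * real h * 2 ^ card U * real (\<Prod>V) ^ 2" if V: "V \<subseteq> U" for V
    proof -
      have "(\<Sum>x\<in>Z. gcd_set V x ^ Suc 2) \<le> 2 * real h * 2 ^ card V * real (\<Prod>V) ^ 2"
        unfolding Z_def using U V by (intro sum_gcd_set_power_le) (auto intro: finite_subset)
      also have "\<dots> \<le> 2 * real h * 2 ^ card U * real (\<Prod>V) ^ 2"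
        using U V by (intro mult_right_mono mult_left_mono power_increasing card_mono) auto
      finally show ?thesis by (simp add: numeral_3_eq_3)
    qed
    have B: "x \<le> 6 * K * (real h) ^ 3 * Q powr (- 43/33)"
    proof -
      define c where "c = 12 ^ card U / Q ^ 2 * Q powr (2/3)"
      define G where "G = (\<lambda>x. gcd_set (S \<inter> T) x ^ 3 / g ^ 2)"
      define R where "R = (\<lambda>x. gcd_set (S - T) x ^ 3 / r ^ 2)"
      define W where "W = (\<lambda>x. gcd_set (T - S) x ^ 3 / s ^ 2)"
      have nn: "G x \<ge> 0" "R x \<ge> 0" "W x \<ge> 0" for x by (simp_all add: G_def R_def W_def)
      have c0: "c \<ge> 0" using Q by (simp add: c_def)
      define m where "m = 2 * real h * 2 ^ card U"
      have m0: "m \<ge> 0" by (simp add: m_def)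
      have Gs: "(\<Sum>x\<in>Z. G x) \<le> m" and Rs: "(\<Sum>x\<in>Z. R x) \<le> m" and Ws: "(\<Sum>x\<in>Z. W x) \<le> m"
      proof -
        have "g ^ 2 > 0" "r ^ 2 > 0" "s ^ 2 > 0" using grs by auto
        thus "(\<Sum>x\<in>Z. G x) \<le> m" "(\<Sum>x\<in>Z. R x) \<le> m" "(\<Sum>x\<in>Z. W x) \<le> m"
          unfolding G_def R_def W_def m_def sum_divide_distrib[symmetric]
          using cub[of "S \<inter> T"] cub[of "S - T"] cub[of "T - S"]
          by (auto simp: pos_divide_le_eq g_def r_def s_def U_def)
      qed
      have sub: "(\<Sum>k\<in>I - {j, i}. f k) \<le> (\<Sum>k\<in>I - {i}. f k)" "(\<Sum>k\<in>I - {j, i}. f k) \<le> (\<Sum>k\<in>I - {j}. f k)"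
        if "\<And>x. f x \<ge> 0" for f :: "int \<Rightarrow> real" and i j
        using cardI that by (auto intro!: sum_mono2)
      have "x \<le> (\<Sum>j\<in>I. \<bar>\<Sum>i\<in>I - {j}. \<Sum>k\<in>I - {j, i}. F j i k\<bar>)" unfolding x_def by (rule sum_abs)
      also have "\<dots> \<le> (\<Sum>j\<in>I. \<Sum>i\<in>I - {j}. \<bar>\<Sum>k\<in>I - {j, i}. F j i k\<bar>)" by (intro sum_mono sum_abs)
      also have "\<dots> \<le> (\<Sum>j\<in>I. \<Sum>i\<in>I - {j}. \<Sum>k\<in>I - {j, i}. \<bar>F j i k\<bar>)" by (intro sum_mono sum_abs)
      also have "\<dots> \<le> (\<Sum>j\<in>I. \<Sum>i\<in>I - {j}. \<Sum>k\<in>I - {j, i}. c * (G (i - k) + R (i - j) + W (k - j)))"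
      proof (intro sum_mono)
        fix j i k
        have "\<bar>F j i k\<bar> \<le> 12 ^ card U / Q ^ 2 * (gcd_set (S \<inter> T) (i - k) * gcd_set (S - T) (i - j) * gcd_set (T - S) (k - j))"
          using abs_prod_loc_le[of S T "i - j" "k - j"] fin pr by (simp add: F_def U_def Q_def)
        also have "\<dots> \<le> 12 ^ card U / Q ^ 2 * (Q powr (2/3) * (G (i - k) + R (i - j) + W (k - j)))"
          unfolding Qgrs G_def R_def W_def using grs Q by (intro mult_left_mono mult3_le_cubes) auto
        finally show "\<bar>F j i k\<bar> \<le> c * (G (i - k) + R (i - j) + W (k - j))" by (simp add: c_def)
      qed
      also have "\<dots> = c * (\<Sum>j\<in>I. \<Sum>i\<in>I - {j}. \<Sum>k\<in>I - {j, i}. (G (i - k) + R (i - j) + W (k - j)))"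
        by (simp add: sum_distrib_left)
      also have "\<dots> \<le> c * (\<Sum>j\<in>I. 3 * real h * m)"
      proof (intro mult_left_mono sum_mono c0)
        fix j assume j: "j \<in> I"
        have jj: "i \<in> {1..int h}" if "i \<in> I" for i using that by (simp add: I_def)
        have a1: "(\<Sum>i\<in>I - {j}. \<Sum>k\<in>I - {j, i}. G (i - k)) \<le> (\<Sum>i\<in>I - {j}. m)"
        proof (intro sum_mono)
          fix i assume i: "i \<in> I - {j}"
          have "(\<Sum>k\<in>I - {j, i}. G (i - k)) \<le> (\<Sum>k\<in>I - {i}. G (i - k))" by (rule sub) (rule nn)
          also have "\<dots> \<le> (\<Sum>x\<in>Z. G x)" unfolding I_def Z_def using i jj nn by (intro sum_offdiag_le) auto
          finally show "(\<Sum>k\<in>I - {j, i}. G (i - k)) \<le> m" using Gs by linarith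
        qed
        have a2: "(\<Sum>i\<in>I - {j}. \<Sum>k\<in>I - {j, i}. W (k - j)) \<le> (\<Sum>i\<in>I - {j}. m)"
        proof (intro sum_mono)
          fix i assume i: "i \<in> I - {j}"
          have "(\<Sum>k\<in>I - {j, i}. W (k - j)) \<le> (\<Sum>k\<in>I - {j}. W (k - j))" by (rule sub) (rule nn)
          also have "\<dots> \<le> (\<Sum>x\<in>Z. W x)" unfolding I_def Z_def using j jj nn by (intro sum_offdiag_le) auto
          finally show "(\<Sum>k\<in>I - {j, i}. W (k - j)) \<le> m" using Ws by linarith
        qed
        \<comment> \<open>\<open>R (i - j)\<close> does not involve \<open>k\<close>, so here the
          free summation over \<open>k\<close> gives the factor \<open>h\<close>; in the other two
          sums it is the summation over \<open>i\<close>.\<close>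
        have a3: "(\<Sum>i\<in>I - {j}. \<Sum>k\<in>I - {j, i}. R (i - j)) \<le> real h * m"
        proof -
          have "(\<Sum>i\<in>I - {j}. \<Sum>k\<in>I - {j, i}. R (i - j)) \<le> (\<Sum>i\<in>I - {j}. real h * R (i - j))"
          proof (intro sum_mono)
            fix i
            have "real (card (I - {j, i})) \<le> real h"
              using cardI card_mono[of I "I - {j, i}"] by simp
            thus "(\<Sum>k\<in>I - {j, i}. R (i - j)) \<le> real h * R (i - j)" using nn by (simp add: mult_right_mono)
          qed
          also have "\<dots> = real h * (\<Sum>i\<in>I - {j}. R (i - j))" by (simp add: sum_distrib_left)
          also have "(\<Sum>i\<in>I - {j}. R (i - j)) \<le> (\<Sum>x\<in>Z. R x)"
            unfolding I_def Z_def using j jj nn by (intro sum_offdiag_le) auto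
          also have "\<dots> \<le> m" by (rule Rs)
          finally show ?thesis by (simp add: mult_left_mono)
        qed
        have "(\<Sum>i\<in>I - {j}. m) \<le> real h * m" using cardI1[of j] m0 by (simp add: mult_right_mono)
        thus "(\<Sum>i\<in>I - {j}. \<Sum>k\<in>I - {j, i}. (G (i - k) + R (i - j) + W (k - j))) \<le> 3 * real h * m"
          using a1 a2 a3 by (simp add: sum.distrib)
      qed
      also have "\<dots> = 6 * (real h) ^ 3 * (24 ^ card U * (Q powr (2/3) / Q ^ 2))"
        using cardI by (simp add: c_def m_def eval_nat_numeral) (simp add: power_mult_distrib[symmetric] mult_ac)
      also have "Q powr (2/3) / Q ^ 2 = Q powr (- 4/3)"
        using Q powr_diff[of Q "2/3" 2] by simp
      also have "6 * (real h) ^ 3 * (24 ^ card U * Q powr (- 4/3)) \<le> 6 * (real h) ^ 3 * ((K * Q powr (1/33)) * Q powr (- 4/3))"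
        using K(2)[OF U] by (intro mult_left_mono mult_right_mono) (auto simp: Q_def)
      also have "(K * Q powr (1/33)) * Q powr (- 4/3) = K * Q powr (- 43/33)"
        by (simp add: mult.assoc flip: powr_add)
      finally show ?thesis by (simp add: mult_ac)
    qed
    have x4: "x \<le> (5 * real h ^ 2 * Q) powr (1/12) * (6 * K * (real h) ^ 3 * Q powr (- 43/33)) powr (1 - 1/12)"
      using A B by (intro interpolate_powr) (auto simp: x_def)
    also have "\<dots> = (5 powr (1/12) * (6 * K) powr (11/12)) * ((real h ^ 2) powr (1/12) * (real h ^ 3) powr (11/12)) * (Q powr (1/12) * (Q powr (- 43/33)) powr (11/12))"
      using K Q by (simp add: powr_mult mult_ac)
    also have "(real h ^ 2) powr (1/12) * (real h ^ 3) powr (11/12) = real h powr (35/12)"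
    proof (cases "h = 0")
      case False
      hence "(real h ^ 2) powr (1/12) = real h powr (1/6)" "(real h ^ 3) powr (11/12) = real h powr (11/4)"
        using powr_powr[of "real h" 2 "1/12"] powr_powr[of "real h" 3 "11/12"] by simp_all
      thus ?thesis by (simp flip: powr_add)
    qed simp
    also have "Q powr (1/12) * (Q powr (- 43/33)) powr (11/12) = Q powr (- 10/9)"
      by (simp add: powr_powr flip: powr_add)
    finally show ?thesis unfolding x_def Q_def U_def F_def I_def .
  qed
  moreover have "5 powr (1/12) * (6 * K) powr (11/12) > 0" using K by simp
  ultimately show ?thesis by blast
qed

section \<open>Averages of the main terms\<close>

definition corr1 :: "nat \<Rightarrow> int \<Rightarrow> real" where
  "corr1 X a = (\<Sum>S\<in>prime_sets X. \<Prod>p\<in>S. eta p a)"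

lemma corr_1_right: "corr X (Suc 0) a b = corr1 X a"
  unfolding corr_def corr1_def prime_sets_1 by (intro sum.cong) (auto simp: loc_def intro!: prod.cong)

lemma eta_0: "prime p \<Longrightarrow> eta p 0 = 1 / (real p - 1)"
proof -
  assume "prime p"
  hence "real p - 1 > 0" using prime_gt_1_nat by simp
  thus ?thesis by (simp add: eta_def sp_def power2_eq_square)
qed

text \<open>A reduced residue \<open>u\<close> is never divisible by \<open>p\<close>, so the factor
  with shift 0 is the constant \<open>1 / (p - 1)\<close>. This is how \<open>L_sum\<close>
  separates from \<open>corr\<close> when a shift coincides with that of the prime variable.\<close>

lemma gam_0:
  assumes "prime p"
  shows "gam p 0 b = 1 / (real p - 1) * eta p b" "gam p a 0 = 1 / (real p - 1) * eta p a"
proof -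
  define q where "q = real p - 1"
  have q: "q > 0" "real p = q + 1" using prime_gt_1_nat[OF assms] by (auto simp: q_def)
  show "gam p 0 b = 1 / (real p - 1) * eta p b" "gam p a 0 = 1 / (real p - 1) * eta p a"
    unfolding gam_def eta_def sp_def q_def[symmetric]
    using q by (auto simp: field_simps power2_eq_square)
qed

lemma corr1_0: "corr1 X 0 = L_sum X"
  unfolding corr1_def L_sum_def prime_wt_def
  by (intro sum.cong prod.cong refl eta_0) (auto dest: prime_setsD)

lemma prod_loc_0:
  assumes "finite S" "finite T" "\<And>p. p \<in> S \<union> T \<Longrightarrow> prime p"
  shows "(\<Prod>p\<in>S \<union> T. loc S T 0 b p) = prime_wt S * (\<Prod>p\<in>T. eta p b)"
    and "(\<Prod>p\<in>S \<union> T. loc S T a 0 p) = (\<Prod>p\<in>S. eta p a) * prime_wt T"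
proof -
  define W where "W = S \<union> T"
  have W: "finite W" "S \<subseteq> W" "T \<subseteq> W" using assms by (auto simp: W_def)
  have wt: "prime_wt V = (\<Prod>p\<in>W. if p \<in> V then 1 / (real p - 1) else 1)" if "V \<subseteq> W" for V
    unfolding prime_wt_def using W that by (intro prod.mono_neutral_cong_left) auto
  have et: "(\<Prod>p\<in>V. eta p c) = (\<Prod>p\<in>W. if p \<in> V then eta p c else 1)" if "V \<subseteq> W" for V c
    using W that by (intro prod.mono_neutral_cong_left) auto
  show "(\<Prod>p\<in>S \<union> T. loc S T 0 b p) = prime_wt S * (\<Prod>p\<in>T. eta p b)"
    unfolding wt[OF W(2)] et[OF W(3)] prod.distrib[symmetric] W_def[symmetric]
    using assms by (intro prod.cong refl) (auto simp: loc_def gam_0 eta_0 W_def)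
  show "(\<Prod>p\<in>S \<union> T. loc S T a 0 p) = (\<Prod>p\<in>S. eta p a) * prime_wt T"
    unfolding wt[OF W(3)] et[OF W(2)] prod.distrib[symmetric] W_def[symmetric]
    using assms by (intro prod.cong refl) (auto simp: loc_def gam_0 eta_0 W_def)
qed

lemma corr_0:
  shows "corr X Y 0 b = L_sum X * corr1 Y b" "corr X Y a 0 = corr1 X a * L_sum Y"
proof -
  have "corr X Y 0 b = (\<Sum>S\<in>prime_sets X. \<Sum>T\<in>prime_sets Y. prime_wt S * (\<Prod>p\<in>T. eta p b))"
    unfolding corr_def by (intro sum.cong refl prod_loc_0) (auto dest: prime_setsD)
  thus "corr X Y 0 b = L_sum X * corr1 Y b" by (simp add: L_sum_def corr1_def sum_product)
  have "corr X Y a 0 = (\<Sum>S\<in>prime_sets X. \<Sum>T\<in>prime_sets Y. (\<Prod>p\<in>S. eta p a) * prime_wt T)"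
    unfolding corr_def by (intro sum.cong refl prod_loc_0) (auto dest: prime_setsD)
  thus "corr X Y a 0 = corr1 X a * L_sum Y" by (simp add: L_sum_def corr1_def sum_product)
qed

text \<open>\<open>S\<close> and \<open>T\<close> can be recovered from \<open>S \<inter> T\<close>,
  \<open>S - T\<close> and \<open>T - S\<close>, and all three parts stay in
  \<open>prime_sets X\<close>; so the double sum embeds into a triple sum that factors.\<close>

lemma sum_prime_sets_pair_le:
  fixes f g k :: "nat set \<Rightarrow> real"
  assumes "\<And>S. S \<in> prime_sets X \<Longrightarrow> f S \<ge> 0" "\<And>S. S \<in> prime_sets X \<Longrightarrow> g S \<ge> 0"
    "\<And>S. S \<in> prime_sets X \<Longrightarrow> k S \<ge> 0"
  shows "(\<Sum>S\<in>prime_sets X. \<Sum>T\<in>prime_sets X. f (S \<inter> T) * g (S - T) * k (T - S))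
           \<le> (\<Sum>S\<in>prime_sets X. f S) * (\<Sum>S\<in>prime_sets X. g S) * (\<Sum>S\<in>prime_sets X. k S)"
proof -
  define P where "P = prime_sets X"
  have fin: "finite P" by (simp add: P_def)
  define h where "h = (\<lambda>(S :: nat set, T :: nat set). (S \<inter> T, S - T, T - S))"
  define F where "F = (\<lambda>(A, B, C). f A * g B * k C)"
  have inj: "inj_on h (P \<times> P)"
  proof (rule inj_onI)
    fix x y assume "h x = h y"
    moreover obtain S T S' T' where "x = (S, T)" "y = (S', T')" by (cases x, cases y) auto
    ultimately have "S \<inter> T = S' \<inter> T'" "S - T = S' - T'" "T - S = T' - S'" and xy: "x = (S, T)" "y = (S', T')"
      by (auto simp: h_def)
    hence "S = S'" "T = T'" by blast+
    thus "x = y" using xy by simp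
  qed
  have "(\<Sum>S\<in>P. \<Sum>T\<in>P. f (S \<inter> T) * g (S - T) * k (T - S)) = (\<Sum>x\<in>P \<times> P. F (h x))"
    by (simp add: sum.cartesian_product F_def h_def case_prod_beta)
  also have "\<dots> = sum F (h ` (P \<times> P))" by (subst sum.reindex[OF inj]) simp
  also have "\<dots> \<le> sum F (P \<times> P \<times> P)"
  proof (rule sum_mono2)
    show "h ` (P \<times> P) \<subseteq> P \<times> P \<times> P"
      by (auto simp: h_def P_def intro: prime_sets_mono)
  qed (use fin assms in \<open>auto simp: F_def P_def\<close>)
  also have "\<dots> = (\<Sum>A\<in>P. \<Sum>B\<in>P. \<Sum>C\<in>P. f A * g B * k C)"
    by (simp add: F_def flip: sum.cartesian_product)
  also have "\<dots> = (\<Sum>S\<in>P. f S) * (\<Sum>S\<in>P. g S) * (\<Sum>S\<in>P. k S)"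
    by (simp flip: sum_distrib_left sum_distrib_right)
  finally show ?thesis by (simp add: P_def)
qed

lemma sum_offdiag_1: "(\<Sum>i\<in>{1..int h}. \<Sum>j\<in>{1..int h} - {i}. (1::real)) = real h * (real h - 1)"
proof -
  have "(\<Sum>i\<in>{1..int h}. \<Sum>j\<in>{1..int h} - {i}. (1::real)) = (\<Sum>i\<in>{1..int h}. real h - 1)"
    by (intro sum.cong refl) (auto simp: of_nat_diff)
  thus ?thesis by simp
qed

text \<open>The main term of the empty set is subtracted here, so that one bound covers all sets
  \<open>U\<close>, the empty one included.\<close>

definition offdiag :: "nat \<Rightarrow> nat set \<Rightarrow> real" where
  "offdiag h U = (\<Sum>i\<in>{1..int h}. \<Sum>j\<in>{1..int h} - {i}. \<Prod>p\<in>U. eta p (j - i))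
     - (if U = {} then real h * (real h - 1) else 0)"

lemma offdiag_bound:
  "\<exists>K>0. \<forall>U h. finite U \<longrightarrow> (\<forall>p\<in>U. prime p) \<longrightarrow>
     \<bar>offdiag h U\<bar> \<le> K * real h powr (7/4) * real (\<Prod>U) powr (- 9/8)"
proof -
  obtain K where K: "K > 0" "\<And>U h. finite U \<Longrightarrow> (\<forall>p\<in>U. prime p) \<Longrightarrow> U \<noteq> {} \<Longrightarrow>
     \<bar>\<Sum>i\<in>{1..int h}. \<Sum>j\<in>{1..int h} - {i}. \<Prod>p\<in>U. eta p (j - i)\<bar>
        \<le> K * real h powr (7/4) * real (\<Prod>U) powr (- 9/8)"
    using pair_sum_bound by blast
  have "\<bar>offdiag h U\<bar> \<le> K * real h powr (7/4) * real (\<Prod>U) powr (- 9/8)"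
    if "finite U" "\<forall>p\<in>U. prime p" for U h
  proof (cases "U = {}")
    case True
    hence "offdiag h U = 0" unfolding offdiag_def by (simp only: prod.empty sum_offdiag_1) simp
    thus ?thesis using K(1) by simp
  next
    case False
    thus ?thesis using K(2)[OF that False, of h] by (simp add: offdiag_def)
  qed
  thus ?thesis using K(1) by blast
qed

text \<open>Only \<open>S = {}\<close> produces a main term; the others form a series that converges
  uniformly in \<open>X\<close>, since 9/8 exceeds 1.\<close>

lemma sum_corr1:
  "\<exists>K>0. \<forall>X\<ge>1. \<forall>h. \<bar>(\<Sum>i\<in>{1..int h}. \<Sum>j\<in>{1..int h} - {i}. corr1 X (j - i)) - real h * (real h - 1)\<bar>
      \<le> K * real h powr (7/4)"
proof -
  obtain K where K: "K > 0" "\<And>U h. finite U \<Longrightarrow> (\<forall>p\<in>U. prime p) \<Longrightarrow>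
     \<bar>offdiag h U\<bar> \<le> K * real h powr (7/4) * real (\<Prod>U) powr (- 9/8)"
    using offdiag_bound by blast
  obtain K' where K': "K' > 0" "\<And>X. (\<Sum>S\<in>prime_sets X. real (\<Prod>S) powr (- 9/8)) \<le> K'"
    using sum_prime_sets_powr_le[of "9/8"] by auto
  have "\<bar>(\<Sum>i\<in>{1..int h}. \<Sum>j\<in>{1..int h} - {i}. corr1 X (j - i)) - real h * (real h - 1)\<bar>
      \<le> (K * K') * real h powr (7/4)" if X: "X \<ge> 1" for X h
  proof -
    have "(\<Sum>i\<in>{1..int h}. \<Sum>j\<in>{1..int h} - {i}. corr1 X (j - i))
       = (\<Sum>i\<in>{1..int h}. \<Sum>S\<in>prime_sets X. \<Sum>j\<in>{1..int h} - {i}. \<Prod>p\<in>S. eta p (j - i))"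
      unfolding corr1_def by (intro sum.cong refl sum.swap)
    also have "\<dots> = (\<Sum>S\<in>prime_sets X. \<Sum>i\<in>{1..int h}. \<Sum>j\<in>{1..int h} - {i}. \<Prod>p\<in>S. eta p (j - i))"
      by (rule sum.swap)
    also have "\<dots> = (\<Sum>S\<in>prime_sets X. offdiag h S + (if S = {} then real h * (real h - 1) else 0))"
      by (simp add: offdiag_def)
    also have "\<dots> = (\<Sum>S\<in>prime_sets X. offdiag h S) + real h * (real h - 1)"
      using X by (simp add: sum.distrib)
    finally have "\<bar>(\<Sum>i\<in>{1..int h}. \<Sum>j\<in>{1..int h} - {i}. corr1 X (j - i)) - real h * (real h - 1)\<bar>
        = \<bar>\<Sum>S\<in>prime_sets X. offdiag h S\<bar>" by simp
    also have "\<dots> \<le> (\<Sum>S\<in>prime_sets X. K * real h powr (7/4) * real (\<Prod>S) powr (- 9/8))"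
      using K(2) by (intro order.trans[OF sum_abs] sum_mono) (auto dest: prime_setsD)
    also have "\<dots> = K * real h powr (7/4) * (\<Sum>S\<in>prime_sets X. real (\<Prod>S) powr (- 9/8))"
      by (simp only: sum_distrib_left)
    also have "\<dots> \<le> K * real h powr (7/4) * K'" using K K' by (intro mult_left_mono) auto
    finally show ?thesis by (simp add: mult_ac)
  qed
  thus ?thesis using K K' by (intro exI[of _ "K * K'"]) auto
qed

text \<open>For \<open>a = b\<close> the mean value of \<open>gam p\<close> is not small: its constant part \<open>1 / (p - 1)\<close> is what
  produces the factor \<open>L_sum X\<close> in the diagonal sum.\<close>

lemma gam_diag:
  assumes "prime p"
  shows "gam p a a = - (real p - 2) / (real p - 1) * eta p a + 1 / (real p - 1)"
proof -
  define q where "q = real p - 1"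
  have q: "q > 0" "real p = q + 1" using prime_gt_1_nat[OF assms] by (auto simp: q_def)
  show ?thesis
    unfolding gam_def eta_def sp_def q_def[symmetric]
    using q by (auto simp: field_simps power2_eq_square)
qed

text \<open>On \<open>S \<inter> T\<close> each factor is split by \<open>gam_diag\<close>, and
  \<open>E\<close> collects the primes where the \<open>eta\<close> part is chosen. This leaves
  \<open>eta\<close> over \<open>E\<close> and the symmetric difference, weighted by
  \<open>prime_wt (S \<inter> T - E)\<close>. In the error the sum of that weight costs one factor
  \<open>L_sum X\<close>, and the sums over \<open>E\<close>, \<open>S - T\<close> and
  \<open>T - S\<close> converge, whence \<open>K' ^ 3\<close>.\<close>

lemma sum_corr_diag:
  "\<exists>K>0. \<forall>X\<ge>1. \<forall>h. \<bar>(\<Sum>j\<in>{1..int h}. \<Sum>i\<in>{1..int h} - {j}. corr X X (i - j) (i - j)) - L_sum X * (real h * (real h - 1))\<bar>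
      \<le> K * L_sum X * real h powr (7/4)"
proof -
  obtain K where K: "K > 0" "\<And>U h. finite U \<Longrightarrow> (\<forall>p\<in>U. prime p) \<Longrightarrow>
     \<bar>offdiag h U\<bar> \<le> K * real h powr (7/4) * real (\<Prod>U) powr (- 9/8)"
    using offdiag_bound by blast
  obtain K' where K': "K' > 0" "\<And>X. (\<Sum>S\<in>prime_sets X. real (\<Prod>S) powr (- 9/8)) \<le> K'"
    using sum_prime_sets_powr_le[of "9/8"] by auto
  have "\<bar>(\<Sum>j\<in>{1..int h}. \<Sum>i\<in>{1..int h} - {j}. corr X X (i - j) (i - j)) - L_sum X * (real h * (real h - 1))\<bar>
      \<le> (K * K' ^ 3) * L_sum X * real h powr (7/4)" if X: "X \<ge> 1" for X h
  proof -
    define P where "P = prime_sets X"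
    define \<kappa> where "\<kappa> p = - (real p - 2) / (real p - 1)" for p :: nat
    define c where "c S T E = (\<Prod>p\<in>E. \<kappa> p) * prime_wt (S \<inter> T - E)" for S T E
    define U where "U S T E = E \<union> ((S - T) \<union> (T - S))" for S T E :: "nat set"
    define n where "n = real h * (real h - 1)"
    have P: "finite S" "\<And>p. p \<in> S \<Longrightarrow> prime p" if "S \<in> P" for S
      using prime_setsD[of S X] that by (auto simp: P_def)
    have expand: "(\<Prod>p\<in>S \<union> T. loc S T a a p) = (\<Sum>E\<in>Pow (S \<inter> T). c S T E * (\<Prod>p\<in>U S T E. eta p a))"
      if ST: "S \<in> P" "T \<in> P" for S T a
    proof -
      note fin = P[OF ST(1)] P[OF ST(2)]
      define D where "D = (S - T) \<union> (T - S)"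
      have "S \<union> T = (S \<inter> T) \<union> D" "(S \<inter> T) \<inter> D = {}" "finite D" by (auto simp: D_def fin)
      hence "(\<Prod>p\<in>S \<union> T. loc S T a a p) = (\<Prod>p\<in>S \<inter> T. loc S T a a p) * (\<Prod>p\<in>D. loc S T a a p)"
        using fin by (simp only:) (rule prod.union_disjoint; simp)
      also have "(\<Prod>p\<in>D. loc S T a a p) = (\<Prod>p\<in>D. eta p a)"
        by (intro prod.cong) (auto simp: D_def loc_def)
      also have "(\<Prod>p\<in>S \<inter> T. loc S T a a p) = (\<Prod>p\<in>S \<inter> T. \<kappa> p * eta p a + 1 / (real p - 1))"
        using fin by (intro prod.cong) (auto simp: loc_def gam_diag \<kappa>_def)
      also have "\<dots> = (\<Sum>E\<in>Pow (S \<inter> T). (\<Prod>p\<in>E. \<kappa> p * eta p a) * (\<Prod>p\<in>S \<inter> T - E. 1 / (real p - 1)))"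
        using fin by (intro prod_add) auto
      also have "\<dots> * (\<Prod>p\<in>D. eta p a) = (\<Sum>E\<in>Pow (S \<inter> T). c S T E * (\<Prod>p\<in>U S T E. eta p a))"
        unfolding sum_distrib_right
      proof (intro sum.cong refl)
        fix E assume E: "E \<in> Pow (S \<inter> T)"
        hence "finite E" "E \<inter> D = {}" using fin by (auto simp: D_def intro: finite_subset)
        hence "(\<Prod>p\<in>U S T E. eta p a) = (\<Prod>p\<in>E. eta p a) * (\<Prod>p\<in>D. eta p a)"
          unfolding U_def D_def[symmetric] using \<open>finite D\<close> by (intro prod.union_disjoint)
        thus "(\<Prod>p\<in>E. \<kappa> p * eta p a) * (\<Prod>p\<in>S \<inter> T - E. 1 / (real p - 1)) * (\<Prod>p\<in>D. eta p a)
           = c S T E * (\<Prod>p\<in>U S T E. eta p a)"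
          by (simp add: c_def prime_wt_def prod.distrib)
      qed
      finally show ?thesis .
    qed
    define V where "V W = (\<Sum>j\<in>{1..int h}. \<Sum>i\<in>{1..int h} - {j}. \<Prod>p\<in>W. eta p (i - j))" for W :: "nat set"
    have VO: "V W = offdiag h W + (if W = {} then n else 0)" for W
      by (simp add: V_def offdiag_def n_def)
    have "(\<Sum>j\<in>{1..int h}. \<Sum>i\<in>{1..int h} - {j}. corr X X (i - j) (i - j))
      = (\<Sum>j\<in>{1..int h}. \<Sum>i\<in>{1..int h} - {j}. \<Sum>S\<in>P. \<Sum>T\<in>P. \<Sum>E\<in>Pow (S \<inter> T). c S T E * (\<Prod>p\<in>U S T E. eta p (i - j)))"
      unfolding corr_def P_def[symmetric] using expand by (intro sum.cong refl) auto
    also have "\<dots> = (\<Sum>j\<in>{1..int h}. \<Sum>S\<in>P. \<Sum>T\<in>P. \<Sum>E\<in>Pow (S \<inter> T). \<Sum>i\<in>{1..int h} - {j}. c S T E * (\<Prod>p\<in>U S T E. eta p (i - j)))"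
      by (subst sum.swap, intro sum.cong refl, subst sum.swap, intro sum.cong refl, subst sum.swap, intro refl)
    also have "\<dots> = (\<Sum>S\<in>P. \<Sum>T\<in>P. \<Sum>E\<in>Pow (S \<inter> T). \<Sum>j\<in>{1..int h}. \<Sum>i\<in>{1..int h} - {j}. c S T E * (\<Prod>p\<in>U S T E. eta p (i - j)))"
      by (subst sum.swap, intro sum.cong refl, subst sum.swap, intro sum.cong refl, subst sum.swap, intro refl)
    also have "\<dots> = (\<Sum>S\<in>P. \<Sum>T\<in>P. \<Sum>E\<in>Pow (S \<inter> T). c S T E * V (U S T E))"
      by (simp add: V_def sum_distrib_left)
    also have "\<dots> = (\<Sum>S\<in>P. \<Sum>T\<in>P. \<Sum>E\<in>Pow (S \<inter> T). c S T E * offdiag h (U S T E))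
        + (\<Sum>S\<in>P. \<Sum>T\<in>P. \<Sum>E\<in>Pow (S \<inter> T). c S T E * (if U S T E = {} then n else 0))"
      unfolding VO by (simp add: sum.distrib distrib_left)
    also have "(\<Sum>S\<in>P. \<Sum>T\<in>P. \<Sum>E\<in>Pow (S \<inter> T). c S T E * (if U S T E = {} then n else 0)) = L_sum X * n"
    proof -
      \<comment> \<open>\<open>U S T E\<close> is empty only for \<open>T = S\<close> and
        \<open>E = {}\<close>, where the coefficient is \<open>prime_wt S\<close>; summing over
        \<open>S\<close> gives \<open>L_sum X\<close>.\<close>
      have "(\<Sum>S\<in>P. \<Sum>T\<in>P. \<Sum>E\<in>Pow (S \<inter> T). c S T E * (if U S T E = {} then n else 0))
          = (\<Sum>S\<in>P. prime_wt S * n)"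
      proof (intro sum.cong refl)
        fix S assume S: "S \<in> P"
        have "(\<Sum>T\<in>P. \<Sum>E\<in>Pow (S \<inter> T). c S T E * (if U S T E = {} then n else 0))
            = (\<Sum>T\<in>P. if T = S then prime_wt S * n else 0)"
        proof (intro sum.cong refl)
          fix T assume "T \<in> P"
          have "(\<Sum>E\<in>Pow (S \<inter> T). c S T E * (if U S T E = {} then n else 0))
             = (\<Sum>E\<in>Pow (S \<inter> T). if E = {} then (if T = S then prime_wt S * n else 0) else 0)"
            by (intro sum.cong refl) (auto simp: U_def c_def)
          thus "(\<Sum>E\<in>Pow (S \<inter> T). c S T E * (if U S T E = {} then n else 0)) = (if T = S then prime_wt S * n else 0)"
            using P(1)[OF S] by simp
        qed
        thus "(\<Sum>T\<in>P. \<Sum>E\<in>Pow (S \<inter> T). c S T E * (if U S T E = {} then n else 0)) = prime_wt S * n"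
          using S by (simp add: P_def)
      qed
      thus ?thesis by (simp add: L_sum_def P_def sum_distrib_right)
    qed
    finally have "\<bar>(\<Sum>j\<in>{1..int h}. \<Sum>i\<in>{1..int h} - {j}. corr X X (i - j) (i - j)) - L_sum X * n\<bar>
      = \<bar>\<Sum>S\<in>P. \<Sum>T\<in>P. \<Sum>E\<in>Pow (S \<inter> T). c S T E * offdiag h (U S T E)\<bar>" by simp
    also have "\<dots> \<le> (\<Sum>S\<in>P. \<bar>\<Sum>T\<in>P. \<Sum>E\<in>Pow (S \<inter> T). c S T E * offdiag h (U S T E)\<bar>)"
      by (rule sum_abs)
    also have "\<dots> \<le> (\<Sum>S\<in>P. \<Sum>T\<in>P. \<bar>\<Sum>E\<in>Pow (S \<inter> T). c S T E * offdiag h (U S T E)\<bar>)"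
      by (intro sum_mono sum_abs)
    also have "\<dots> \<le> (\<Sum>S\<in>P. \<Sum>T\<in>P. \<Sum>E\<in>Pow (S \<inter> T). \<bar>c S T E * offdiag h (U S T E)\<bar>)"
      by (intro sum_mono sum_abs)
    also have "\<dots> \<le> (\<Sum>S\<in>P. \<Sum>T\<in>P. \<Sum>E\<in>Pow (S \<inter> T). K * real h powr (7/4) *
        (real (\<Prod>E) powr (- 9/8) * prime_wt (S \<inter> T - E) * real (\<Prod>(S - T)) powr (- 9/8) * real (\<Prod>(T - S)) powr (- 9/8)))"
    proof (intro sum_mono)
      fix S T E assume ST: "S \<in> P" "T \<in> P" and E: "E \<in> Pow (S \<inter> T)"
      note fin = P[OF ST(1)] P[OF ST(2)]
      have wt: "prime_wt (S \<inter> T - E) \<ge> 0" using fin by (intro less_imp_le prime_wt_pos) auto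
      have \<kappa>: "\<bar>\<Prod>p\<in>E. \<kappa> p\<bar> \<le> 1"
        unfolding abs_prod
      proof (intro prod_le_1 conjI)
        fix p assume "p \<in> E"
        hence "prime p" using E fin by auto
        hence "real p \<ge> 2" using prime_ge_2_nat by simp
        thus "\<bar>\<kappa> p\<bar> \<le> 1" by (simp add: \<kappa>_def)
      qed auto
      have "\<bar>c S T E * offdiag h (U S T E)\<bar> = \<bar>\<Prod>p\<in>E. \<kappa> p\<bar> * prime_wt (S \<inter> T - E) * \<bar>offdiag h (U S T E)\<bar>"
        using wt by (simp add: c_def abs_mult)
      also have "\<dots> \<le> 1 * prime_wt (S \<inter> T - E) * (K * real h powr (7/4) * real (\<Prod>(U S T E)) powr (- 9/8))"
        using \<kappa> wt E fin by (intro mult_mono K(2)) (auto simp: U_def intro: finite_subset)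
      also have "\<Prod>(U S T E) = \<Prod>E * (\<Prod>(S - T) * \<Prod>(T - S))"
        unfolding U_def using E fin
        by (subst prod.union_disjoint; (subst prod.union_disjoint)?; auto intro: finite_subset)
      also have "real (\<Prod>E * (\<Prod>(S - T) * \<Prod>(T - S))) powr (- 9/8)
          = real (\<Prod>E) powr (- 9/8) * real (\<Prod>(S - T)) powr (- 9/8) * real (\<Prod>(T - S)) powr (- 9/8)"
        by (simp only: of_nat_mult powr_mult of_nat_0_le_iff mult.assoc)
      finally show "\<bar>c S T E * offdiag h (U S T E)\<bar> \<le> K * real h powr (7/4) *
        (real (\<Prod>E) powr (- 9/8) * prime_wt (S \<inter> T - E) * real (\<Prod>(S - T)) powr (- 9/8) * real (\<Prod>(T - S)) powr (- 9/8))"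
        by (simp add: mult_ac)
    qed
    also have "\<dots> = K * real h powr (7/4) * (\<Sum>S\<in>P. \<Sum>T\<in>P. (\<Sum>E\<in>Pow (S \<inter> T). real (\<Prod>E) powr (- 9/8) * prime_wt (S \<inter> T - E))
        * real (\<Prod>(S - T)) powr (- 9/8) * real (\<Prod>(T - S)) powr (- 9/8))"
      by (simp only: sum_distrib_left sum_distrib_right)
    also have "\<dots> \<le> K * real h powr (7/4) * ((\<Sum>S\<in>P. \<Sum>E\<in>Pow S. real (\<Prod>E) powr (- 9/8) * prime_wt (S - E))
        * (\<Sum>S\<in>P. real (\<Prod>S) powr (- 9/8)) * (\<Sum>S\<in>P. real (\<Prod>S) powr (- 9/8)))"
      unfolding P_def
    proof (intro mult_left_mono sum_prime_sets_pair_le sum_nonneg mult_nonneg_nonneg)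
      fix S E assume "S \<in> prime_sets X" "E \<in> Pow S"
      thus "0 \<le> prime_wt (S - E)" using P[of S] by (intro less_imp_le prime_wt_pos) (auto simp: P_def)
    qed (use K in auto)
    also have "\<dots> \<le> K * real h powr (7/4) * ((K' * L_sum X) * K' * K')"
    proof (intro mult_left_mono mult_mono)
      have "(\<Sum>S\<in>P. \<Sum>E\<in>Pow S. real (\<Prod>E) powr (- 9/8) * prime_wt (S - E))
         \<le> (\<Sum>S\<in>P. real (\<Prod>S) powr (- 9/8)) * L_sum X"
        unfolding P_def L_sum_def
      proof (rule sum_prime_sets_split_le)
        fix S assume "S \<in> prime_sets X"
        thus "0 \<le> prime_wt S" using P[of S] by (intro less_imp_le prime_wt_pos) (auto simp: P_def)
      qed auto
      also have "\<dots> \<le> K' * L_sum X" unfolding P_def using K' L_sum_nonneg by (intro mult_right_mono) auto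
      finally show "(\<Sum>S\<in>P. \<Sum>E\<in>Pow S. real (\<Prod>E) powr (- 9/8) * prime_wt (S - E)) \<le> K' * L_sum X" .
    qed (use K K' L_sum_nonneg in \<open>auto simp: P_def intro!: sum_nonneg mult_nonneg_nonneg\<close>)
    finally show ?thesis by (simp add: n_def mult_ac eval_nat_numeral)
  qed
  thus ?thesis using K K' by (intro exI[of _ "K * K' ^ 3"]) auto
qed

text \<open>Only \<open>S = T = {}\<close> contributes to the main term, namely the number of
  ordered triples of distinct shifts. The rest is summable over the three disjoint parts of
  \<open>S \<union> T\<close>, since 10/9 exceeds 1.\<close>

lemma sum_corr_distinct:
  "\<exists>K>0. \<forall>X\<ge>1. \<forall>h. \<bar>(\<Sum>j\<in>{1..int h}. \<Sum>i\<in>{1..int h} - {j}. \<Sum>k\<in>{1..int h} - {j, i}. corr X X (i - j) (k - j))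
      - real h * (real h - 1) * (real h - 2)\<bar> \<le> K * real h powr (35/12)"
proof -
  obtain K where K: "K > 0" "\<And>S T h. finite S \<Longrightarrow> finite T \<Longrightarrow> (\<forall>p\<in>S \<union> T. prime p) \<Longrightarrow> S \<union> T \<noteq> {} \<Longrightarrow>
     \<bar>\<Sum>j\<in>{1..int h}. \<Sum>i\<in>{1..int h} - {j}. \<Sum>k\<in>{1..int h} - {j, i}. \<Prod>p\<in>S \<union> T. loc S T (i - j) (k - j) p\<bar>
        \<le> K * real h powr (35/12) * real (\<Prod>(S \<union> T)) powr (- 10/9)"
    using triple_sum_bound by blast
  obtain K' where K': "K' > 0" "\<And>X. (\<Sum>S\<in>prime_sets X. real (\<Prod>S) powr (- 10/9)) \<le> K'"
    using sum_prime_sets_powr_le[of "10/9"] by auto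
  have "\<bar>(\<Sum>j\<in>{1..int h}. \<Sum>i\<in>{1..int h} - {j}. \<Sum>k\<in>{1..int h} - {j, i}. corr X X (i - j) (k - j))
      - real h * (real h - 1) * (real h - 2)\<bar> \<le> (K * K' ^ 3) * real h powr (35/12)" if X: "X \<ge> 1" for X h
  proof -
    define P where "P = prime_sets X"
    define I where "I = {1..int h}"
    define n where "n = real h * (real h - 1) * (real h - 2)"
    define D where "D S T = (\<Sum>j\<in>I. \<Sum>i\<in>I - {j}. \<Sum>k\<in>I - {j, i}. \<Prod>p\<in>S \<union> T. loc S T (i - j) (k - j) p)" for S T
    have P: "finite S" "\<And>p. p \<in> S \<Longrightarrow> prime p" if "S \<in> P" for S
      using prime_setsD[of S X] that by (auto simp: P_def)
    have D0: "D {} {} = n"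
    proof -
      have "D {} {} = (\<Sum>j\<in>I. \<Sum>i\<in>I - {j}. real h - 2)"
        unfolding D_def
      proof (intro sum.cong refl)
        fix j i assume "j \<in> I" "i \<in> I - {j}"
        hence "{j, i} \<subseteq> I" "card {j, i} = 2" by auto
        hence "card (I - {j, i}) = h - 2" "2 \<le> h"
          using card_mono[of I "{j, i}"] by (auto simp: card_Diff_subset I_def)
        thus "(\<Sum>k\<in>I - {j, i}. \<Prod>p\<in>{} \<union> {}. loc {} {} (i - j) (k - j) p) = real h - 2"
          by simp
      qed
      also have "\<dots> = (\<Sum>j\<in>I. (real h - 1) * (real h - 2))"
        by (intro sum.cong refl) (auto simp: I_def of_nat_diff)
      finally show ?thesis by (simp add: I_def n_def)
    qed
    have "(\<Sum>j\<in>I. \<Sum>i\<in>I - {j}. \<Sum>k\<in>I - {j, i}. corr X X (i - j) (k - j))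
       = (\<Sum>j\<in>I. \<Sum>i\<in>I - {j}. \<Sum>S\<in>P. \<Sum>T\<in>P. \<Sum>k\<in>I - {j, i}. \<Prod>p\<in>S \<union> T. loc S T (i - j) (k - j) p)"
      unfolding corr_def P_def[symmetric]
      by (intro sum.cong refl, subst sum.swap, intro sum.cong refl, subst sum.swap, intro refl)
    also have "\<dots> = (\<Sum>j\<in>I. \<Sum>S\<in>P. \<Sum>T\<in>P. \<Sum>i\<in>I - {j}. \<Sum>k\<in>I - {j, i}. \<Prod>p\<in>S \<union> T. loc S T (i - j) (k - j) p)"
      by (intro sum.cong refl, subst sum.swap, intro sum.cong refl, subst sum.swap, intro refl)
    also have "\<dots> = (\<Sum>S\<in>P. \<Sum>T\<in>P. D S T)" unfolding D_def
      by (subst sum.swap, intro sum.cong refl, subst sum.swap, intro refl)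
    also have "\<dots> = (\<Sum>S\<in>P. \<Sum>T\<in>P. (D S T - (if S = {} then if T = {} then n else 0 else 0))) + n"
    proof -
      have "(\<Sum>S\<in>P. \<Sum>T\<in>P. (if S = {} then if T = {} then n else 0 else 0)) = (\<Sum>S\<in>P. if S = {} then n else 0)"
        using X by (intro sum.cong refl) (auto simp: P_def)
      also have "\<dots> = n" using X by (simp add: P_def)
      finally show ?thesis by (simp add: sum_subtractf)
    qed
    finally have "\<bar>(\<Sum>j\<in>I. \<Sum>i\<in>I - {j}. \<Sum>k\<in>I - {j, i}. corr X X (i - j) (k - j)) - n\<bar>
      = \<bar>\<Sum>S\<in>P. \<Sum>T\<in>P. (D S T - (if S = {} then if T = {} then n else 0 else 0))\<bar>" by simp
    also have "\<dots> \<le> (\<Sum>S\<in>P. \<bar>\<Sum>T\<in>P. (D S T - (if S = {} then if T = {} then n else 0 else 0))\<bar>)"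
      by (rule sum_abs)
    also have "\<dots> \<le> (\<Sum>S\<in>P. \<Sum>T\<in>P. \<bar>D S T - (if S = {} then if T = {} then n else 0 else 0)\<bar>)"
      by (intro sum_mono sum_abs)
    also have "\<dots> \<le> (\<Sum>S\<in>P. \<Sum>T\<in>P. K * real h powr (35/12) *
       (real (\<Prod>(S \<inter> T)) powr (- 10/9) * real (\<Prod>(S - T)) powr (- 10/9) * real (\<Prod>(T - S)) powr (- 10/9)))"
    proof (intro sum_mono)
      fix S T assume ST: "S \<in> P" "T \<in> P"
      note fin = P[OF ST(1)] P[OF ST(2)]
      have "S \<union> T = ((S \<inter> T) \<union> (S - T)) \<union> (T - S)" by auto
      hence prd: "\<Prod>(S \<union> T) = \<Prod>(S \<inter> T) * \<Prod>(S - T) * \<Prod>(T - S)"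
        using fin by (simp only:) (subst prod.union_disjoint; (subst prod.union_disjoint)?; auto)
      have "real (\<Prod>(S \<union> T)) powr (- 10/9)
          = real (\<Prod>(S \<inter> T)) powr (- 10/9) * real (\<Prod>(S - T)) powr (- 10/9) * real (\<Prod>(T - S)) powr (- 10/9)"
        unfolding prd by (simp only: of_nat_mult powr_mult of_nat_0_le_iff)
      moreover have "\<bar>D S T - (if S = {} then if T = {} then n else 0 else 0)\<bar> \<le> K * real h powr (35/12) * real (\<Prod>(S \<union> T)) powr (- 10/9)"
      proof (cases "S \<union> T = {}")
        case True
        thus ?thesis using K(1) D0 by simp
      next
        case False
        thus ?thesis using K(2)[of S T h] fin by (auto simp: D_def I_def)
      qed
      ultimately show "\<bar>D S T - (if S = {} then if T = {} then n else 0 else 0)\<bar> \<le> K * real h powr (35/12) *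
       (real (\<Prod>(S \<inter> T)) powr (- 10/9) * real (\<Prod>(S - T)) powr (- 10/9) * real (\<Prod>(T - S)) powr (- 10/9))"
        by (simp add: mult.assoc)
    qed
    also have "\<dots> = K * real h powr (35/12) * (\<Sum>S\<in>P. \<Sum>T\<in>P.
       real (\<Prod>(S \<inter> T)) powr (- 10/9) * real (\<Prod>(S - T)) powr (- 10/9) * real (\<Prod>(T - S)) powr (- 10/9))"
      by (simp only: sum_distrib_left)
    also have "\<dots> \<le> K * real h powr (35/12) * ((\<Sum>S\<in>P. real (\<Prod>S) powr (- 10/9)) *
        (\<Sum>S\<in>P. real (\<Prod>S) powr (- 10/9)) * (\<Sum>S\<in>P. real (\<Prod>S) powr (- 10/9)))"
      unfolding P_def using K by (intro mult_left_mono sum_prime_sets_pair_le) auto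
    also have "\<dots> \<le> K * real h powr (35/12) * (K' * K' * K')"
      unfolding P_def using K K' by (intro mult_left_mono mult_mono K'(2)) (auto intro!: sum_nonneg mult_nonneg_nonneg)
    finally show ?thesis by (simp add: I_def n_def mult_ac eval_nat_numeral)
  qed
  thus ?thesis using K K' by (intro exI[of _ "K * K' ^ 3"]) auto
qed

section \<open>The mixed moments\<close>

lemma psi_R_diff:
  "psi_R R (real n + real h) - psi_R R (real n) = (\<Sum>i\<in>{1..int h}. lam_sets (nat \<lfloor>R\<rfloor>) (int n + i))"
proof -
  have fl: "\<lfloor>real n + real h\<rfloor> = int n + int h" "\<lfloor>real n\<rfloor> = int n"
    by (simp_all flip: of_nat_add)
  have "{1..int n + int h} = {1..int n} \<union> {int n + 1..int n + int h}" by auto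
  hence "(\<Sum>m=1..int n + int h. lambda_R R m) = (\<Sum>m=1..int n. lambda_R R m) + (\<Sum>m=int n + 1..int n + int h. lambda_R R m)"
    by (simp add: sum.union_disjoint)
  also have "(\<Sum>m=int n + 1..int n + int h. lambda_R R m) = (\<Sum>i\<in>{1..int h}. lambda_R R (int n + i))"
    by (rule sum.reindex_bij_witness[of _ "\<lambda>i. int n + i" "\<lambda>m. m - int n"]) auto
  also have "\<dots> = (\<Sum>i\<in>{1..int h}. lam_sets (nat \<lfloor>R\<rfloor>) (int n + i))"
    by (intro sum.cong refl lambda_R_eq_lam_sets) auto
  finally show ?thesis unfolding psi_R_def fl by simp
qed

lemma psi_diff:
  "psi (real n + real h) - psi (real n) = (\<Sum>j\<in>{1..int h}. mangoldt (nat (int n + j)))"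
proof -
  have fl: "nat \<lfloor>real n + real h\<rfloor> = n + h" "nat \<lfloor>real n\<rfloor> = n"
    by (simp_all flip: of_nat_add)
  have "{1..n + h} = {1..n} \<union> {n + 1..n + h}" by auto
  hence "(\<Sum>m=1..n + h. mangoldt m :: real) = (\<Sum>m=1..n. mangoldt m) + (\<Sum>m=n + 1..n + h. mangoldt m)"
    by (simp add: sum.union_disjoint)
  also have "(\<Sum>m=n + 1..n + h. mangoldt m :: real) = (\<Sum>j\<in>{1..int h}. mangoldt (nat (int n + j)))"
    by (rule sum.reindex_bij_witness[of _ "\<lambda>j. nat (int n + j)" "\<lambda>m. int m - int n"]) auto
  finally show ?thesis unfolding psi_def fl by simp
qed

text \<open>One function serves all three moments: at level 1 \<open>lam_sets\<close> is constantly
  1, so setting \<open>X\<close> or \<open>Y\<close> to 1 removes a factor.\<close>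

definition corr_sum :: "nat \<Rightarrow> nat \<Rightarrow> nat \<Rightarrow> int \<Rightarrow> int \<Rightarrow> int \<Rightarrow> real" where
  "corr_sum N X Y i k j = (\<Sum>n=1..N. lam_sets X (int n + i) * lam_sets Y (int n + k) * mangoldt (nat (int n + j)))"

lemma lam_sets_1: "lam_sets (Suc 0) n = 1"
  by (simp add: lam_sets_def prime_sets_1)

lemma M_tilde_1: "M_tilde 1 N h (psi_R R) = (\<Sum>j\<in>{1..int h}. corr_sum N 1 1 j j j)"
  unfolding M_tilde_def psi_diff corr_sum_def by (simp add: lam_sets_1) (rule sum.swap)

lemma M_tilde_2:
  "M_tilde 2 N h (psi_R R) = (\<Sum>j\<in>{1..int h}. \<Sum>i\<in>{1..int h}. corr_sum N (nat \<lfloor>R\<rfloor>) 1 i j j)"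
proof -
  have "M_tilde 2 N h (psi_R R) = (\<Sum>n=1..N. \<Sum>j\<in>{1..int h}. \<Sum>i\<in>{1..int h}.
      lam_sets (nat \<lfloor>R\<rfloor>) (int n + i) * mangoldt (nat (int n + j)))"
    unfolding M_tilde_def psi_diff psi_R_diff by (simp add: sum_product) (intro sum.cong refl sum.swap)
  also have "\<dots> = (\<Sum>j\<in>{1..int h}. \<Sum>n=1..N. \<Sum>i\<in>{1..int h}.
      lam_sets (nat \<lfloor>R\<rfloor>) (int n + i) * mangoldt (nat (int n + j)))"
    by (rule sum.swap)
  also have "\<dots> = (\<Sum>j\<in>{1..int h}. \<Sum>i\<in>{1..int h}. corr_sum N (nat \<lfloor>R\<rfloor>) 1 i j j)"
    unfolding corr_sum_def One_nat_def lam_sets_1 mult_1_right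
    by (intro sum.cong refl sum.swap)
  finally show ?thesis .
qed

lemma M_tilde_3:
  "M_tilde 3 N h (psi_R R) = (\<Sum>j\<in>{1..int h}. \<Sum>i\<in>{1..int h}. \<Sum>k\<in>{1..int h}. corr_sum N (nat \<lfloor>R\<rfloor>) (nat \<lfloor>R\<rfloor>) i k j)"
proof -
  define f where "f n i k j = lam_sets (nat \<lfloor>R\<rfloor>) (int n + i) * lam_sets (nat \<lfloor>R\<rfloor>) (int n + k) * mangoldt (nat (int n + j))"
    for n i k j
  have "M_tilde 3 N h (psi_R R) = (\<Sum>n=1..N. \<Sum>j\<in>{1..int h}. \<Sum>i\<in>{1..int h}. \<Sum>k\<in>{1..int h}. f n i k j)"
    unfolding M_tilde_def psi_diff psi_R_diff
  proof (intro sum.cong refl)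
    fix n
    define A where "A = (\<Sum>i\<in>{1..int h}. lam_sets (nat \<lfloor>R\<rfloor>) (int n + i))"
    have "(\<Sum>j\<in>{1..int h}. \<Sum>i\<in>{1..int h}. \<Sum>k\<in>{1..int h}. f n i k j)
       = (\<Sum>j\<in>{1..int h}. A * A * mangoldt (nat (int n + j)))"
    proof (intro sum.cong refl)
      fix j
      have "A * A = (\<Sum>i\<in>{1..int h}. \<Sum>k\<in>{1..int h}.
          lam_sets (nat \<lfloor>R\<rfloor>) (int n + i) * lam_sets (nat \<lfloor>R\<rfloor>) (int n + k))"
        unfolding A_def by (rule sum_product)
      thus "(\<Sum>i\<in>{1..int h}. \<Sum>k\<in>{1..int h}. f n i k j) = A * A * mangoldt (nat (int n + j))"
        by (simp add: f_def sum_distrib_right)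
    qed
    also have "\<dots> = A * A * (\<Sum>j\<in>{1..int h}. mangoldt (nat (int n + j)))"
      by (simp only: sum_distrib_left)
    finally show "A ^ (3 - 1) * (\<Sum>j\<in>{1..int h}. mangoldt (nat (int n + j)))
       = (\<Sum>j\<in>{1..int h}. \<Sum>i\<in>{1..int h}. \<Sum>k\<in>{1..int h}. f n i k j)"
      by (simp add: power2_eq_square)
  qed
  also have "\<dots> = (\<Sum>j\<in>{1..int h}. \<Sum>n=1..N. \<Sum>i\<in>{1..int h}. \<Sum>k\<in>{1..int h}. f n i k j)"
    by (rule sum.swap)
  also have "\<dots> = (\<Sum>j\<in>{1..int h}. \<Sum>i\<in>{1..int h}. \<Sum>n=1..N. \<Sum>k\<in>{1..int h}. f n i k j)"
    by (intro sum.cong refl sum.swap)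
  also have "\<dots> = (\<Sum>j\<in>{1..int h}. \<Sum>i\<in>{1..int h}. \<Sum>k\<in>{1..int h}. \<Sum>n=1..N. f n i k j)"
    by (intro sum.cong refl sum.swap)
  finally show ?thesis by (simp add: corr_sum_def f_def)
qed

text \<open>Each local factor has absolute value at most 1. The bound is crude, but it is applied
  only to the few boundary terms of the shift.\<close>

lemma abs_lam_sets_le: "\<bar>lam_sets X n\<bar> \<le> real X"
proof -
  have "\<bar>lam_sets X n\<bar> \<le> (\<Sum>S\<in>prime_sets X. 1)"
    unfolding lam_sets_def
  proof (intro order.trans[OF sum_abs] sum_mono)
    fix S assume S: "S \<in> prime_sets X"
    show "\<bar>\<Prod>p\<in>S. sp p n / (real p - 1)\<bar> \<le> 1"
      unfolding abs_prod
    proof (intro prod_le_1 conjI)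
      fix p assume "p \<in> S"
      hence "real p \<ge> 2" using prime_setsD(2)[OF S] prime_ge_2_nat by auto
      thus "\<bar>sp p n / (real p - 1)\<bar> \<le> 1" by (simp add: sp_def)
    qed auto
  qed
  also have "\<dots> \<le> (\<Sum>n=1..X. 1)" by (rule sum_prime_sets_le[where f = "\<lambda>_. 1"]) auto
  finally show ?thesis by simp
qed

text \<open>Substituting \<open>m = n + j\<close> moves the window from \<open>{1..N}\<close> to
  \<open>{j + 1..N + j}\<close>; the two windows differ by two pieces of at most \<open>h\<close>
  terms, which are estimated trivially.\<close>

lemma corr_sum_shift:
  assumes ikj: "j \<in> {1..int h}" and N: "N \<ge> 1"
  shows "\<bar>corr_sum N X Y i k j - (\<Sum>m=1..N. mangoldt m * (lam_sets X (int m + (i - j)) * lam_sets Y (int m + (k - j))))\<bar>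
           \<le> 2 * real h * ln (real N + real h) * real (X * Y)"
proof -
  define J where "J = nat j"
  have J: "int J = j" "J \<le> h" using ikj by (auto simp: J_def)
  define g where "g m = mangoldt m * (lam_sets X (int m + (i - j)) * lam_sets Y (int m + (k - j)))" for m
  have cs: "corr_sum N X Y i k j = (\<Sum>m=J+1..N+J. g m)"
    unfolding corr_sum_def g_def
    by (rule sum.reindex_bij_witness[of _ "\<lambda>m. m - J" "\<lambda>n. n + J"])
       (auto simp: J(1)[symmetric] nat_add_distrib mult_ac of_nat_diff algebra_simps)
  have split: "(\<Sum>m=1..J. g m) + (\<Sum>m=J+1..N+J. g m) = (\<Sum>m=1..N. g m) + (\<Sum>m=N+1..N+J. g m)"
  proof -
    have "(\<Sum>m=1..J. g m) + (\<Sum>m=J+1..N+J. g m) = (\<Sum>m\<in>{1..J} \<union> {J+1..N+J}. g m)"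
      by (subst sum.union_disjoint) auto
    also have "{1..J} \<union> {J+1..N+J} = {1..N} \<union> {N+1..N+J}" by auto
    also have "(\<Sum>m\<in>\<dots>. g m) = (\<Sum>m=1..N. g m) + (\<Sum>m=N+1..N+J. g m)"
      by (subst sum.union_disjoint) auto
    finally show ?thesis .
  qed
  have bound: "\<bar>\<Sum>m\<in>A. g m\<bar> \<le> real h * (ln (real N + real h) * real (X * Y))"
    if "A \<subseteq> {1..N+h}" "card A \<le> h" for A
  proof -
    have "\<bar>\<Sum>m\<in>A. g m\<bar> \<le> (\<Sum>m\<in>A. ln (real N + real h) * real (X * Y))"
    proof (intro order.trans[OF sum_abs] sum_mono)
      fix m assume "m \<in> A"
      hence m: "m \<ge> 1" "m \<le> N + h" using that by auto
      have "mangoldt m \<le> ln (real m)" using m by (intro mangoldt_le) auto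
      also have "\<dots> \<le> ln (real N + real h)" using m by simp
      finally have "mangoldt m \<le> ln (real N + real h)" .
      moreover have "\<bar>lam_sets X (int m + (i - j)) * lam_sets Y (int m + (k - j))\<bar> \<le> real X * real Y"
        unfolding abs_mult by (intro mult_mono abs_lam_sets_le) auto
      ultimately show "\<bar>g m\<bar> \<le> ln (real N + real h) * real (X * Y)"
        unfolding g_def abs_mult[of "mangoldt m"] using mangoldt_nonneg[of m]
        by (simp only: of_nat_mult) (intro mult_mono; simp)
    qed
    also have "\<dots> = real (card A) * (ln (real N + real h) * real (X * Y))" by simp
    also have "\<dots> \<le> real h * (ln (real N + real h) * real (X * Y))"
      using that N by (intro mult_right_mono mult_nonneg_nonneg) auto
    finally show ?thesis .
  qed
  have "\<bar>\<Sum>m=1..J. g m\<bar> \<le> real h * (ln (real N + real h) * real (X * Y))"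
    by (rule bound) (use J in auto)
  moreover have "\<bar>\<Sum>m=N+1..N+J. g m\<bar> \<le> real h * (ln (real N + real h) * real (X * Y))"
    by (rule bound) (use J in auto)
  ultimately have "\<bar>corr_sum N X Y i k j - (\<Sum>m=1..N. g m)\<bar>
      \<le> 2 * (real h * (ln (real N + real h) * real (X * Y)))"
    using cs split by linarith
  thus ?thesis unfolding g_def by (simp only: mult.assoc)
qed

text \<open>The number of admissible shifts is \<open>h \<le> C ln N\<close>, so the boundary terms of the shift are
  negligible because \<open>X * Y\<close> is at most a power of \<open>N\<close> with exponent less than 1.\<close>

lemma corr_sum_approx:
  assumes EH: "EH \<theta>" and \<theta>: "\<theta> \<le> 1" "\<theta>' < \<theta>" and \<epsilon>: "\<epsilon> > 0" and C: "C > 0"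
  shows "\<forall>\<^sub>F N in at_top. \<forall>X Y h i k j. X \<ge> 1 \<longrightarrow> Y \<ge> 1 \<longrightarrow> real (X * Y) \<le> real N powr \<theta>' \<longrightarrow>
    real h \<le> C * ln (real N) \<longrightarrow> j \<in> {1..int h} \<longrightarrow>
    \<bar>corr_sum N X Y i k j - real N * corr X Y (i - j) (k - j)\<bar> \<le> \<epsilon> * real N"
proof -
  define \<delta> where "\<delta> = 1 - \<theta>'"
  have \<delta>: "\<delta> > 0" using \<theta> by (simp add: \<delta>_def)
  have "((\<lambda>N. 2 * (C * ln (real N)) * ln (real N + C * ln (real N)) / real N powr \<delta>) \<longlongrightarrow> 0) at_top"
    using \<delta> C by real_asymp
  hence "\<forall>\<^sub>F N in at_top. 2 * (C * ln (real N)) * ln (real N + C * ln (real N)) / real N powr \<delta> < \<epsilon> / 2"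
    using \<epsilon> by (intro order_tendstoD(2)[of _ 0]) auto
  moreover have "\<forall>\<^sub>F N in at_top. N \<ge> (1 :: nat)" by (rule eventually_ge_at_top)
  moreover have "\<forall>\<^sub>F N in at_top. \<forall>X Y a b. X \<ge> 1 \<longrightarrow> Y \<ge> 1 \<longrightarrow> real (X * Y) \<le> real N powr \<theta>' \<longrightarrow>
    \<bar>(\<Sum>m=1..N. mangoldt m * (lam_sets X (int m + a) * lam_sets Y (int m + b))) - real N * corr X Y a b\<bar>
      \<le> \<epsilon> / 2 * real N"
    using \<epsilon> by (intro corr_approx_EH[OF EH \<theta>]) auto
  ultimately show ?thesis
  proof eventually_elim
    case (elim N)
    show ?case
    proof (intro allI impI)
      fix X Y h i k j
      assume XY: "X \<ge> 1" "Y \<ge> 1" "real (X * Y) \<le> real N powr \<theta>'" and h: "real h \<le> C * ln (real N)" and j: "j \<in> {1..int h}"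
      define G where "G = (\<Sum>m=1..N. mangoldt m * (lam_sets X (int m + (i - j)) * lam_sets Y (int m + (k - j))))"
      have "\<bar>corr_sum N X Y i k j - G\<bar> \<le> 2 * real h * ln (real N + real h) * real (X * Y)"
        unfolding G_def by (rule corr_sum_shift[OF j elim(2)])
      also have "\<dots> \<le> 2 * (C * ln (real N)) * ln (real N + C * ln (real N)) * real N powr \<theta>'"
        using h elim(2) XY(3) C by (intro mult_mono mult_nonneg_nonneg) auto
      also have "real N powr \<theta>' = real N * (1 / real N powr \<delta>)"
        using elim(2) by (simp add: \<delta>_def powr_diff)
      also have "2 * (C * ln (real N)) * ln (real N + C * ln (real N)) * (real N * (1 / real N powr \<delta>))
          = real N * (2 * (C * ln (real N)) * ln (real N + C * ln (real N)) / real N powr \<delta>)" by simp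
      also have "\<dots> \<le> real N * (\<epsilon> / 2)" using elim(1) by (intro mult_left_mono) auto
      finally have 1: "\<bar>corr_sum N X Y i k j - G\<bar> \<le> real N * (\<epsilon> / 2)" .
      have 2: "\<bar>G - real N * corr X Y (i - j) (k - j)\<bar> \<le> \<epsilon> / 2 * real N"
        unfolding G_def using elim(3) XY by blast
      show "\<bar>corr_sum N X Y i k j - real N * corr X Y (i - j) (k - j)\<bar> \<le> \<epsilon> * real N"
      proof -
        have "\<epsilon> * real N = real N * (\<epsilon> / 2) + \<epsilon> / 2 * real N" by simp
        thus ?thesis using 1 2 by linarith
      qed
    qed
  qed
qed

lemma L_sum_powr_asymp:
  assumes "\<theta> > 0"
  shows "(\<lambda>N. L_sum (nat \<lfloor>real N powr \<theta>\<rfloor>)) \<sim>[at_top] (\<lambda>N. \<theta> * ln (real N))"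
proof -
  define X where "X N = nat \<lfloor>real N powr \<theta>\<rfloor>" for N :: nat
  have lim: "filterlim (\<lambda>N :: nat. real N powr \<theta>) at_top at_top" using assms by real_asymp
  have X: "filterlim X at_top at_top"
    unfolding X_def by (rule filterlim_compose[OF filterlim_nat_sequentially filterlim_compose[OF filterlim_floor_sequentially lim]])
  have "(\<lambda>N. ln (real (X N))) \<sim>[at_top] (\<lambda>N. \<theta> * ln (real N))"
  proof (rule asymp_equiv_sandwich_real)
    show "(\<lambda>N. ln (real N powr \<theta> - 1)) \<sim>[at_top] (\<lambda>N. \<theta> * ln (real N))"
      using assms by real_asymp
    show "(\<lambda>N. ln (real N powr \<theta>)) \<sim>[at_top] (\<lambda>N. \<theta> * ln (real N))"
      using assms by real_asymp
    have "\<forall>\<^sub>F N in at_top. real N powr \<theta> > 2" using lim by (simp add: filterlim_at_top_dense)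
    thus "\<forall>\<^sub>F N in at_top. ln (real (X N)) \<in> {ln (real N powr \<theta> - 1)..ln (real N powr \<theta>)}"
    proof eventually_elim
      case (elim N)
      have "real N powr \<theta> - 1 \<le> real (X N)" "real (X N) \<le> real N powr \<theta>"
        using elim unfolding X_def by linarith+
      hence "ln (real N powr \<theta> - 1) \<le> ln (real (X N))" "ln (real (X N)) \<le> ln (real N powr \<theta>)"
        using elim by (subst ln_le_cancel_iff; linarith)+
      thus ?case unfolding atLeastAtMost_iff by (rule conjI)
    qed
  qed
  moreover have "(\<lambda>N. L_sum (X N)) \<sim>[at_top] (\<lambda>N. ln (real (X N)))"
  proof (rule asymp_equivI')
    show "((\<lambda>N. L_sum (X N) / ln (real (X N))) \<longlongrightarrow> 1) at_top"
      using filterlim_compose[OF L_sum_asymp X] .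
  qed
  ultimately show ?thesis unfolding X_def using asymp_equiv_trans by blast
qed

lemma abs_diff_scale:
  fixes c a b :: real
  assumes "c \<ge> 0"
  shows "\<bar>c * a - c * b\<bar> = c * \<bar>a - b\<bar>"
  using assms by (simp add: abs_mult flip: right_diff_distrib)

text \<open>The coefficients 1, 3, 1 count the partitions of the three shifts \<open>i\<close>,
  \<open>k\<close>, \<open>j\<close>: all equal gives \<open>L_sum X ^ 2\<close>, each of the three
  ways of identifying just two gives one \<open>L_sum X\<close>, and distinct shifts give
  none.\<close>

lemma corr_total:
  "\<exists>K>0. \<forall>X\<ge>1. \<forall>h. \<bar>(\<Sum>j\<in>{1..int h}. \<Sum>i\<in>{1..int h}. \<Sum>k\<in>{1..int h}. corr X X (i - j) (k - j))
      - (real h * L_sum X ^ 2 + 3 * real h ^ 2 * L_sum X + real h ^ 3)\<bar>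
    \<le> K * (L_sum X * real h powr (7/4) + real h powr (35/12))"
proof -
  obtain K1 where K1: "K1 > 0" "\<And>X h. X \<ge> 1 \<Longrightarrow>
    \<bar>(\<Sum>i\<in>{1..int h}. \<Sum>j\<in>{1..int h} - {i}. corr1 X (j - i)) - real h * (real h - 1)\<bar> \<le> K1 * real h powr (7/4)"
    using sum_corr1 by blast
  obtain K2 where K2: "K2 > 0" "\<And>X h. X \<ge> 1 \<Longrightarrow>
    \<bar>(\<Sum>j\<in>{1..int h}. \<Sum>i\<in>{1..int h} - {j}. corr X X (i - j) (i - j)) - L_sum X * (real h * (real h - 1))\<bar>
      \<le> K2 * L_sum X * real h powr (7/4)"
    using sum_corr_diag by blast
  obtain K3 where K3: "K3 > 0" "\<And>X h. X \<ge> 1 \<Longrightarrow>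
    \<bar>(\<Sum>j\<in>{1..int h}. \<Sum>i\<in>{1..int h} - {j}. \<Sum>k\<in>{1..int h} - {j, i}. corr X X (i - j) (k - j))
      - real h * (real h - 1) * (real h - 2)\<bar> \<le> K3 * real h powr (35/12)"
    using sum_corr_distinct by blast
  define K where "K = 3 + 2 * K1 + K2 + K3 + 5"
  have "\<bar>(\<Sum>j\<in>{1..int h}. \<Sum>i\<in>{1..int h}. \<Sum>k\<in>{1..int h}. corr X X (i - j) (k - j))
      - (real h * L_sum X ^ 2 + 3 * real h ^ 2 * L_sum X + real h ^ 3)\<bar>
    \<le> K * (L_sum X * real h powr (7/4) + real h powr (35/12))" if X: "X \<ge> 1" for X h
  proof -
    define L where "L = L_sum X"
    have L: "L \<ge> 0" using L_sum_nonneg by (simp add: L_def)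
    define H where "H = real h"
    define I where "I = {1..int h}"
    define B where "B = (\<Sum>j\<in>I. \<Sum>k\<in>I - {j}. corr1 X (k - j))"
    define C where "C = (\<Sum>j\<in>I. \<Sum>i\<in>I - {j}. corr X X (i - j) (i - j))"
    define D where "D = (\<Sum>j\<in>I. \<Sum>i\<in>I - {j}. \<Sum>k\<in>I - {j, i}. corr X X (i - j) (k - j))"
    have "(\<Sum>j\<in>I. \<Sum>i\<in>I. \<Sum>k\<in>I. corr X X (i - j) (k - j))
      = (\<Sum>j\<in>I. L * L + L * (\<Sum>k\<in>I - {j}. corr1 X (k - j)) + L * (\<Sum>i\<in>I - {j}. corr1 X (i - j))
         + (\<Sum>i\<in>I - {j}. corr X X (i - j) (i - j)) + (\<Sum>i\<in>I - {j}. \<Sum>k\<in>I - {j, i}. corr X X (i - j) (k - j)))"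
    proof (intro sum.cong refl)
      fix j assume j: "j \<in> I"
      have "(\<Sum>i\<in>I. \<Sum>k\<in>I. corr X X (i - j) (k - j)) = corr X X (j - j) (j - j)
        + (\<Sum>k\<in>I - {j}. corr X X (j - j) (k - j)) + (\<Sum>i\<in>I - {j}. corr X X (i - j) (j - j))
        + (\<Sum>i\<in>I - {j}. corr X X (i - j) (i - j)) + (\<Sum>i\<in>I - {j}. \<Sum>k\<in>I - {j, i}. corr X X (i - j) (k - j))"
        using j by (intro sum_pairs_split) (auto simp: I_def)
      thus "(\<Sum>i\<in>I. \<Sum>k\<in>I. corr X X (i - j) (k - j)) = L * L + L * (\<Sum>k\<in>I - {j}. corr1 X (k - j)) + L * (\<Sum>i\<in>I - {j}. corr1 X (i - j))
         + (\<Sum>i\<in>I - {j}. corr X X (i - j) (i - j)) + (\<Sum>i\<in>I - {j}. \<Sum>k\<in>I - {j, i}. corr X X (i - j) (k - j))"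
        by (simp add: corr_0 corr1_0 L_def sum_distrib_left mult.commute)
    qed
    also have "\<dots> = H * L ^ 2 + 2 * (L * B) + C + D"
      by (simp add: sum.distrib B_def C_def D_def I_def H_def power2_eq_square flip: sum_distrib_left)
    finally have eq: "(\<Sum>j\<in>I. \<Sum>i\<in>I. \<Sum>k\<in>I. corr X X (i - j) (k - j)) = H * L ^ 2 + 2 * (L * B) + C + D" .
    define p1 p2 where "p1 = H powr (7/4)" and "p2 = H powr (35/12)"
    have b1: "H \<le> p1" "H ^ 2 \<le> p2" "H \<le> H ^ 2"
    proof -
      show "H \<le> p1"
      proof (cases "h = 0")
        case False
        hence "H powr 1 \<le> H powr (7/4)" unfolding H_def by (intro powr_mono) auto
        thus ?thesis using False by (simp add: H_def p1_def)
      qed (simp add: H_def p1_def)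
      show "H ^ 2 \<le> p2"
      proof (cases "h = 0")
        case False
        hence "H powr 2 \<le> H powr (35/12)" unfolding H_def by (intro powr_mono) auto
        thus ?thesis using False by (simp add: H_def p2_def)
      qed (simp add: H_def p2_def)
      show "H \<le> H ^ 2" by (cases "h = 0") (simp_all add: H_def power2_eq_square)
    qed
    have H0: "H \<ge> 0" by (simp add: H_def)
    have cB: "\<bar>B - H * (H - 1)\<bar> \<le> K1 * p1" using K1(2)[OF X, of h] by (simp add: B_def I_def H_def p1_def)
    have cC: "\<bar>C - L * (H * (H - 1))\<bar> \<le> K2 * L * p1" using K2(2)[OF X, of h] by (simp add: C_def I_def H_def p1_def L_def)
    have cD: "\<bar>D - H * (H - 1) * (H - 2)\<bar> \<le> K3 * p2" using K3(2)[OF X, of h] by (simp add: D_def I_def H_def p2_def)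
    have B2: "\<bar>L * B - L * (H * (H - 1))\<bar> \<le> K1 * L * p1"
      using mult_left_mono[OF cB L] unfolding abs_diff_scale[OF L] by (simp only: mult_ac)
    have Lp: "L * H \<le> L * p1" using b1 L by (intro mult_left_mono) auto
    have LH0: "L * H \<ge> 0" using L H0 by simp
    have e1: "L * (H * (H - 1)) = L * H ^ 2 - L * H" by (simp add: algebra_simps power2_eq_square)
    have e2: "H * (H - 1) * (H - 2) = H ^ 3 - 3 * H ^ 2 + 2 * H" by (simp add: algebra_simps eval_nat_numeral)
    \<comment> \<open>Replacing \<open>H * (H - 1)\<close> by \<open>H ^ 2\<close> in three terms
      costs \<open>3 * L * H\<close>; replacing \<open>H * (H - 1) * (H - 2)\<close> by
      \<open>H ^ 3\<close> costs at most \<open>3 * H ^ 2 + 2 * H \<le> 5 * H ^ 2\<close>.\<close>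
    have "\<bar>(H * L ^ 2 + 2 * (L * B) + C + D) - (H * L ^ 2 + 3 * (L * H ^ 2) + H ^ 3)\<bar>
       \<le> 2 * (K1 * L * p1) + K2 * L * p1 + K3 * p2 + 3 * (L * p1) + 5 * p2"
      using B2 cC cD Lp LH0 b1 H0 unfolding e1 e2 by linarith
    also have "\<dots> = (3 + 2 * K1 + K2) * (L * p1) + (K3 + 5) * p2" by (simp add: algebra_simps)
    also have "\<dots> \<le> K * (L * p1) + K * p2"
      unfolding K_def using K1(1) K2(1) K3(1) L
      by (intro add_mono[OF mult_right_mono mult_right_mono]) (auto simp: p1_def p2_def)
    finally show ?thesis unfolding eq[unfolded I_def] by (simp add: H_def L_def p1_def p2_def distrib_left mult_ac)
  qed
  moreover have "K > 0" using K1 K2 K3 by (simp add: K_def)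
  ultimately show ?thesis by blast
qed

lemma corr1_total:
  "\<exists>K>0. \<forall>X\<ge>1. \<forall>h. \<bar>(\<Sum>j\<in>{1..int h}. \<Sum>i\<in>{1..int h}. corr1 X (i - j)) - (real h * L_sum X + real h ^ 2)\<bar>
    \<le> K * real h powr (7/4)"
proof -
  obtain K1 where K1: "K1 > 0" "\<And>X h. X \<ge> 1 \<Longrightarrow>
    \<bar>(\<Sum>i\<in>{1..int h}. \<Sum>j\<in>{1..int h} - {i}. corr1 X (j - i)) - real h * (real h - 1)\<bar> \<le> K1 * real h powr (7/4)"
    using sum_corr1 by blast
  have "\<bar>(\<Sum>j\<in>{1..int h}. \<Sum>i\<in>{1..int h}. corr1 X (i - j)) - (real h * L_sum X + real h ^ 2)\<bar>
    \<le> (K1 + 1) * real h powr (7/4)" if X: "X \<ge> 1" for X h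
  proof -
    define B where "B = (\<Sum>j\<in>{1..int h}. \<Sum>i\<in>{1..int h} - {j}. corr1 X (i - j))"
    have "(\<Sum>j\<in>{1..int h}. \<Sum>i\<in>{1..int h}. corr1 X (i - j)) = (\<Sum>j\<in>{1..int h}. L_sum X + (\<Sum>i\<in>{1..int h} - {j}. corr1 X (i - j)))"
    proof (intro sum.cong refl)
      fix j assume "j \<in> {1..int h}"
      hence "(\<Sum>i\<in>{1..int h}. corr1 X (i - j)) = corr1 X (j - j) + (\<Sum>i\<in>{1..int h} - {j}. corr1 X (i - j))"
        by (intro sum.remove) auto
      thus "(\<Sum>i\<in>{1..int h}. corr1 X (i - j)) = L_sum X + (\<Sum>i\<in>{1..int h} - {j}. corr1 X (i - j))"
        by (simp add: corr1_0)
    qed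
    also have "\<dots> = real h * L_sum X + B" by (simp add: sum.distrib B_def)
    finally have eq: "(\<Sum>j\<in>{1..int h}. \<Sum>i\<in>{1..int h}. corr1 X (i - j)) = real h * L_sum X + B" .
    have "\<bar>B - real h * (real h - 1)\<bar> \<le> K1 * real h powr (7/4)"
      using K1(2)[OF X, of h] by (simp add: B_def)
    moreover have "real h \<le> real h powr (7/4)"
    proof (cases "h = 0")
      case False
      hence "real h powr 1 \<le> real h powr (7/4)" by (intro powr_mono) auto
      thus ?thesis using False by simp
    qed simp
    moreover have "real h * (real h - 1) = real h ^ 2 - real h" by (simp add: algebra_simps power2_eq_square)
    ultimately show ?thesis unfolding eq distrib_right by linarith
  qed
  thus ?thesis using K1(1) by (intro exI[of _ "K1 + 1"]) auto
qed

section \<open>The three moments, with errors relative to the term of degree one in h\<close>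

lemma floor_powr_ge_1: "N \<ge> 1 \<Longrightarrow> t \<ge> 0 \<Longrightarrow> nat \<lfloor>real N powr t\<rfloor> \<ge> 1"
  using ge_one_powr_ge_zero[of "real N" t] by (simp add: le_nat_floor)

lemma floor_powr_le: "real (nat \<lfloor>real N powr t\<rfloor>) \<le> real N powr t"
  by (simp add: of_nat_nat)

lemma M_tilde_1_approx:
  assumes EH: "EH \<theta>" and \<theta>: "0 < \<theta>" "\<theta> \<le> 1" and C: "C > 0" "\<forall>\<^sub>F N in at_top. real (h N) \<le> C * ln (real N)"
  shows "(\<lambda>N. M_tilde 1 N (h N) (psi_R (R N)) - real N * real (h N)) \<in> o(\<lambda>N. real N * real (h N))"
proof (rule landau_o.smallI)
  fix c :: real assume c: "c > 0"
  \<comment> \<open>With \<open>X = Y = 1\<close> any nonnegative exponent below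
    \<open>\<theta>\<close> would serve.\<close>
  have "\<theta> / 2 < \<theta>" using \<theta> by simp
  note approx = corr_sum_approx[OF EH \<theta>(2) this c C(1)]
  have "\<forall>\<^sub>F N in at_top. N \<ge> (1 :: nat)" by (rule eventually_ge_at_top)
  with approx C(2) show "\<forall>\<^sub>F N in at_top. norm (M_tilde 1 N (h N) (psi_R (R N)) - real N * real (h N)) \<le> c * norm (real N * real (h N))"
  proof eventually_elim
    case (elim N)
    have one: "1 \<le> real N powr (\<theta> / 2)" using elim(3) \<theta> by (intro ge_one_powr_ge_zero) auto
    have "\<bar>M_tilde 1 N (h N) (psi_R (R N)) - real N * real (h N)\<bar> = \<bar>\<Sum>j\<in>{1..int (h N)}. (corr_sum N 1 1 j j j - real N)\<bar>"
      unfolding M_tilde_1 by (simp add: sum_subtractf mult.commute)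
    also have "\<dots> \<le> (\<Sum>j\<in>{1..int (h N)}. c * real N)"
    proof (intro order.trans[OF sum_abs] sum_mono)
      fix j assume j: "j \<in> {1..int (h N)}"
      have "\<bar>corr_sum N 1 1 j j j - real N * corr 1 1 (j - j) (j - j)\<bar> \<le> c * real N"
        using elim(1)[rule_format, of 1 1 "h N" j j j] elim(2) one j by simp
      moreover have "L_sum (Suc 0) = 1" by (simp add: L_sum_def prime_sets_1 prime_wt_def)
      ultimately show "\<bar>corr_sum N 1 1 j j j - real N\<bar> \<le> c * real N"
        by (simp add: corr_1_right corr1_0)
    qed
    finally show ?case by (simp add: mult_ac)
  qed
qed

lemma M_tilde_2_approx:
  assumes EH: "EH \<theta>" and \<theta>: "\<theta> \<le> 1" "0 < t" "t < \<theta>" and C: "C > 0" "\<forall>\<^sub>F N in at_top. real (h N) \<le> C * ln (real N)"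
  shows "(\<lambda>N. M_tilde 2 N (h N) (psi_R (real N powr t)) -
            real N * (real (h N) * L_sum (nat \<lfloor>real N powr t\<rfloor>) + real (h N) ^ 2)) \<in> o(\<lambda>N. real N * real (h N) * ln (real N))"
proof (rule landau_o.smallI)
  fix c :: real assume c: "c > 0"
  obtain K where K: "K > 0" "\<And>X h. X \<ge> 1 \<Longrightarrow>
    \<bar>(\<Sum>j\<in>{1..int h}. \<Sum>i\<in>{1..int h}. corr1 X (i - j)) - (real h * L_sum X + real h ^ 2)\<bar> \<le> K * real h powr (7/4)"
    using corr1_total by blast
  \<comment> \<open>The error is incurred for \<open>h ^ 2\<close> pairs of shifts, and one factor
    \<open>h\<close> is traded for \<open>C * ln N\<close>; this leaves \<open>c / 2\<close> times
    \<open>N * h * ln N\<close>.\<close>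
  have "c / (2 * C) > 0" using c C by simp
  note approx = corr_sum_approx[OF EH \<theta>(1,3) this C(1)]
  have "((\<lambda>N. K * (C * ln (real N)) powr (3/4) / ln (real N)) \<longlongrightarrow> 0) at_top"
    using C(1) by real_asymp
  hence "\<forall>\<^sub>F N in at_top. K * (C * ln (real N)) powr (3/4) / ln (real N) < c / 2"
    using c by (intro order_tendstoD(2)[of _ 0]) auto
  moreover have "\<forall>\<^sub>F N in at_top. N \<ge> (3 :: nat)" by (rule eventually_ge_at_top)
  ultimately show "\<forall>\<^sub>F N in at_top. norm (M_tilde 2 N (h N) (psi_R (real N powr t)) -
      real N * (real (h N) * L_sum (nat \<lfloor>real N powr t\<rfloor>) + real (h N) ^ 2)) \<le> c * norm (real N * real (h N) * ln (real N))"
    using approx C(2)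
  proof eventually_elim
    case (elim N)
    define X where "X = nat \<lfloor>real N powr t\<rfloor>"
    define l where "l = ln (real N)"
    define H where "H = real (h N)"
    have l: "l > 0" using elim(2) by (simp add: l_def)
    have X: "X \<ge> 1" "real (X * 1) \<le> real N powr t"
      using floor_powr_ge_1[of N t] floor_powr_le[of N t] elim(2) \<theta> by (auto simp: X_def)
    have HC: "H \<le> C * l" "H \<ge> 0" using elim(4) by (auto simp: l_def H_def)
    define T where "T = (\<Sum>j\<in>{1..int (h N)}. \<Sum>i\<in>{1..int (h N)}. corr1 X (i - j))"
    have p74: "H powr (7/4) \<le> H * (C * l) powr (3/4)"
    proof -
      have "H powr (1 + 3/4) = H powr 1 * H powr (3/4)" by (rule powr_add)
      also have "\<dots> \<le> H * (C * l) powr (3/4)"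
        using HC by (intro mult_mono powr_mono2) auto
      finally show ?thesis by simp
    qed
    have "\<bar>M_tilde 2 N (h N) (psi_R (real N powr t)) - real N * T\<bar>
       = \<bar>\<Sum>j\<in>{1..int (h N)}. \<Sum>i\<in>{1..int (h N)}. (corr_sum N X 1 i j j - real N * corr1 X (i - j))\<bar>"
      unfolding M_tilde_2 T_def X_def by (simp add: sum_subtractf sum_distrib_left)
    also have "\<dots> \<le> (\<Sum>j\<in>{1..int (h N)}. \<Sum>i\<in>{1..int (h N)}. c / (2 * C) * real N)"
    proof (intro order.trans[OF sum_abs] sum_mono)
      fix j i assume j: "j \<in> {1..int (h N)}"
      have "\<bar>corr_sum N X 1 i j j - real N * corr X 1 (i - j) (j - j)\<bar> \<le> c / (2 * C) * real N"
        using elim(3,4) X j by blast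
      thus "\<bar>corr_sum N X 1 i j j - real N * corr1 X (i - j)\<bar> \<le> c / (2 * C) * real N"
        by (simp add: corr_1_right)
    qed
    also have "\<dots> = H * (H * (c / (2 * C) * real N))" by (simp add: H_def)
    also have "\<dots> \<le> H * ((C * l) * (c / (2 * C) * real N))"
      using HC c C(1) by (intro mult_left_mono mult_right_mono) auto
    also have "\<dots> = c / 2 * (real N * H * l)" using C(1) by (simp add: field_simps)
    finally have 1: "\<bar>M_tilde 2 N (h N) (psi_R (real N powr t)) - real N * T\<bar> \<le> c / 2 * (real N * H * l)" .
    have "\<bar>T - (H * L_sum X + H ^ 2)\<bar> \<le> K * H powr (7/4)"
      using K(2)[OF X(1), of "h N"] by (simp add: T_def H_def)
    also have "\<dots> \<le> K * (H * (C * l) powr (3/4))" using p74 K(1) by (intro mult_left_mono) auto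
    also have "\<dots> = H * (K * (C * l) powr (3/4))" by simp
    also have "\<dots> \<le> H * (c / 2 * l)"
      using elim(1) l HC unfolding l_def[symmetric] by (intro mult_left_mono) (auto simp: pos_divide_less_eq)
    finally have "\<bar>T - (H * L_sum X + H ^ 2)\<bar> \<le> H * (c / 2 * l)" .
    hence "real N * \<bar>T - (H * L_sum X + H ^ 2)\<bar> \<le> real N * (H * (c / 2 * l))" by (intro mult_left_mono) auto
    hence 2: "\<bar>real N * T - real N * (H * L_sum X + H ^ 2)\<bar> \<le> c / 2 * (real N * H * l)"
      unfolding abs_diff_scale[OF of_nat_0_le_iff] by (simp only: mult_ac)
    have "\<bar>M_tilde 2 N (h N) (psi_R (real N powr t)) - real N * (H * L_sum X + H ^ 2)\<bar> \<le> c * (real N * H * l)"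
      using 1 2 by linarith
    thus ?case using l HC by (simp add: H_def X_def l_def abs_mult)
  qed
qed

lemma M_tilde_3_approx:
  assumes EH: "EH \<theta>" and \<theta>: "\<theta> \<le> 1" "0 < t" "t < \<theta> / 2" and C: "C > 0" "\<forall>\<^sub>F N in at_top. real (h N) \<le> C * ln (real N)"
  defines "L \<equiv> (\<lambda>N :: nat. L_sum (nat \<lfloor>real N powr t\<rfloor>))"
  shows "(\<lambda>N. M_tilde 3 N (h N) (psi_R (real N powr t)) -
            real N * (real (h N) * L N ^ 2 + 3 * real (h N) ^ 2 * L N + real (h N) ^ 3)) \<in> o(\<lambda>N. real N * real (h N) * ln (real N) ^ 2)"
proof (rule landau_o.smallI)
  fix c :: real assume c: "c > 0"
  obtain K where K: "K > 0" "\<And>X h. X \<ge> 1 \<Longrightarrow>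
    \<bar>(\<Sum>j\<in>{1..int h}. \<Sum>i\<in>{1..int h}. \<Sum>k\<in>{1..int h}. corr X X (i - j) (k - j))
      - (real h * L_sum X ^ 2 + 3 * real h ^ 2 * L_sum X + real h ^ 3)\<bar>
    \<le> K * (L_sum X * real h powr (7/4) + real h powr (35/12))"
    using corr_total by blast
  \<comment> \<open>Two of the three factors \<open>h\<close> are traded for
    \<open>C * ln N\<close>. The moduli reach \<open>X * X \<le> N powr (2 * t)\<close>, which is
    where \<open>t < \<theta> / 2\<close> enters.\<close>
  have "c / (2 * C ^ 2) > 0" "2 * t < \<theta>" using c C \<theta> by simp_all
  note approx = corr_sum_approx[OF EH \<theta>(1) this(2,1) C(1)]
  \<comment> \<open>After one factor \<open>h\<close> is taken out, the exponents of the logarithm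
    are 1 + 3/4 and 23/12, both below 2.\<close>
  have "((\<lambda>N. K * (2 * t * ln (real N) * (C * ln (real N)) powr (3/4) + (C * ln (real N)) powr (23/12)) / ln (real N) ^ 2) \<longlongrightarrow> 0) at_top"
    using C(1) \<theta>(2) by real_asymp
  hence "\<forall>\<^sub>F N in at_top. K * (2 * t * ln (real N) * (C * ln (real N)) powr (3/4) + (C * ln (real N)) powr (23/12)) / ln (real N) ^ 2 < c / 2"
    using c by (intro order_tendstoD(2)[of _ 0]) auto
  moreover have "\<forall>\<^sub>F N in at_top. N \<ge> (3 :: nat)" by (rule eventually_ge_at_top)
  moreover have "\<forall>\<^sub>F N in at_top. norm (L N) \<le> 2 * norm (t * ln (real N))"
    unfolding L_def using L_sum_powr_asymp[OF \<theta>(2)] by (rule asymp_equiv_imp_eventually_le) simp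
  ultimately show "\<forall>\<^sub>F N in at_top. norm (M_tilde 3 N (h N) (psi_R (real N powr t)) -
      real N * (real (h N) * L N ^ 2 + 3 * real (h N) ^ 2 * L N + real (h N) ^ 3)) \<le> c * norm (real N * real (h N) * ln (real N) ^ 2)"
    using approx C(2)
  proof eventually_elim
    case (elim N)
    define X where "X = nat \<lfloor>real N powr t\<rfloor>"
    define l where "l = ln (real N)"
    define H where "H = real (h N)"
    have l: "l > 0" using elim(2) by (simp add: l_def)
    have "real X * real X \<le> real N powr t * real N powr t"
      unfolding X_def by (intro mult_mono floor_powr_le) auto
    hence X: "X \<ge> 1" "real (X * X) \<le> real N powr (2 * t)"
      using floor_powr_ge_1[of N t] elim(2) \<theta> by (auto simp: X_def simp flip: powr_add)
    have LX: "L N = L_sum X" by (simp add: L_def X_def)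
    have L0: "L N \<ge> 0" "L N \<le> 2 * t * l"
      using elim(3) L_sum_nonneg[of X] \<theta>(2) l by (simp_all add: LX l_def abs_mult)
    have HC: "H \<le> C * l" "H \<ge> 0" using elim(5) by (auto simp: l_def H_def)
    define T where "T = (\<Sum>j\<in>{1..int (h N)}. \<Sum>i\<in>{1..int (h N)}. \<Sum>k\<in>{1..int (h N)}. corr X X (i - j) (k - j))"
    have p74: "H powr (7/4) \<le> H * (C * l) powr (3/4)"
    proof -
      have "H powr (1 + 3/4) = H powr 1 * H powr (3/4)" by (rule powr_add)
      also have "\<dots> \<le> H * (C * l) powr (3/4)"
        using HC by (intro mult_mono powr_mono2) auto
      finally show ?thesis by simp
    qed
    have p3512: "H powr (35/12) \<le> H * (C * l) powr (23/12)"
    proof -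
      have "H powr (1 + 23/12) = H powr 1 * H powr (23/12)" by (rule powr_add)
      also have "\<dots> \<le> H * (C * l) powr (23/12)"
        using HC by (intro mult_mono powr_mono2) auto
      finally show ?thesis by simp
    qed
    have "\<bar>M_tilde 3 N (h N) (psi_R (real N powr t)) - real N * T\<bar>
       = \<bar>\<Sum>j\<in>{1..int (h N)}. \<Sum>i\<in>{1..int (h N)}. \<Sum>k\<in>{1..int (h N)}. (corr_sum N X X i k j - real N * corr X X (i - j) (k - j))\<bar>"
      unfolding M_tilde_3 T_def X_def by (simp add: sum_subtractf sum_distrib_left)
    also have "\<dots> \<le> (\<Sum>j\<in>{1..int (h N)}. \<Sum>i\<in>{1..int (h N)}. \<Sum>k\<in>{1..int (h N)}. c / (2 * C ^ 2) * real N)"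
    proof (intro order.trans[OF sum_abs] sum_mono)
      fix j i k assume j: "j \<in> {1..int (h N)}"
      show "\<bar>corr_sum N X X i k j - real N * corr X X (i - j) (k - j)\<bar> \<le> c / (2 * C ^ 2) * real N"
        using elim(4,5) X j by blast
    qed
    also have "\<dots> = H * (H * H * (c / (2 * C ^ 2) * real N))" by (simp add: H_def)
    also have "\<dots> \<le> H * ((C * l) * (C * l) * (c / (2 * C ^ 2) * real N))"
      using HC c C(1) l by (intro mult_left_mono mult_right_mono mult_mono) auto
    also have "\<dots> = c / 2 * (real N * H * l ^ 2)" using C(1) by (simp add: field_simps power2_eq_square)
    finally have 1: "\<bar>M_tilde 3 N (h N) (psi_R (real N powr t)) - real N * T\<bar> \<le> c / 2 * (real N * H * l ^ 2)" .
    define P where "P = H * L N ^ 2 + 3 * H ^ 2 * L N + H ^ 3"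
    have "\<bar>T - P\<bar> \<le> K * (L N * H powr (7/4) + H powr (35/12))"
      using K(2)[OF X(1), of "h N"] by (simp add: T_def P_def H_def LX)
    also have "\<dots> \<le> K * ((2 * t * l) * (H * (C * l) powr (3/4)) + H * (C * l) powr (23/12))"
      using p74 p3512 K(1) L0 HC l \<theta>(2) by (intro mult_left_mono add_mono mult_mono) auto
    also have "\<dots> = H * (K * (2 * t * l * (C * l) powr (3/4) + (C * l) powr (23/12)))" by (simp add: algebra_simps)
    also have "\<dots> \<le> H * (c / 2 * l ^ 2)"
      using elim(1) l HC unfolding l_def[symmetric] by (intro mult_left_mono) (auto simp: pos_divide_less_eq)
    finally have "\<bar>T - P\<bar> \<le> H * (c / 2 * l ^ 2)" .
    hence "real N * \<bar>T - P\<bar> \<le> real N * (H * (c / 2 * l ^ 2))" by (intro mult_left_mono) auto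
    hence 2: "\<bar>real N * T - real N * P\<bar> \<le> c / 2 * (real N * H * l ^ 2)"
      unfolding abs_diff_scale[OF of_nat_0_le_iff] by (simp only: mult_ac)
    have "\<bar>M_tilde 3 N (h N) (psi_R (real N powr t)) - real N * P\<bar> \<le> c * (real N * H * l ^ 2)"
      using 1 2 by linarith
    thus ?case using l HC by (simp add: H_def l_def P_def abs_mult)
  qed
qed

text \<open>Nonnegativity excludes cancellation, so each summand is dominated by the sum and
  relative errors add up.\<close>

lemma asymp_equiv_add_nonneg:
  fixes f1 f2 g1 g2 :: "nat \<Rightarrow> real"
  assumes "f1 \<sim>[at_top] g1" "f2 \<sim>[at_top] g2"
    and "\<forall>\<^sub>F n in at_top. g1 n \<ge> 0" "\<forall>\<^sub>F n in at_top. g2 n \<ge> 0"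
  shows "(\<lambda>n. f1 n + f2 n) \<sim>[at_top] (\<lambda>n. g1 n + g2 n)"
proof -
  have "g1 \<in> O(\<lambda>n. g1 n + g2 n)" "g2 \<in> O(\<lambda>n. g1 n + g2 n)"
    by (rule bigoI[of _ 1], use assms(3,4) in eventually_elim, simp)+
  moreover have "(\<lambda>n. f1 n - g1 n) \<in> o(g1)" "(\<lambda>n. f2 n - g2 n) \<in> o(g2)"
    using assms(1,2) asymp_equiv_imp_diff_smallo by blast+
  ultimately have "(\<lambda>n. (f1 n - g1 n) + (f2 n - g2 n)) \<in> o(\<lambda>n. g1 n + g2 n)"
    by (intro sum_in_smallo(1)) (auto intro: landau_o.small_big_trans)
  thus ?thesis unfolding asymp_equiv_altdef by (simp add: algebra_simps)
qed

lemma asymp_equiv_of_diff: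
  fixes f g k :: "nat \<Rightarrow> real"
  assumes "(\<lambda>n. f n - g n) \<in> o(k)" "k \<in> O(t)" "g \<sim>[at_top] t"
  shows "f \<sim>[at_top] t"
proof -
  have "(\<lambda>n. (f n - g n) + (g n - t n)) \<in> o(t)"
    using assms asymp_equiv_imp_diff_smallo by (intro sum_in_smallo(1)) (auto intro: landau_o.small_big_trans)
  thus ?thesis unfolding asymp_equiv_altdef by simp
qed

theorem corollary2:
  fixes \<theta> \<theta>2 \<theta>3 :: real
    and lam :: "nat \<Rightarrow> real"
    and h :: "nat \<Rightarrow> nat"
    and R :: "nat \<Rightarrow> real"
  assumes "0 < \<theta>" and "\<theta> \<le> 1" and "EH \<theta>"
    and "\<And>N. 0 < lam N" and "lam \<in> O[at_top](\<lambda>_. 1)"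
    and "\<And>N. 0 < h N"
    and "(\<lambda>N. real (h N)) \<sim>[at_top] (\<lambda>N. lam N * ln (real N))"
    and "0 < \<theta>2" and "\<theta>2 < \<theta>"
    and "0 < \<theta>3" and "\<theta>3 < \<theta> / 2"
  shows "(\<lambda>N. M_tilde 1 N (h N) (psi_R (R N)))
           \<sim>[at_top] (\<lambda>N. lam N * real N * ln (real N))
       \<and> (\<lambda>N. M_tilde 2 N (h N) (psi_R (real N powr \<theta>2)))
           \<sim>[at_top] (\<lambda>N. (\<theta>2 * lam N + (lam N)\<^sup>2) * real N * (ln (real N))\<^sup>2)
       \<and> (\<lambda>N. M_tilde 3 N (h N) (psi_R (real N powr \<theta>3)))
           \<sim>[at_top] (\<lambda>N. (\<theta>3\<^sup>2 * lam N + 3 * \<theta>3 * (lam N)\<^sup>2 + (lam N) ^ 3)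
                            * real N * (ln (real N)) ^ 3)"
proof -
  define l where "l N = ln (real N)" for N :: nat
  define H where "H N = real (h N)" for N
  define x where "x N = lam N * l N" for N
  have l: "\<forall>\<^sub>F N in at_top. l N > 0"
    using eventually_ge_at_top[of "3 :: nat"] by eventually_elim (simp add: l_def)
  have Hx: "H \<sim>[at_top] x" using assms(7) by (simp add: H_def[abs_def] x_def[abs_def] l_def)
  have x0: "\<forall>\<^sub>F N in at_top. x N > 0"
    using l by eventually_elim (use assms(4) in \<open>simp add: x_def\<close>)
  obtain c where c: "c > 0" "\<forall>\<^sub>F N in at_top. norm (lam N) \<le> c * norm (1 :: real)"
    using assms(5) by (elim landau_o.bigE)
  \<comment> \<open>Boundedness of \<open>lam\<close> turns the asymptotic for \<open>h\<close> into
    a logarithmic upper bound; the 2 absorbs the asymptotic equivalence.\<close>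
  have hC: "\<forall>\<^sub>F N in at_top. real (h N) \<le> (2 * c) * ln (real N)"
    using asymp_equiv_imp_eventually_le[OF Hx, of 2, simplified] c(2) l
  proof eventually_elim
    case (elim N)
    have "H N \<le> 2 * (lam N * l N)" using elim assms(4)[of N] by (simp add: x_def abs_mult H_def)
    also have "\<dots> \<le> 2 * (c * l N)" using elim by (intro mult_left_mono mult_right_mono) auto
    finally show ?case by (simp add: H_def l_def)
  qed
  have c2: "2 * c > 0" using c by simp
  define Nx where "Nx N = real N * x N" for N
  have NHx: "(\<lambda>N. real N * H N) \<sim>[at_top] Nx"
    unfolding Nx_def using Hx by (intro asymp_equiv_intros)
  have "(\<lambda>N. M_tilde 1 N (h N) (psi_R (R N))) \<sim>[at_top] Nx"
    using M_tilde_1_approx[OF assms(3,1,2) c2 hC, of R] asymp_equiv_imp_bigo[OF NHx] NHx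
    unfolding H_def by (rule asymp_equiv_of_diff)
  hence M1: "(\<lambda>N. M_tilde 1 N (h N) (psi_R (R N))) \<sim>[at_top] (\<lambda>N. lam N * real N * ln (real N))"
    by (simp add: Nx_def[abs_def] x_def l_def mult_ac)
  define L2 where "L2 N = L_sum (nat \<lfloor>real N powr \<theta>2\<rfloor>)" for N
  define L3 where "L3 N = L_sum (nat \<lfloor>real N powr \<theta>3\<rfloor>)" for N
  have L2: "L2 \<sim>[at_top] (\<lambda>N. \<theta>2 * l N)" unfolding L2_def[abs_def] l_def by (rule L_sum_powr_asymp[OF assms(8)])
  have L3: "L3 \<sim>[at_top] (\<lambda>N. \<theta>3 * l N)" unfolding L3_def[abs_def] l_def by (rule L_sum_powr_asymp[OF assms(10)])
  define T2 where "T2 N = real N * (x N * (\<theta>2 * l N) + x N ^ 2)" for N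
  have "(\<lambda>N. M_tilde 2 N (h N) (psi_R (real N powr \<theta>2))) \<sim>[at_top] T2"
  proof (rule asymp_equiv_of_diff)
    show "(\<lambda>N. M_tilde 2 N (h N) (psi_R (real N powr \<theta>2)) - real N * (H N * L2 N + H N ^ 2)) \<in> o(\<lambda>N. real N * H N * l N)"
      unfolding H_def L2_def l_def by (rule M_tilde_2_approx[OF assms(3,2,8,9) c2 hC])
    show "(\<lambda>N. real N * (H N * L2 N + H N ^ 2)) \<sim>[at_top] T2"
      unfolding T2_def
    proof (intro asymp_equiv_mult asymp_equiv_refl asymp_equiv_add_nonneg asymp_equiv_power Hx L2)
      show "\<forall>\<^sub>F N in at_top. x N * (\<theta>2 * l N) \<ge> 0" using x0 l by eventually_elim (use assms(8) in simp)
    qed simp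
    have "(\<lambda>N. real N * H N * l N) \<in> O(\<lambda>N. Nx N * l N)"
      using asymp_equiv_imp_bigo[OF NHx] by (intro landau_o.big.mult) auto
    also have "(\<lambda>N. Nx N * l N) \<in> O(T2)"
    \<comment> \<open>Only the first term of \<open>T2\<close> is used: as \<open>lam\<close> may
      tend to 0, the term of degree one in \<open>x\<close> is the one guaranteed to dominate the
      error, with constant \<open>1 / \<theta>2\<close>.\<close>
    proof (rule bigoI)
      show "\<forall>\<^sub>F N in at_top. norm (Nx N * l N) \<le> 1 / \<theta>2 * norm (T2 N)"
        using x0 l
      proof eventually_elim
        case (elim N)
        have pos: "T2 N \<ge> 0" unfolding T2_def using elim assms(8) by (intro mult_nonneg_nonneg add_nonneg_nonneg) auto
        have "Nx N * l N * \<theta>2 \<le> T2 N" using elim by (simp add: Nx_def T2_def algebra_simps)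
        thus ?case using pos elim assms(8) by (simp add: field_simps Nx_def abs_mult)
      qed
    qed
    finally show "(\<lambda>N. real N * H N * l N) \<in> O(T2)" .
  qed
  hence M2: "(\<lambda>N. M_tilde 2 N (h N) (psi_R (real N powr \<theta>2)))
           \<sim>[at_top] (\<lambda>N. (\<theta>2 * lam N + (lam N)\<^sup>2) * real N * (ln (real N))\<^sup>2)"
    by (rule asymp_equiv_trans) (simp add: T2_def[abs_def] x_def l_def algebra_simps power2_eq_square)
  define T3 where "T3 N = real N * (x N * (\<theta>3 * l N) ^ 2 + 3 * x N ^ 2 * (\<theta>3 * l N) + x N ^ 3)" for N
  have "(\<lambda>N. M_tilde 3 N (h N) (psi_R (real N powr \<theta>3))) \<sim>[at_top] T3"
  proof (rule asymp_equiv_of_diff)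
    show "(\<lambda>N. M_tilde 3 N (h N) (psi_R (real N powr \<theta>3)) -
        real N * (H N * L3 N ^ 2 + 3 * H N ^ 2 * L3 N + H N ^ 3)) \<in> o(\<lambda>N. real N * H N * l N ^ 2)"
      unfolding H_def L3_def l_def by (rule M_tilde_3_approx[OF assms(3,2,10,11) c2 hC])
    show "(\<lambda>N. real N * (H N * L3 N ^ 2 + 3 * H N ^ 2 * L3 N + H N ^ 3)) \<sim>[at_top] T3"
      unfolding T3_def
    proof (intro asymp_equiv_mult asymp_equiv_refl asymp_equiv_add_nonneg asymp_equiv_power Hx L3)
      show "\<forall>\<^sub>F N in at_top. x N * (\<theta>3 * l N) ^ 2 \<ge> 0" using x0 l by eventually_elim simp
      show "\<forall>\<^sub>F N in at_top. 3 * x N ^ 2 * (\<theta>3 * l N) \<ge> 0" using x0 l by eventually_elim (use assms(10) in simp)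
      show "\<forall>\<^sub>F N in at_top. x N * (\<theta>3 * l N) ^ 2 + 3 * x N ^ 2 * (\<theta>3 * l N) \<ge> 0"
        using x0 l by eventually_elim (use assms(10) in simp)
      show "\<forall>\<^sub>F N in at_top. x N ^ 3 \<ge> 0" using x0 by eventually_elim simp
    qed
    have "(\<lambda>N. real N * H N * l N ^ 2) \<in> O(\<lambda>N. Nx N * l N ^ 2)"
      using asymp_equiv_imp_bigo[OF NHx] by (intro landau_o.big.mult) auto
    also have "(\<lambda>N. Nx N * l N ^ 2) \<in> O(T3)"
    proof (rule bigoI)
      show "\<forall>\<^sub>F N in at_top. norm (Nx N * l N ^ 2) \<le> 1 / \<theta>3 ^ 2 * norm (T3 N)"
        using x0 l
      proof eventually_elim
        case (elim N)
        have pos: "T3 N \<ge> 0" unfolding T3_def using elim assms(10) by (intro mult_nonneg_nonneg add_nonneg_nonneg) auto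
        have "Nx N * l N ^ 2 * \<theta>3 ^ 2 = real N * (x N * (\<theta>3 * l N) ^ 2)" by (simp add: Nx_def power_mult_distrib)
        also have "\<dots> \<le> T3 N" unfolding T3_def using elim assms(10) by (intro mult_left_mono) auto
        finally have "Nx N * l N ^ 2 * \<theta>3 ^ 2 \<le> T3 N" .
        hence "Nx N * l N ^ 2 \<le> T3 N / \<theta>3 ^ 2" using assms(10) by (simp add: pos_le_divide_eq)
        moreover have "Nx N * l N ^ 2 \<ge> 0" using elim by (simp add: Nx_def)
        ultimately show ?case using pos by simp
      qed
    qed
    finally show "(\<lambda>N. real N * H N * l N ^ 2) \<in> O(T3)" .
  qed
  hence M3: "(\<lambda>N. M_tilde 3 N (h N) (psi_R (real N powr \<theta>3)))
           \<sim>[at_top] (\<lambda>N. (\<theta>3\<^sup>2 * lam N + 3 * \<theta>3 * (lam N)\<^sup>2 + (lam N) ^ 3) * real N * (ln (real N)) ^ 3)"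
    by (rule asymp_equiv_trans) (simp add: T3_def[abs_def] x_def l_def algebra_simps eval_nat_numeral)
  show ?thesis using M1 M2 M3 by blast
qed

end
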